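(* Let $$g(s)=\sum_{n=2}^\infty\frac1{n\log n}\,n^{-s}.$$ Then $\mathbf{T}_g:\mathcal{H}^p\to\mathcal{H}^p$ is bounded for every $0<p<\infty$.
   Context: Let $(p_j)_{j\ge1}$ be the increasing sequence of primes; for $n=\prod_jp_j^{\kappa_j}$ put $\kappa(n)=(\kappa_1,\kappa_2,\dots)$. The Bohr lift of $f(s)=\sum_{n\ge1}a_nn^{-s}$ is $\mathcal{B}f(z)=\sum_{n\ge1}a_nz^{\kappa(n)}$. Let $m_\infty$ be the normalized Haar measure on $\mathbb{T}^\infty$. For $0<p<\infty$, $\mathcal{H}^p$ is the space of Dirichlet series $f$ with $\mathcal{B}f\in H^p(\mathbb{D}^\infty)$ (the closure in $L^p(\mathbb{T}^\infty)$ of the analytic polynomials in finitely many variables), with $\|f\|_{\mathcal{H}^p}=\left(\int_{\mathbb{T}^\infty}|\mathcal{B}f|^p\,dm_\infty\right)^{1/p}$. $\mathbf{T}_gf(s)=-\int_s^{+\infty}f(w)g'(w)\,dw$ (integral along the horizontal half-line from $s$, $\mathrm{Re}\,s>1/2$), which is again a Dirichlet series; it is bounded on $\mathcal{H}^p$ if it maps $\mathcal{H}^p$ into itself and $\sup_{\|f\|_{\mathcal{H}^p}\le1}\|\mathbf{T}_gf\|_{\mathcal{H}^p}<\infty$. *)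

theory Defs
  imports "HOL-Probability.Probability" "HOL-Computational_Algebra.Primes"
begin

text \<open>
  A (formal) Dirichlet series is given by its coefficients \<open>a :: nat \<Rightarrow> complex\<close>;
  the value \<open>a 0\<close> carries no meaning. In particular it does not contribute to
  \<open>dirichlet_term\<close>, because \<open>0 powr s = 0\<close>.
\<close>

definition dirichlet_term :: "(nat \<Rightarrow> complex) \<Rightarrow> complex \<Rightarrow> nat \<Rightarrow> complex" where
  "dirichlet_term a s n = a n * of_nat n powr (- s)"

definition dirichlet_fun :: "(nat \<Rightarrow> complex) \<Rightarrow> complex \<Rightarrow> complex" where
  "dirichlet_fun a s = (\<Sum>n. dirichlet_term a s n)"

definition circle_measure :: "complex measure" where
  "circle_measure =
     distr (uniform_measure lborel {0..<2 * pi}) (restrict_space borel (sphere 0 1)) cis"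

text \<open>
  The normalized Haar measure of the compact group \<open>\<T>\<^sup>\<infinity>\<close> is the
  countable product of the normalized arc length measures.
\<close>

definition torus_measure :: "(nat \<Rightarrow> complex) measure" where
  "torus_measure = Pi\<^sub>M UNIV (\<lambda>_. circle_measure)"

lemma cis_measurable_sphere:
  "cis \<in> uniform_measure lborel A \<rightarrow>\<^sub>M restrict_space borel (sphere 0 1)"
  by (rule measurable_restrict_space2)
     (auto simp: measurable_cong_sets[OF sets_uniform_measure refl]
           intro!: borel_measurable_continuous_onI continuous_intros)

lemma prob_space_circle_measure: "prob_space circle_measure"
  unfolding circle_measure_def
  by (rule prob_space.prob_space_distr[OF prob_space_uniform_measure cis_measurable_sphere]) auto

lemma prob_space_torus_measure: "prob_space torus_measure"
  unfolding torus_measure_def by (rule prob_space_PiM) (rule prob_space_circle_measure)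

lemma space_torus_measure: "space torus_measure = {z. \<forall>j. norm (z j) = 1}"
  by (auto simp: torus_measure_def circle_measure_def space_PiM PiE_iff space_restrict_space)

text \<open>The primes are enumerated increasingly from index \<open>0\<close>.\<close>

definition kappa :: "nat \<Rightarrow> nat \<Rightarrow> nat" where
  "kappa n j = multiplicity (enumerate {q. prime q} j) n"

definition monomial :: "(nat \<Rightarrow> nat) \<Rightarrow> (nat \<Rightarrow> complex) \<Rightarrow> complex" where
  "monomial \<alpha> z = (\<Prod>j\<in>{j. \<alpha> j \<noteq> 0}. z j ^ \<alpha> j)"

definition dirichlet_polynomial :: "(nat \<Rightarrow> complex) \<Rightarrow> bool" where
  "dirichlet_polynomial a \<longleftrightarrow> finite {n. a n \<noteq> 0}"

text \<open>
  Since \<open>kappa\<close> is a bijection from the positive integers onto the finitely supported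
  multi-indices, the Bohr lifts of the Dirichlet polynomials are exactly the analytic
  polynomials in finitely many of the variables \<open>z j\<close>.
\<close>

definition bohr_polynomial :: "(nat \<Rightarrow> complex) \<Rightarrow> (nat \<Rightarrow> complex) \<Rightarrow> complex" where
  "bohr_polynomial a z = (\<Sum>n\<in>{n. 1 \<le> n \<and> a n \<noteq> 0}. a n * monomial (kappa n) z)"

definition lp_functional :: "real \<Rightarrow> ((nat \<Rightarrow> complex) \<Rightarrow> complex) \<Rightarrow> real" where
  "lp_functional p F = (LINT z|torus_measure. norm (F z) powr p) powr (1 / p)"

text \<open>
  \<open>is_bohr_lift p f F\<close>: the function \<open>F\<close> lies in the closure of the analytic polynomials
  in \<open>L\<^sup>p(\<T>\<^sup>\<infinity>)\<close>, and \<open>f\<close> is its coefficient sequence.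
  For \<open>p < 1\<close> Fourier coefficients of \<open>F\<close> need not exist as integrals; the coefficients
  are the continuous extensions to the closure of the coefficient functionals on the
  polynomials, which are bounded for the \<open>L\<^sup>p\<close> quasinorm. (For \<open>p \<ge> 1\<close> they
  are the usual Fourier coefficients.)
\<close>

definition is_bohr_lift ::
  "real \<Rightarrow> (nat \<Rightarrow> complex) \<Rightarrow> ((nat \<Rightarrow> complex) \<Rightarrow> complex) \<Rightarrow> bool" where
  "is_bohr_lift p f F \<longleftrightarrow>
     F \<in> borel_measurable torus_measure \<and>
     integrable torus_measure (\<lambda>z. norm (F z) powr p) \<and>
     (\<exists>P :: nat \<Rightarrow> nat \<Rightarrow> complex.
        (\<forall>k. dirichlet_polynomial (P k)) \<and>
        (\<lambda>k. lp_functional p (\<lambda>z. F z - bohr_polynomial (P k) z)) \<longlonglongrightarrow> 0 \<and>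
        (\<forall>n\<ge>1. (\<lambda>k. P k n) \<longlonglongrightarrow> f n))"

definition hardy_space :: "real \<Rightarrow> (nat \<Rightarrow> complex) set" where
  "hardy_space p = {f. \<exists>F. is_bohr_lift p f F}"

text \<open>For \<open>f\<close> in the Hardy space, \<open>bohr_lift p f\<close> is unique up to null sets.\<close>

definition bohr_lift :: "real \<Rightarrow> (nat \<Rightarrow> complex) \<Rightarrow> (nat \<Rightarrow> complex) \<Rightarrow> complex" where
  "bohr_lift p f = (SOME F. is_bohr_lift p f F)"

definition hardy_norm :: "real \<Rightarrow> (nat \<Rightarrow> complex) \<Rightarrow> real" where
  "hardy_norm p f = lp_functional p (bohr_lift p f)"

definition volterra_integrand ::
  "(nat \<Rightarrow> complex) \<Rightarrow> (nat \<Rightarrow> complex) \<Rightarrow> complex \<Rightarrow> complex" where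
  "volterra_integrand g f w = dirichlet_fun f w * deriv (dirichlet_fun g) w"

definition volterra_fun ::
  "(nat \<Rightarrow> complex) \<Rightarrow> (nat \<Rightarrow> complex) \<Rightarrow> complex \<Rightarrow> complex" where
  "volterra_fun g f s = - (LINT t:{0..}|lborel. volterra_integrand g f (s + of_real t))"

text \<open>
  \<open>is_volterra g f h\<close>: the function \<open>volterra_fun g f\<close> is well defined in the half-plane
  \<open>Re s > 1/2\<close>, and there it is the sum of the Dirichlet series \<open>h\<close>.
\<close>

definition is_volterra ::
  "(nat \<Rightarrow> complex) \<Rightarrow> (nat \<Rightarrow> complex) \<Rightarrow> (nat \<Rightarrow> complex) \<Rightarrow> bool" where
  "is_volterra g f h \<longleftrightarrow>
     (\<forall>s. Re s > 1 / 2 \<longrightarrow>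
        summable (dirichlet_term f s) \<and>
        set_integrable lborel {0..} (\<lambda>t. volterra_integrand g f (s + of_real t)) \<and>
        dirichlet_term h s sums volterra_fun g f s)"

definition volterra_bounded :: "real \<Rightarrow> (nat \<Rightarrow> complex) \<Rightarrow> bool" where
  "volterra_bounded p g \<longleftrightarrow>
     (\<forall>f\<in>hardy_space p. \<exists>h\<in>hardy_space p. is_volterra g f h) \<and>
     bdd_above {hardy_norm p h | f h.
       f \<in> hardy_space p \<and> hardy_norm p f \<le> 1 \<and> h \<in> hardy_space p \<and> is_volterra g f h}"

end

theory Submission
  imports Defs "HOL-Complex_Analysis.Complex_Analysis"
begin

text \<open>
  The flow \<open>z\<^sub>j \<mapsto> p\<^sub>j powr (- \<i> t) z\<^sub>j\<close> preserves the Haar measure, and along its lines Bohr lifts become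
  functions on the half-plane \<open>Re s \<ge> 0\<close> whose means over the torus depend on \<open>\<sigma> = Re s\<close> only. Hence the
  mean of a bounded subharmonic function is convex and bounded in \<open>\<sigma>\<close>, so it decreases.

  For a truncation \<open>g\<close> of the symbol let \<open>L\<close> be the analytic function with \<open>Re L = \<bar>g\<bar>\<^sup>2\<close> on \<open>\<sigma> = 0\<close>. The
  function \<open>\<phi> = \<bar>g\<bar>\<^sup>2 - Re L\<close> has the Laplacian \<open>4 \<bar>g'\<bar>\<^sup>2\<close> and is bounded independently of the truncation; this
  is where the size of the coefficients \<open>1 / (n log n)\<close> enters. Let \<open>H' = f g'\<close>, \<open>q = p / 2\<close>,
  \<open>U = \<epsilon> + \<bar>f\<bar>\<^sup>2\<close> and \<open>V = \<epsilon> + \<bar>f\<bar>\<^sup>2 + \<bar>H\<bar>\<^sup>2\<close>. For \<open>q \<le> 1\<close> the function \<open>A e\<^sup>\<phi> U\<^sup>q + B U\<^sup>q - V\<^sup>q\<close> is subharmonic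
  for suitable \<open>A, B\<close>; for \<open>q \<ge> 1\<close> so is \<open>A e\<^sup>\<phi> U\<^sup>q + B e\<^sup>\<phi> V\<^sup>q - V\<^sup>q\<close> with \<open>V = \<epsilon> + \<bar>H\<bar>\<^sup>2\<close>. Comparing the means
  at \<open>\<sigma> = 0\<close> and \<open>\<sigma> = \<infinity>\<close> bounds the \<open>p\<close>-th mean of \<open>H\<close> by that of \<open>f\<close>.

  Weissler's inequality on the circle, applied prime by prime, turns a horizontal translation by \<open>\<delta> > 0\<close>
  into a bound of the \<open>2 q\<close>-th mean by the \<open>q\<close>-th. Iterating it controls \<open>\<Sum> \<bar>a\<^sub>n\<bar>\<^sup>2 n powr (- 2 \<delta>)\<close> by the
  \<open>p\<close>-th mean for every \<open>p\<close>, which gives convergence for \<open>Re s > 1 / 2\<close> and the uniqueness of Bohr lifts;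
  completeness of \<open>L\<^sup>p\<close> carries the estimate from polynomials to the whole space.
\<close>

section \<open>Monomials and the Haar measure\<close>

text \<open>The coefficients 1 / (n log n) are not summable, so |g|^2 is not bounded uniformly in
  the truncation and cannot itself be the exponent. Subtracting the harmonic function Re L keeps the
  Laplacian and removes the boundary values. L is read off by expanding |g|^2 into pairs (m, n): on
  \<sigma> = 0 a pair has the frequency ln m - ln n, and its real part extends boundedly to the
  right with the frequency ln max - ln min. What remains of a pair is of size max^(-\<sigma>)
  (min^\<sigma> - min^(-\<sigma>)). The number \<epsilon> keeps U and V away from 0, so that their
  powers are smooth at the zeros of f and H. There are two Bellman functions because the factor
  V^(q-1), produced by differentiating V^q, decreases in V for q \<le> 1 and increases for q \<ge>
  1: in the first case adding |f|^2 to V bounds it by U^(q-1), in the second it has to be split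
  between U and V. For p < 1 neither duality nor Fourier integrals are available. Coefficients are
  therefore reached through hypercontractivity, and limits are handled with p-th power means and a
  quasi-triangle inequality with constant 2^p.\<close>

lemma monomial_eq_prod:
  assumes "finite J" "\<And>j. \<alpha> j \<noteq> 0 \<Longrightarrow> j \<in> J"
  shows "monomial \<alpha> z = (\<Prod>j\<in>J. z j ^ \<alpha> j)"
  unfolding monomial_def
  by (rule prod.mono_neutral_left) (use assms in auto)

lemma monomial_add:
  assumes "finite {j. \<alpha> j \<noteq> 0}" "finite {j. \<beta> j \<noteq> 0}"
  shows "monomial (\<lambda>j. \<alpha> j + \<beta> j) z = monomial \<alpha> z * monomial \<beta> z"
  using assms
  by (subst (1 2 3) monomial_eq_prod[where J = "{j. \<alpha> j \<noteq> 0} \<union> {j. \<beta> j \<noteq> 0}"])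
     (auto simp: power_add prod.distrib)

lemma monomial_scale: "monomial \<alpha> (\<lambda>j. c j * z j) = monomial \<alpha> c * monomial \<alpha> z"
  by (simp add: monomial_def power_mult_distrib prod.distrib)

text \<open>Isolates the power of one coordinate; this is how a polynomial on the torus is later
  read as a polynomial in a single variable.\<close>

lemma monomial_fun_upd:
  assumes "finite {j. \<alpha> j \<noteq> 0}"
  shows "monomial \<alpha> (z(j := w)) = w ^ \<alpha> j * monomial (\<alpha>(j := 0)) z"
proof -
  let ?J = "{j. \<alpha> j \<noteq> 0}"
  have "monomial \<alpha> (z(j := w)) = (\<Prod>i\<in>insert j ?J. (z(j := w)) i ^ \<alpha> i)"
    using assms by (intro monomial_eq_prod) auto
  also have "\<dots> = w ^ \<alpha> j * (\<Prod>i\<in>?J - {j}. (z(j := w)) i ^ \<alpha> i)"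
    using assms by (subst prod.insert_remove) auto
  also have "(\<Prod>i\<in>?J - {j}. (z(j := w)) i ^ \<alpha> i) = (\<Prod>i\<in>?J - {j}. z i ^ (\<alpha>(j := 0)) i)"
    by (intro prod.cong) auto
  also have "\<dots> = monomial (\<alpha>(j := 0)) z"
    using assms by (intro monomial_eq_prod[symmetric]) (auto split: if_splits)
  finally show ?thesis .
qed

lemma norm_monomial: "z \<in> space torus_measure \<Longrightarrow> norm (monomial \<alpha> z) = 1"
  by (simp add: monomial_def space_torus_measure prod_norm[symmetric] norm_power)

section \<open>Prime exponents and the characters of the torus\<close>

abbreviation nth_prime :: "nat \<Rightarrow> nat" where
  "nth_prime j \<equiv> enumerate {q. prime q} j"

lemma prime_nth_prime: "prime (nth_prime j)"
  using enumerate_in_set[OF primes_infinite, of j] by simp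

lemma bij_nth_prime: "bij_betw nth_prime UNIV {q. prime q}"
  by (rule bij_enumerate) (rule primes_infinite)

lemma finite_kappa:
  assumes "n \<ge> 1"
  shows "finite {j. kappa n j \<noteq> 0}"
proof -
  have "{j. kappa n j \<noteq> 0} \<subseteq> nth_prime -` prime_factors n"
    using assms prime_nth_prime by (auto simp: kappa_def prime_factors_multiplicity)
  moreover have "finite (nth_prime -` prime_factors n)"
    by (rule finite_vimageI) (use bij_nth_prime bij_betw_imp_inj_on in auto)
  ultimately show ?thesis
    by (rule finite_subset)
qed

lemma kappa_mult: "m \<ge> 1 \<Longrightarrow> n \<ge> 1 \<Longrightarrow> kappa (m * n) = (\<lambda>j. kappa m j + kappa n j)"
  unfolding kappa_def
  by (intro ext prime_elem_multiplicity_mult_distrib) (simp_all add: prime_nth_prime)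

text \<open>The character of the torus attached to \<open>n\<close>, that is, the Bohr lift of
  n^(-s).\<close>

definition dchar :: "nat \<Rightarrow> (nat \<Rightarrow> complex) \<Rightarrow> complex" where
  "dchar n z = monomial (kappa n) z"

lemma dchar_1 [simp]: "dchar (Suc 0) z = 1"
  by (simp add: dchar_def monomial_def kappa_def)

lemma dchar_mult: "m \<ge> 1 \<Longrightarrow> n \<ge> 1 \<Longrightarrow> dchar (m * n) z = dchar m z * dchar n z"
  by (simp add: dchar_def kappa_mult monomial_add finite_kappa[simplified])

lemma norm_dchar: "z \<in> space torus_measure \<Longrightarrow> norm (dchar n z) = 1"
  by (simp add: dchar_def norm_monomial)

lemma prod_nth_prime_kappa:
  assumes "n \<ge> 1"
  shows "(\<Prod>j | kappa n j \<noteq> 0. nth_prime j ^ kappa n j) = n"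
proof -
  have "n = (\<Prod>p\<in>prime_factors n. p ^ multiplicity p n)"
    using assms by (intro prime_factorization_nat) auto
  also have "prime_factors n = nth_prime ` {j. kappa n j \<noteq> 0}"
  proof -
    have "p \<in> nth_prime ` {j. kappa n j \<noteq> 0}" if "p \<in> prime_factors n" for p
    proof -
      have "p \<in> nth_prime ` UNIV"
        using that bij_nth_prime by (auto simp: bij_betw_def)
      then show ?thesis
        using that by (auto simp: kappa_def prime_factors_multiplicity)
    qed
    then show ?thesis
      using assms prime_nth_prime by (auto simp: kappa_def prime_factors_multiplicity)
  qed
  also have "(\<Prod>p\<in>nth_prime ` {j. kappa n j \<noteq> 0}. p ^ multiplicity p n) =
      (\<Prod>j | kappa n j \<noteq> 0. nth_prime j ^ kappa n j)"
    using bij_nth_prime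
    by (subst prod.reindex) (auto simp: kappa_def bij_betw_def intro: inj_on_subset)
  finally show ?thesis by simp
qed

text \<open>Unique factorization in logarithmic form. Imaginary \<open>s\<close> gives the action of
  the flow on characters; \<open>s\<close> = - \<delta> shows that damping the variable of each
  prime p by p^(-\<delta>) damps the \<open>n\<close>-th coefficient by n^(-\<delta>).\<close>

lemma dchar_powr:
  assumes "n \<ge> 1"
  shows "dchar n (\<lambda>j. of_nat (nth_prime j) powr s) = of_nat n powr s"
proof -
  have pos: "0 < nth_prime j" for j
    using prime_nth_prime by (simp add: prime_gt_0_nat)
  have ln_n: "ln (real n) = (\<Sum>j | kappa n j \<noteq> 0. real (kappa n j) * ln (real (nth_prime j)))"
  proof -
    have "ln (real n) = ln (\<Prod>j | kappa n j \<noteq> 0. real (nth_prime j) ^ kappa n j)"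
      using prod_nth_prime_kappa[OF assms] by (metis (no_types, lifting) of_nat_power of_nat_prod prod.cong)
    also have "\<dots> = (\<Sum>j | kappa n j \<noteq> 0. ln (real (nth_prime j) ^ kappa n j))"
      using pos finite_kappa[OF assms] by (intro ln_prod) auto
    finally show ?thesis
      using pos by (simp add: ln_realpow)
  qed
  have powr_eq: "of_nat m powr s = exp (s * of_real (ln (real m)))" if "m > 0" for m
    using that by (simp add: powr_def Ln_of_nat)
  have "dchar n (\<lambda>j. of_nat (nth_prime j) powr s) =
      (\<Prod>j | kappa n j \<noteq> 0. exp (of_nat (kappa n j) * (s * of_real (ln (real (nth_prime j))))))"
    using pos by (simp add: dchar_def monomial_def powr_eq exp_of_nat_mult)
  also have "\<dots> = exp (\<Sum>j | kappa n j \<noteq> 0. of_nat (kappa n j) * (s * of_real (ln (real (nth_prime j)))))"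
    using finite_kappa[OF assms] by (simp add: exp_sum)
  also have "(\<Sum>j | kappa n j \<noteq> 0. of_nat (kappa n j) * (s * of_real (ln (real (nth_prime j))))) =
      s * of_real (ln (real n))"
    by (simp add: ln_n sum_distrib_left mult_ac)
  finally show ?thesis
    using assms powr_eq[of n] by simp
qed

lemma measurable_coordinate [measurable]: "(\<lambda>z. z j) \<in> borel_measurable torus_measure"
proof -
  have "(\<lambda>z. z j) \<in> torus_measure \<rightarrow>\<^sub>M circle_measure"
    unfolding torus_measure_def by measurable
  then have "(\<lambda>z. z j) \<in> torus_measure \<rightarrow>\<^sub>M restrict_space borel (sphere 0 1)"
    by (simp add: circle_measure_def cong: measurable_cong_sets)
  then show ?thesis
    by (simp add: measurable_restrict_space2_iff)
qed

lemma measurable_monomial [measurable]: "monomial \<alpha> \<in> borel_measurable torus_measure"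
  unfolding monomial_def by measurable

lemma measurable_dchar [measurable]: "dchar n \<in> borel_measurable torus_measure"
  unfolding dchar_def by measurable

section \<open>Rotation invariance of the measures on the circle and the torus\<close>

interpretation torus: prob_space torus_measure
  by (rule prob_space_torus_measure)

interpretation circle: prob_space circle_measure
  by (rule prob_space_circle_measure)

lemma space_circle: "space circle_measure = sphere 0 1"
  by (simp add: circle_measure_def space_restrict_space)

lemma sets_circle [measurable_cong]: "sets circle_measure = sets (restrict_space borel (sphere 0 1))"
  by (simp add: circle_measure_def)

lemma measurable_circle_id [measurable]: "(\<lambda>w. w) \<in> borel_measurable circle_measure"
  by (simp add: measurable_restrict_space1 cong: measurable_cong_sets[OF sets_circle refl])

lemma measurable_circle_mult:
  assumes "norm c = 1"
  shows "(\<lambda>w. c * w) \<in> circle_measure \<rightarrow>\<^sub>M circle_measure"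
proof -
  have "(\<lambda>w. c * w) \<in> circle_measure \<rightarrow>\<^sub>M restrict_space borel (sphere 0 1)"
    using assms by (intro measurable_restrict_space2) (auto simp: space_circle norm_mult)
  then show ?thesis
    by (simp cong: measurable_cong_sets[OF refl sets_circle])
qed

lemma emeasure_circle:
  assumes "A \<in> sets circle_measure"
  shows "emeasure circle_measure A = (\<integral>\<^sup>+ t. indicator {0..<2*pi} t * indicator A (cis t) \<partial>lborel) / (2 * pi)"
proof -
  have A: "A \<in> sets (restrict_space borel (sphere 0 1))"
    using assms by (simp add: sets_circle)
  have B: "cis -` A \<in> sets lborel"
    using measurable_sets[OF cis_measurable_sphere A, where A1 = "{0..<2*pi}"] by simp
  have "emeasure circle_measure A = emeasure (uniform_measure lborel {0..<2*pi}) (cis -` A)"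
    unfolding circle_measure_def
    using cis_measurable_sphere A by (subst emeasure_distr) auto
  also have "\<dots> = emeasure lborel ({0..<2*pi} \<inter> cis -` A) / (2 * pi)"
    using B by (subst emeasure_uniform_measure) auto
  also have "emeasure lborel ({0..<2*pi} \<inter> cis -` A) =
     (\<integral>\<^sup>+ t. indicator ({0..<2*pi} \<inter> cis -` A) t \<partial>lborel)"
    using B by (subst nn_integral_indicator) auto
  also have "\<dots> = (\<integral>\<^sup>+ t. indicator {0..<2*pi} t * indicator A (cis t) \<partial>lborel)"
    by (intro nn_integral_cong) (auto simp: indicator_def)
  finally show ?thesis .
qed

lemma nn_integral_period:
  fixes f :: "real \<Rightarrow> ennreal"
  assumes f [measurable]: "f \<in> borel_measurable borel" and period: "\<And>t. f (t + 2 * pi) = f t"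
    and a: "0 \<le> a" "a < 2 * pi"
  shows "(\<integral>\<^sup>+ t. indicator {0..<2*pi} t * f (t + a) \<partial>lborel) =
     (\<integral>\<^sup>+ t. indicator {0..<2*pi} t * f t \<partial>lborel)"
proof -
  have shift: "(\<integral>\<^sup>+ t. indicator {u..<v} t * f (t + c) \<partial>lborel) =
      (\<integral>\<^sup>+ t. indicator {u+c..<v+c} t * f t \<partial>lborel)" for u v c :: real
    by (subst (2) nn_integral_real_affine[where c = 1 and t = c])
       (auto intro!: nn_integral_cong simp: indicator_def add_ac)
  have split: "(\<integral>\<^sup>+ t. indicator {u..<w} t * f t \<partial>lborel) =
      (\<integral>\<^sup>+ t. indicator {u..<v} t * f t \<partial>lborel) + (\<integral>\<^sup>+ t. indicator {v..<w} t * f t \<partial>lborel)"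
    if "u \<le> v" "v \<le> w" for u v w :: real
    using that by (subst nn_integral_add[symmetric]) (auto intro!: nn_integral_cong simp: indicator_def)
  have "(\<integral>\<^sup>+ t. indicator {0..<2*pi} t * f (t + a) \<partial>lborel) =
      (\<integral>\<^sup>+ t. indicator {a..<2*pi} t * f t \<partial>lborel) + (\<integral>\<^sup>+ t. indicator {2*pi..<2*pi+a} t * f t \<partial>lborel)"
    using a by (simp add: shift) (rule split, auto)
  also have "(\<integral>\<^sup>+ t. indicator {2*pi..<2*pi+a} t * f t \<partial>lborel) = (\<integral>\<^sup>+ t. indicator {0..<a} t * f t \<partial>lborel)"
    using shift[of 0 a "2*pi"] by (simp add: period add_ac)
  finally show ?thesis
    using split[of 0 a "2*pi"] a by (simp add: add_ac)
qed

lemma distr_circle_mult: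
  assumes "norm c = 1"
  shows "distr circle_measure circle_measure (\<lambda>w. c * w) = circle_measure"
proof (rule measure_eqI)
  obtain a where a: "0 \<le> a" "a < 2 * pi" "c = cis a"
    by (metis Arg2pi_ge_0 Arg2pi_lt_2pi assms cis_conv_exp complex_norm_eq_1_exp)
  fix A assume "A \<in> sets (distr circle_measure circle_measure (\<lambda>w. c * w))"
  then have A: "A \<in> sets circle_measure" by simp
  have sp: "(\<lambda>w. c * w) -` A \<inter> space circle_measure \<in> sets circle_measure"
    using measurable_sets[OF measurable_circle_mult[OF assms] A] .
  have cis_meas: "cis \<in> borel \<rightarrow>\<^sub>M restrict_space borel (sphere 0 1)"
    by (rule measurable_restrict_space2)
       (auto intro!: borel_measurable_continuous_onI continuous_intros)
  have B: "(\<lambda>t. indicator A (cis t) :: ennreal) \<in> borel_measurable borel"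
    using A by (intro measurable_compose[OF cis_meas] borel_measurable_indicator) (simp add: sets_circle)
  have "emeasure (distr circle_measure circle_measure (\<lambda>w. c * w)) A =
      emeasure circle_measure ((\<lambda>w. c * w) -` A \<inter> space circle_measure)"
    using A measurable_circle_mult[OF assms] by (subst emeasure_distr) auto
  also have "\<dots> = (\<integral>\<^sup>+ t. indicator {0..<2*pi} t * indicator A (cis (t + a)) \<partial>lborel) / (2 * pi)"
    unfolding emeasure_circle[OF sp]
    by (intro arg_cong2[where f = "(/)"] nn_integral_cong refl)
       (auto simp: indicator_def space_circle a cis_mult add_ac)
  also have "\<dots> = emeasure circle_measure A"
    unfolding emeasure_circle[OF A] using a
    by (subst nn_integral_period[OF B]) (simp_all flip: cis_mult)
  finally show "emeasure (distr circle_measure circle_measure (\<lambda>w. c * w)) A = emeasure circle_measure A" .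
qed simp

lemma measurable_torus_scale:
  assumes "\<And>j. norm (c j) = 1"
  shows "(\<lambda>z j. c j * z j) \<in> torus_measure \<rightarrow>\<^sub>M torus_measure"
  unfolding torus_measure_def
proof (rule measurable_PiM_single')
  fix j :: nat
  show "(\<lambda>z. c j * z j) \<in> Pi\<^sub>M UNIV (\<lambda>_. circle_measure) \<rightarrow>\<^sub>M circle_measure"
    by (rule measurable_compose[OF _ measurable_circle_mult[OF assms]])
       (rule measurable_component_singleton, simp)
qed (auto simp: space_PiM space_circle assms norm_mult PiE_iff)

text \<open>Probability measures on the product are determined by cylinder sets, and the preimage of
  a cylinder is the cylinder over the rotated sides, which has the same product measure.\<close>

lemma distr_torus_scale:
  assumes c: "\<And>j. norm (c j) = 1"
  shows "distr torus_measure torus_measure (\<lambda>z j. c j * z j) = torus_measure"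
  unfolding torus_measure_def
proof (rule measure_eqI_PiM_infinite)
  let ?T = "Pi\<^sub>M UNIV (\<lambda>_::nat. circle_measure)"
  interpret product_prob_space "\<lambda>_::nat. circle_measure" UNIV ..
  have m: "(\<lambda>z j. c j * z j) \<in> ?T \<rightarrow>\<^sub>M ?T"
    using measurable_torus_scale[of c] c by (simp add: torus_measure_def)
  fix J :: "nat set" and A :: "nat \<Rightarrow> complex set"
  assume J: "finite J" "J \<subseteq> UNIV" "\<And>j. j \<in> J \<Longrightarrow> A j \<in> sets circle_measure"
  define B where "B j = (\<lambda>w. c j * w) -` A j \<inter> space circle_measure" for j
  have B: "j \<in> J \<Longrightarrow> B j \<in> sets circle_measure" for j
    unfolding B_def using J measurable_circle_mult[OF c, of j] by (intro measurable_sets) auto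
  have AB: "emeasure circle_measure (B j) = emeasure circle_measure (A j)" if "j \<in> J" for j
    unfolding B_def
    by (subst (2) distr_circle_mult[OF c, of j, symmetric], subst emeasure_distr)
       (use J that measurable_circle_mult[OF c, of j] in auto)
  have "(\<lambda>z j. c j * z j) -` prod_emb UNIV (\<lambda>_. circle_measure) J (Pi\<^sub>E J A) \<inter> space ?T =
      prod_emb UNIV (\<lambda>_. circle_measure) J (Pi\<^sub>E J B)"
    by (auto simp: prod_emb_def space_PiM PiE_iff B_def space_circle norm_mult c)
  then show "emeasure (distr ?T ?T (\<lambda>z j. c j * z j)) (prod_emb UNIV (\<lambda>_. circle_measure) J (Pi\<^sub>E J A)) =
      emeasure ?T (prod_emb UNIV (\<lambda>_. circle_measure) J (Pi\<^sub>E J A))"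
    using J B AB m
    by (subst emeasure_distr) (auto simp: emeasure_PiM_emb intro!: sets_PiM_I prod.cong)
next
  show "finite_measure (distr (Pi\<^sub>M UNIV (\<lambda>_. circle_measure)) (Pi\<^sub>M UNIV (\<lambda>_. circle_measure)) (\<lambda>z j. c j * z j))"
    using prob_space.prob_space_distr[OF prob_space_torus_measure measurable_torus_scale[OF c]]
    unfolding torus_measure_def by (simp add: prob_space_imp_subprob_space subprob_space.axioms(1))
qed simp_all

lemma integral_torus_scale:
  fixes f :: "_ \<Rightarrow> 'b::{banach, second_countable_topology}"
  assumes "\<And>j. norm (c j) = 1" "f \<in> borel_measurable torus_measure"
  shows "(LINT z|torus_measure. f (\<lambda>j. c j * z j)) = (LINT z|torus_measure. f z)"
  by (subst (2) distr_torus_scale[of c, symmetric])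
     (use assms measurable_torus_scale[of c] in \<open>simp_all add: integral_distr\<close>)

lemma integral_circle_scale:
  fixes f :: "_ \<Rightarrow> 'b::{banach, second_countable_topology}"
  assumes "norm c = 1" "f \<in> borel_measurable circle_measure"
  shows "(LINT z|circle_measure. f (c * z)) = (LINT z|circle_measure. f z)"
  by (subst (2) distr_circle_mult[of c, symmetric])
     (use assms measurable_circle_mult[of c] in \<open>simp_all add: integral_distr\<close>)

text \<open>\<open>distr_pair_PiM_eq_PiM\<close> is applied with an index that
  already belongs to the index set.\<close>

lemma distr_torus_fun_upd:
  "distr (circle_measure \<Otimes>\<^sub>M torus_measure) torus_measure (\<lambda>(w, z). z(j := w)) = torus_measure"
  using distr_pair_PiM_eq_PiM[of "UNIV :: nat set" "\<lambda>_. circle_measure" j] prob_space_circle_measure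
  by (simp add: torus_measure_def)

lemma measurable_torus_fun_upd [measurable]:
  "(\<lambda>(w, z). z(j := w)) \<in> circle_measure \<Otimes>\<^sub>M torus_measure \<rightarrow>\<^sub>M torus_measure"
proof -
  have "(\<lambda>p. (snd p)(j := fst p)) \<in> circle_measure \<Otimes>\<^sub>M torus_measure \<rightarrow>\<^sub>M torus_measure"
    unfolding torus_measure_def
    by (rule measurable_fun_upd[where J = UNIV]) measurable
  then show ?thesis
    by (simp add: case_prod_beta')
qed

lemma fun_upd_torus: "z \<in> space torus_measure \<Longrightarrow> w \<in> space circle_measure \<Longrightarrow> z(j := w) \<in> space torus_measure"
  by (auto simp: space_torus_measure space_circle)

section \<open>Subharmonic functions along the Kronecker flow\<close>

text \<open>The mean value inequality bounds all difference quotients by the constant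
  \<open>B\<close>, which is integrable because the measure is finite; dominated convergence along
  sequences does the rest.\<close>

lemma has_real_derivative_integral:
  fixes f f' :: "real \<Rightarrow> 'a \<Rightarrow> real"
  assumes "finite_measure M" and S: "open S" "convex S" "x \<in> S"
    and f: "\<And>y. y \<in> S \<Longrightarrow> integrable M (f y)"
    and f': "f' x \<in> borel_measurable M"
    and deriv: "\<And>y z. y \<in> S \<Longrightarrow> z \<in> space M \<Longrightarrow> ((\<lambda>y. f y z) has_real_derivative f' y z) (at y)"
    and bound: "\<And>y z. y \<in> S \<Longrightarrow> z \<in> space M \<Longrightarrow> \<bar>f' y z\<bar> \<le> B"
  shows "((\<lambda>y. integral\<^sup>L M (f y)) has_real_derivative integral\<^sup>L M (f' x)) (at x)"
proof -
  interpret finite_measure M by fact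
  have quot: "\<bar>(f y z - f x z) / (y - x)\<bar> \<le> B" if "y \<in> S" "y \<noteq> x" "z \<in> space M" for y z
  proof -
    have "norm (f y z - f x z) \<le> B * norm (y - x)"
      using S that deriv bound
      by (intro field_differentiable_bound[of S "\<lambda>y. f y z" "\<lambda>y. f' y z"])
         (auto intro: has_field_derivative_at_within)
    then show ?thesis
      using that by (simp add: divide_le_eq)
  qed
  have "((\<lambda>y. integral\<^sup>L M (\<lambda>z. (f y z - f x z) / (y - x))) \<longlongrightarrow> integral\<^sup>L M (f' x)) (at x)"
    unfolding tendsto_at_iff_sequentially comp_def
  proof (intro allI impI)
    fix X :: "nat \<Rightarrow> real"
    assume X: "\<forall>i. X i \<in> UNIV - {x}" "X \<longlonglongrightarrow> x"
    have "\<forall>\<^sub>F i in sequentially. X i \<in> S"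
      using topological_tendstoD[OF X(2) S(1,3)] .
    then obtain N where N: "\<And>i. i \<ge> N \<Longrightarrow> X i \<in> S"
      by (auto simp: eventually_sequentially)
    \<comment> \<open>The sequence is shifted past the index from which it stays in
      \<open>S\<close>, so that the bound holds for every term.\<close>
    have "(\<lambda>i. integral\<^sup>L M (\<lambda>z. (f (X (i + N)) z - f x z) / (X (i + N) - x))) \<longlonglongrightarrow> integral\<^sup>L M (f' x)"
    proof (rule integral_dominated_convergence[where w = "\<lambda>_. B"])
      show "AE z in M. (\<lambda>i. (f (X (i + N)) z - f x z) / (X (i + N) - x)) \<longlonglongrightarrow> f' x z"
      proof (rule AE_I2)
        fix z assume "z \<in> space M"
        then have "((\<lambda>y. (f y z - f x z) / (y - x)) \<longlongrightarrow> f' x z) (at x)"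
          using deriv[OF S(3)] by (simp add: has_field_derivative_iff)
        then have "(\<lambda>i. (f (X i) z - f x z) / (X i - x)) \<longlonglongrightarrow> f' x z"
          using X by (simp add: tendsto_at_iff_sequentially comp_def)
        then show "(\<lambda>i. (f (X (i + N)) z - f x z) / (X (i + N) - x)) \<longlonglongrightarrow> f' x z"
          by (rule LIMSEQ_ignore_initial_segment)
      qed
      show "(\<lambda>z. (f (X (i + N)) z - f x z) / (X (i + N) - x)) \<in> borel_measurable M" for i
        using f[OF N, of "i + N"] f[OF S(3)] by simp
      show "AE z in M. norm ((f (X (i + N)) z - f x z) / (X (i + N) - x)) \<le> B" for i
        using quot[of "X (i + N)"] X N by auto
    qed (use f' in simp_all)
    then show "(\<lambda>i. integral\<^sup>L M (\<lambda>z. (f (X i) z - f x z) / (X i - x))) \<longlonglongrightarrow> integral\<^sup>L M (f' x)"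
      by (rule LIMSEQ_offset)
  qed
  moreover have "\<forall>\<^sub>F y in at x. integral\<^sup>L M (\<lambda>z. (f y z - f x z) / (y - x)) =
      (integral\<^sup>L M (f y) - integral\<^sup>L M (f x)) / (y - x)"
    using eventually_at_in_open'[OF S(1,3)]
    by eventually_elim (use f S in simp)
  ultimately show ?thesis
    unfolding has_field_derivative_iff by (rule Lim_transform_eventually)
qed

definition rot :: "real \<Rightarrow> (nat \<Rightarrow> complex) \<Rightarrow> nat \<Rightarrow> complex" where
  "rot t z = (\<lambda>j. of_nat (nth_prime j) powr (- (\<i> * of_real t)) * z j)"

lemma norm_nth_prime_powr: "norm (complex_of_nat (nth_prime j) powr (- (\<i> * of_real t))) = 1"
proof -
  have "0 < nth_prime j"
    using prime_nth_prime by (simp add: prime_gt_0_nat)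
  then show ?thesis
    using norm_powr_real_powr[of "of_nat (nth_prime j)" "- (\<i> * of_real t)"] by simp
qed

lemma rot_space [simp]: "z \<in> space torus_measure \<Longrightarrow> rot t z \<in> space torus_measure"
  by (simp add: space_torus_measure rot_def norm_mult norm_nth_prime_powr)

lemma integral_rot:
  fixes f :: "_ \<Rightarrow> 'b::{banach, second_countable_topology}"
  assumes "f \<in> borel_measurable torus_measure"
  shows "(LINT z|torus_measure. f (rot t z)) = (LINT z|torus_measure. f z)"
  unfolding rot_def by (rule integral_torus_scale[OF norm_nth_prime_powr assms])

lemma dchar_rot:
  assumes "n \<ge> 1"
  shows "dchar n (rot t z) = of_nat n powr (- (\<i> * of_real t)) * dchar n z"
  using dchar_powr[OF assms, of "- (\<i> * of_real t)"]
  by (simp add: rot_def dchar_def monomial_scale)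

text \<open>\<open>s \<mapsto> X z s\<close> is thought of as a function on the half-plane attached to the Kronecker flow
  line through \<open>z\<close>: moving along the flow is a vertical translation of \<open>s\<close>.\<close>

definition flow_fun :: "((nat \<Rightarrow> complex) \<Rightarrow> complex \<Rightarrow> 'b::real_normed_vector) \<Rightarrow> bool" where
  "flow_fun X \<longleftrightarrow>
     (\<forall>s. (\<lambda>z. X z s) \<in> borel_measurable torus_measure) \<and>
     (\<exists>B. \<forall>z\<in>space torus_measure. \<forall>s. - 1 \<le> Re s \<longrightarrow> norm (X z s) \<le> B) \<and>
     (\<forall>z\<in>space torus_measure. \<forall>s t. X (rot t z) s = X z (s + \<i> * of_real t))"

lemma flow_funI:
  assumes "\<And>s. (\<lambda>z. X z s) \<in> borel_measurable torus_measure"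
    and "\<And>z s. z \<in> space torus_measure \<Longrightarrow> - 1 \<le> Re s \<Longrightarrow> norm (X z s) \<le> B"
    and "\<And>z s t. z \<in> space torus_measure \<Longrightarrow> X (rot t z) s = X z (s + \<i> * of_real t)"
  shows "flow_fun X"
  using assms unfolding flow_fun_def by blast

lemma flow_fun_measurable: "flow_fun X \<Longrightarrow> (\<lambda>z. X z s) \<in> borel_measurable torus_measure"
  by (simp add: flow_fun_def)

lemma flow_fun_bound:
  assumes "flow_fun X"
  obtains B where "0 \<le> B"
    "\<And>z s. z \<in> space torus_measure \<Longrightarrow> - 1 \<le> Re s \<Longrightarrow> norm (X z s) \<le> B"
proof -
  obtain B where B: "\<forall>z\<in>space torus_measure. \<forall>s. - 1 \<le> Re s \<longrightarrow> norm (X z s) \<le> B"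
    using assms by (auto simp: flow_fun_def)
  show ?thesis
    by (rule that[of "max 0 B"]) (use B in \<open>auto simp: max.coboundedI2\<close>)
qed

lemma flow_fun_rot: "flow_fun X \<Longrightarrow> z \<in> space torus_measure \<Longrightarrow> X (rot t z) s = X z (s + \<i> * of_real t)"
  by (simp add: flow_fun_def)

lemma flow_fun_integrable:
  fixes X :: "_ \<Rightarrow> complex \<Rightarrow> 'b::{banach, second_countable_topology}"
  assumes "flow_fun X" "- 1 \<le> Re s"
  shows "integrable torus_measure (\<lambda>z. X z s)"
proof -
  obtain B where "\<And>z. z \<in> space torus_measure \<Longrightarrow> norm (X z s) \<le> B"
    using flow_fun_bound[OF assms(1)] assms(2) by metis
  then show ?thesis
    using flow_fun_measurable[OF assms(1)] by (intro torus.integrable_const_bound[where B = B]) auto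
qed

lemma flow_fun_const: "flow_fun (\<lambda>z s. c)"
  by (rule flow_funI) auto

lemma flow_fun_add:
  fixes X Y :: "_ \<Rightarrow> complex \<Rightarrow> 'b::{real_normed_vector, second_countable_topology}"
  assumes "flow_fun X" "flow_fun Y"
  shows "flow_fun (\<lambda>z s. X z s + Y z s)"
proof -
  obtain B where B: "\<And>z s. z \<in> space torus_measure \<Longrightarrow> - 1 \<le> Re s \<Longrightarrow> norm (X z s) \<le> B"
    using flow_fun_bound[OF assms(1)] by metis
  obtain C where C: "\<And>z s. z \<in> space torus_measure \<Longrightarrow> - 1 \<le> Re s \<Longrightarrow> norm (Y z s) \<le> C"
    using flow_fun_bound[OF assms(2)] by metis
  show ?thesis
    by (rule flow_funI[where B = "B + C"])
       (use assms B C in \<open>auto simp: flow_fun_rot intro!: norm_add_rule_thm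
          borel_measurable_add[OF assms[THEN flow_fun_measurable]]\<close>)
qed

lemma flow_fun_mult:
  fixes X Y :: "_ \<Rightarrow> complex \<Rightarrow> 'b::{real_normed_algebra, second_countable_topology}"
  assumes "flow_fun X" "flow_fun Y"
  shows "flow_fun (\<lambda>z s. X z s * Y z s)"
proof -
  obtain B where B: "0 \<le> B" "\<And>z s. z \<in> space torus_measure \<Longrightarrow> - 1 \<le> Re s \<Longrightarrow> norm (X z s) \<le> B"
    using flow_fun_bound[OF assms(1)] by metis
  obtain C where C: "\<And>z s. z \<in> space torus_measure \<Longrightarrow> - 1 \<le> Re s \<Longrightarrow> norm (Y z s) \<le> C"
    using flow_fun_bound[OF assms(2)] by metis
  show ?thesis
  proof (rule flow_funI[where B = "B * C"])
    show "norm (X z s * Y z s) \<le> B * C" if "z \<in> space torus_measure" "- 1 \<le> Re s" for z s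
      using B C that by (intro order_trans[OF norm_mult_ineq] mult_mono) auto
      show "(\<lambda>z. X z s * Y z s) \<in> borel_measurable torus_measure" for s
      by (rule borel_measurable_times[OF assms[THEN flow_fun_measurable]])
  qed (use assms in \<open>simp add: flow_fun_rot\<close>)
qed

text \<open>A continuous function is bounded on the compact part of \<open>C\<close> that the
  bounded function \<open>X\<close> can reach. The closed set \<open>C\<close> is there for outer
  functions such as \<open>ln\<close> and \<open>inverse\<close>, which are continuous only away
  from 0.\<close>

lemma flow_fun_comp:
  fixes X :: "_ \<Rightarrow> complex \<Rightarrow> 'b::{heine_borel, real_normed_vector}"
    and f :: "'b \<Rightarrow> 'c::real_normed_vector"
  assumes "flow_fun X" and C: "closed C" "continuous_on C f" "\<And>z s. X z s \<in> C"
  shows "flow_fun (\<lambda>z s. f (X z s))"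
proof -
  obtain B where B: "\<And>z s. z \<in> space torus_measure \<Longrightarrow> - 1 \<le> Re s \<Longrightarrow> norm (X z s) \<le> B"
    using flow_fun_bound[OF assms(1)] by metis
  have "compact (C \<inter> cball 0 B)"
    using C by (intro closed_Int_compact) auto
  then have "bounded (f ` (C \<inter> cball 0 B))"
    using C by (intro compact_imp_bounded compact_continuous_image) (auto intro: continuous_on_subset)
  then obtain K where K: "\<And>x. x \<in> C \<inter> cball 0 B \<Longrightarrow> norm (f x) \<le> K"
    unfolding bounded_iff by blast
  show ?thesis
  proof (rule flow_funI[where B = K])
    show "norm (f (X z s)) \<le> K" if "z \<in> space torus_measure" "- 1 \<le> Re s" for z s
      using B[OF that] C by (intro K) auto
    have "(\<lambda>z. X z s) \<in> torus_measure \<rightarrow>\<^sub>M restrict_space borel C" for s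
      using C by (intro measurable_restrict_space2 flow_fun_measurable[OF assms(1)]) auto
    then show "(\<lambda>z. f (X z s)) \<in> borel_measurable torus_measure" for s
      using borel_measurable_continuous_on_restrict[OF C(2)] by (rule measurable_compose)
  qed (use assms in \<open>simp add: flow_fun_rot\<close>)
qed

lemma flow_fun_comp_UNIV:
  fixes X :: "_ \<Rightarrow> complex \<Rightarrow> 'b::{heine_borel, real_normed_vector}"
    and f :: "'b \<Rightarrow> 'c::real_normed_vector"
  assumes "flow_fun X" and "continuous_on UNIV f"
  shows "flow_fun (\<lambda>z s. f (X z s))"
  using assms flow_fun_comp[of X UNIV f] by auto

lemma flow_fun_cmult:
  fixes X :: "_ \<Rightarrow> complex \<Rightarrow> 'b::{real_normed_algebra, second_countable_topology}"
  shows "flow_fun X \<Longrightarrow> flow_fun (\<lambda>z s. c * X z s)"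
  by (rule flow_fun_mult[OF flow_fun_const])

lemma flow_fun_diff:
  fixes X Y :: "_ \<Rightarrow> complex \<Rightarrow> 'b::{real_normed_algebra_1, second_countable_topology}"
  shows "flow_fun X \<Longrightarrow> flow_fun Y \<Longrightarrow> flow_fun (\<lambda>z s. X z s - Y z s)"
  using flow_fun_add[OF _ flow_fun_cmult[of Y "- 1"]] by simp

lemma flow_fun_Re: "flow_fun X \<Longrightarrow> flow_fun (\<lambda>z s. Re (X z s))"
  using flow_fun_comp_UNIV[of X Re] by (simp add: continuous_intros)

lemma flow_fun_Im: "flow_fun X \<Longrightarrow> flow_fun (\<lambda>z s. Im (X z s))"
  using flow_fun_comp_UNIV[of X Im] by (simp add: continuous_intros)

lemma flow_fun_cnj: "flow_fun X \<Longrightarrow> flow_fun (\<lambda>z s. cnj (X z s))"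
  using flow_fun_comp_UNIV[of X cnj] by (simp add: continuous_intros)

lemma flow_fun_cmod: "flow_fun X \<Longrightarrow> flow_fun (\<lambda>z s. cmod (X z s))"
  using flow_fun_comp_UNIV[of X cmod] by (simp add: continuous_intros)

lemma flow_fun_exp: "flow_fun X \<Longrightarrow> flow_fun (\<lambda>z s. exp (X z s :: real))"
  using flow_fun_comp_UNIV[of X exp] by (simp add: continuous_intros)

lemma flow_fun_power:
  fixes X :: "_ \<Rightarrow> complex \<Rightarrow> 'b::{heine_borel, real_normed_algebra_1}"
  shows "flow_fun X \<Longrightarrow> flow_fun (\<lambda>z s. X z s ^ n)"
  using flow_fun_comp_UNIV[of X "\<lambda>x. x ^ n"] by (simp add: continuous_intros)

lemma flow_fun_ln: "flow_fun X \<Longrightarrow> (\<And>z s. e \<le> X z s) \<Longrightarrow> 0 < e \<Longrightarrow> flow_fun (\<lambda>z s. ln (X z s :: real))"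
  by (rule flow_fun_comp[of X "{e..}" ln]) (auto intro!: continuous_on_ln continuous_on_id)

lemma flow_fun_divide:
  assumes "flow_fun Y" "flow_fun X" "\<And>z s. e \<le> X z s" "0 < e"
  shows "flow_fun (\<lambda>z s. Y z s / X z s :: real)"
proof -
  have "flow_fun (\<lambda>z s. inverse (X z s))"
    using assms
    by (intro flow_fun_comp[of X "{e..}" inverse]) (auto intro!: continuous_on_inverse continuous_on_id)
  from flow_fun_mult[OF assms(1) this] show ?thesis
    by (simp add: field_class.field_divide_inverse)
qed

lemmas flow_intros = flow_fun_const flow_fun_add flow_fun_diff flow_fun_mult flow_fun_Re flow_fun_Im flow_fun_cnj
  flow_fun_cmod flow_fun_exp flow_fun_power

text \<open>Analyticity is in \<open>s\<close> for fixed \<open>z\<close>. Bounds for two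
  derivatives are built in, so that means over the torus may be differentiated twice under the
  integral. The derivative formulas are required for all \<open>s\<close>, the bounds only in the
  half-plane of \<open>flow_fun\<close>.\<close>

definition analytic_flow where
  "analytic_flow a a' a'' \<longleftrightarrow> flow_fun a \<and> flow_fun a' \<and> flow_fun a'' \<and>
     (\<forall>z s. (a z has_field_derivative a' z s) (at s)) \<and>
     (\<forall>z s. (a' z has_field_derivative a'' z s) (at s))"

text \<open>\<open>D \<eta>\<close> and \<open>D2 \<eta>\<close> are the first and second derivatives of \<open>u\<close> in the direction \<open>\<eta>\<close>,
  so \<open>D2 1 + D2 \<i>\<close> is the Laplacian.\<close>

definition smooth_flow where
  "smooth_flow u D D2 \<longleftrightarrow> flow_fun u \<and>
     (\<forall>\<eta>\<in>{1, \<i>}. flow_fun (D \<eta>) \<and> flow_fun (D2 \<eta>) \<and>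
       (\<forall>z s. ((\<lambda>x. u z (s + of_real x * \<eta>) :: real) has_real_derivative D \<eta> z s) (at 0)) \<and>
       (\<forall>z s. ((\<lambda>x. D \<eta> z (s + of_real x * \<eta>)) has_real_derivative D2 \<eta> z s) (at 0)))"

lemma smooth_flowI:
  assumes "flow_fun u"
    and "\<And>\<eta>. \<eta> \<in> {1, \<i>} \<Longrightarrow> flow_fun (D \<eta>)"
    and "\<And>\<eta>. \<eta> \<in> {1, \<i>} \<Longrightarrow> flow_fun (D2 \<eta>)"
    and "\<And>\<eta> z s. \<eta> \<in> {1, \<i>} \<Longrightarrow> ((\<lambda>x. u z (s + of_real x * \<eta>)) has_real_derivative D \<eta> z s) (at 0)"
    and "\<And>\<eta> z s. \<eta> \<in> {1, \<i>} \<Longrightarrow> ((\<lambda>x. D \<eta> z (s + of_real x * \<eta>)) has_real_derivative D2 \<eta> z s) (at 0)"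
  shows "smooth_flow u D D2"
  unfolding smooth_flow_def by (intro conjI ballI allI assms)

lemma smooth_flowD:
  assumes "smooth_flow u D D2"
  shows "flow_fun u"
    and "\<And>\<eta>. \<eta> \<in> {1, \<i>} \<Longrightarrow> flow_fun (D \<eta>)"
    and "\<And>\<eta>. \<eta> \<in> {1, \<i>} \<Longrightarrow> flow_fun (D2 \<eta>)"
    and "\<And>\<eta> z s. \<eta> \<in> {1, \<i>} \<Longrightarrow> ((\<lambda>x. u z (s + of_real x * \<eta>)) has_real_derivative D \<eta> z s) (at 0)"
    and "\<And>\<eta> z s. \<eta> \<in> {1, \<i>} \<Longrightarrow> ((\<lambda>x. D \<eta> z (s + of_real x * \<eta>)) has_real_derivative D2 \<eta> z s) (at 0)"
proof -
  note A = assms[unfolded smooth_flow_def]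
  show "flow_fun u"
    by (rule conjunct1[OF A])
  fix \<eta> :: complex
  assume "\<eta> \<in> {1, \<i>}"
  note B = bspec[OF conjunct2[OF A] this]
  show "flow_fun (D \<eta>)" "flow_fun (D2 \<eta>)"
    by (rule B[THEN conjunct1], rule B[THEN conjunct2, THEN conjunct1])
  fix z s
  show "((\<lambda>x. u z (s + of_real x * \<eta>)) has_real_derivative D \<eta> z s) (at 0)"
    by (rule B[THEN conjunct2, THEN conjunct2, THEN conjunct1, THEN spec, THEN spec])
  show "((\<lambda>x. D \<eta> z (s + of_real x * \<eta>)) has_real_derivative D2 \<eta> z s) (at 0)"
    by (rule B[THEN conjunct2, THEN conjunct2, THEN conjunct2, THEN spec, THEN spec])
qed

lemma analytic_flow_directional:
  assumes "analytic_flow a a' a''"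
  shows "((\<lambda>x. a z (s + of_real x * \<eta>)) has_vector_derivative \<eta> * a' z s) (at (0::real))"
    and "((\<lambda>x. a' z (s + of_real x * \<eta>)) has_vector_derivative \<eta> * a'' z s) (at (0::real))"
proof -
  have *: "((\<lambda>x. f (s + of_real x * \<eta>)) has_vector_derivative \<eta> * f') (at (0::real))"
    if "(f has_field_derivative f') (at s)" for f f'
  proof -
    have line: "((\<lambda>w. s + w * \<eta>) has_field_derivative \<eta>) (at (of_real 0))"
      by (rule derivative_eq_intros refl | simp)+
    have "((\<lambda>w. f (s + w * \<eta>)) has_field_derivative f' * \<eta>) (at (of_real 0))"
      by (rule DERIV_chain2[OF _ line]) (use that in simp)
    from has_vector_derivative_real_field[OF this] show ?thesis
      by (simp add: mult.commute)
  qed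
  show "((\<lambda>x. a z (s + of_real x * \<eta>)) has_vector_derivative \<eta> * a' z s) (at (0::real))"
    using assms by (intro *) (simp add: analytic_flow_def)
  show "((\<lambda>x. a' z (s + of_real x * \<eta>)) has_vector_derivative \<eta> * a'' z s) (at (0::real))"
    using assms by (intro *) (simp add: analytic_flow_def)
qed

lemma smooth_flow_Re:
  assumes "analytic_flow a a' a''"
  shows "smooth_flow (\<lambda>z s. Re (a z s)) (\<lambda>\<eta> z s. Re (\<eta> * a' z s)) (\<lambda>\<eta> z s. Re (\<eta>\<^sup>2 * a'' z s))"
proof (rule smooth_flowI)
  note d = analytic_flow_directional[OF assms]
  show "((\<lambda>x. Re (a z (s + of_real x * \<eta>))) has_real_derivative Re (\<eta> * a' z s)) (at 0)" for \<eta> z s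
    by (rule has_field_derivative_Re[OF d(1)])
  show "((\<lambda>x. Re (\<eta> * a' z (s + of_real x * \<eta>))) has_real_derivative Re (\<eta>\<^sup>2 * a'' z s)) (at 0)" for \<eta> z s
    using has_field_derivative_Re[OF has_vector_derivative_mult_right[OF d(2)[of z s \<eta>], of \<eta>]]
    by (simp only: power2_eq_square mult.assoc)
qed (use assms in \<open>auto simp: analytic_flow_def intro!: flow_intros\<close>)

text \<open>Writing |a|^2 as \<open>a\<close> times its conjugate, each second directional
  derivative is 2 |a'|^2 plus a term with \<eta>^2. As \<eta>^2 is 1 or -1, that term cancels in the
  sum over both directions, and the Laplacian is 4 |a'|^2.\<close>

lemma smooth_flow_norm_square:
  assumes "analytic_flow a a' a''"
  shows "smooth_flow (\<lambda>z s. (cmod (a z s))\<^sup>2) (\<lambda>\<eta> z s. 2 * Re (cnj (a z s) * (\<eta> * a' z s)))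
    (\<lambda>\<eta> z s. 2 * (cmod (a' z s))\<^sup>2 + 2 * Re (cnj (a z s) * (\<eta>\<^sup>2 * a'' z s)))"
proof (rule smooth_flowI)
  note d = analytic_flow_directional[OF assms]
  show "((\<lambda>x. (cmod (a z (s + of_real x * \<eta>)))\<^sup>2) has_real_derivative 2 * Re (cnj (a z s) * (\<eta> * a' z s))) (at 0)" for \<eta> z s
  proof -
    have "((\<lambda>x. a z (s + of_real x * \<eta>) * cnj (a z (s + of_real x * \<eta>))) has_vector_derivative
       a z s * cnj (\<eta> * a' z s) + \<eta> * a' z s * cnj (a z s)) (at 0)"
      using has_vector_derivative_mult[OF d(1) has_vector_derivative_cnj[OF d(1)], of z s \<eta> z s \<eta>]
      by simp
    from has_field_derivative_Re[OF this]
    have "((\<lambda>x. (cmod (a z (s + of_real x * \<eta>)))\<^sup>2) has_real_derivative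
       Re (a z s * cnj (\<eta> * a' z s) + \<eta> * a' z s * cnj (a z s))) (at 0)"
      by (simp only: complex_norm_square[symmetric] Re_complex_of_real)
    also have "Re (a z s * cnj (\<eta> * a' z s) + \<eta> * a' z s * cnj (a z s)) = 2 * Re (cnj (a z s) * (\<eta> * a' z s))"
      by (simp add: algebra_simps)
    finally show ?thesis .
  qed
  show "((\<lambda>x. 2 * Re (cnj (a z (s + of_real x * \<eta>)) * (\<eta> * a' z (s + of_real x * \<eta>)))) has_real_derivative
     2 * (cmod (a' z s))\<^sup>2 + 2 * Re (cnj (a z s) * (\<eta>\<^sup>2 * a'' z s))) (at 0)" if "\<eta> \<in> {1, \<i>}" for \<eta> z s
  proof -
    have \<eta>: "cmod \<eta> = 1"
      using that by auto
    have "((\<lambda>x. cnj (a z (s + of_real x * \<eta>)) * a' z (s + of_real x * \<eta>)) has_vector_derivative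
       cnj (a z s) * (\<eta> * a'' z s) + cnj (\<eta> * a' z s) * a' z s) (at 0)"
      using has_vector_derivative_mult[OF has_vector_derivative_cnj[OF d(1)] d(2), of z s \<eta> z s \<eta>] by simp
    from has_field_derivative_Re[OF has_vector_derivative_mult_right[OF this, of "2 * \<eta>"]]
    have "((\<lambda>x. Re (2 * \<eta> * (cnj (a z (s + of_real x * \<eta>)) * a' z (s + of_real x * \<eta>)))) has_real_derivative
       Re (2 * \<eta> * (cnj (a z s) * (\<eta> * a'' z s) + cnj (\<eta> * a' z s) * a' z s))) (at 0)" .
    also have "2 * \<eta> * (cnj (a z s) * (\<eta> * a'' z s) + cnj (\<eta> * a' z s) * a' z s) =
       2 * (\<eta> * cnj \<eta>) * (a' z s * cnj (a' z s)) + 2 * (cnj (a z s) * (\<eta>\<^sup>2 * a'' z s))"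
      by (simp add: algebra_simps power2_eq_square)
    also have "Re \<dots> = 2 * (cmod (a' z s))\<^sup>2 + 2 * Re (cnj (a z s) * (\<eta>\<^sup>2 * a'' z s))"
      unfolding complex_norm_square[symmetric] by (simp add: \<eta> del: of_real_power)
    finally show ?thesis
      by (simp add: mult_ac)
  qed
qed (use assms in \<open>auto simp: analytic_flow_def intro!: flow_intros\<close>)

lemma smooth_flow_const: "smooth_flow (\<lambda>z s. c) (\<lambda>\<eta> z s. 0) (\<lambda>\<eta> z s. 0)"
  by (rule smooth_flowI) (auto intro!: flow_intros)

lemma smooth_flow_add:
  assumes "smooth_flow u D D2" "smooth_flow v E E2"
  shows "smooth_flow (\<lambda>z s. u z s + v z s) (\<lambda>\<eta> z s. D \<eta> z s + E \<eta> z s) (\<lambda>\<eta> z s. D2 \<eta> z s + E2 \<eta> z s)"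
  using assms by (intro smooth_flowI flow_intros DERIV_add) (auto simp: smooth_flow_def)

lemma smooth_flow_cmult:
  assumes "smooth_flow u D D2"
  shows "smooth_flow (\<lambda>z s. c * u z s) (\<lambda>\<eta> z s. c * D \<eta> z s) (\<lambda>\<eta> z s. c * D2 \<eta> z s)"
  using assms by (intro smooth_flowI flow_intros DERIV_cmult) (auto simp: smooth_flow_def)

lemma smooth_flow_diff:
  assumes "smooth_flow u D D2" "smooth_flow v E E2"
  shows "smooth_flow (\<lambda>z s. u z s - v z s) (\<lambda>\<eta> z s. D \<eta> z s - E \<eta> z s) (\<lambda>\<eta> z s. D2 \<eta> z s - E2 \<eta> z s)"
  using assms by (intro smooth_flowI flow_intros DERIV_diff) (auto simp: smooth_flow_def)

lemma smooth_flow_exp: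
  assumes "smooth_flow u D D2"
  shows "smooth_flow (\<lambda>z s. exp (u z s)) (\<lambda>\<eta> z s. exp (u z s) * D \<eta> z s)
    (\<lambda>\<eta> z s. exp (u z s) * ((D \<eta> z s)\<^sup>2 + D2 \<eta> z s))"
proof (rule smooth_flowI)
  note d = smooth_flowD(4,5)[OF assms]
  show "((\<lambda>x. exp (u z (s + of_real x * \<eta>))) has_real_derivative exp (u z s) * D \<eta> z s) (at 0)"
    if "\<eta> \<in> {1, \<i>}" for \<eta> z s
    using d(1)[OF that, of z s] by (auto intro!: derivative_eq_intros)
  show "((\<lambda>x. exp (u z (s + of_real x * \<eta>)) * D \<eta> z (s + of_real x * \<eta>)) has_real_derivative
     exp (u z s) * ((D \<eta> z s)\<^sup>2 + D2 \<eta> z s)) (at 0)"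
    if "\<eta> \<in> {1, \<i>}" for \<eta> z s
    using d(1)[OF that, of z s] d(2)[OF that, of z s]
    by (auto intro!: derivative_eq_intros simp: power2_eq_square algebra_simps)
qed (use assms in \<open>auto simp: smooth_flow_def intro!: flow_intros\<close>)

lemma smooth_flow_ln:
  assumes "smooth_flow u D D2" and e: "0 < e" "\<And>z s. e \<le> u z s"
  shows "smooth_flow (\<lambda>z s. ln (u z s)) (\<lambda>\<eta> z s. D \<eta> z s / u z s)
    (\<lambda>\<eta> z s. D2 \<eta> z s / u z s - (D \<eta> z s / u z s)\<^sup>2)"
proof (rule smooth_flowI)
  note d = smooth_flowD(4,5)[OF assms(1)]
  have pos: "0 < u z s" for z s
    using e(1) e(2)[of z s] by linarith
  show "((\<lambda>x. ln (u z (s + of_real x * \<eta>))) has_real_derivative D \<eta> z s / u z s) (at 0)"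
    if "\<eta> \<in> {1, \<i>}" for \<eta> z s
    using d(1)[OF that, of z s] pos[of z s] by (auto intro!: derivative_eq_intros)
  show "((\<lambda>x. D \<eta> z (s + of_real x * \<eta>) / u z (s + of_real x * \<eta>)) has_real_derivative
     D2 \<eta> z s / u z s - (D \<eta> z s / u z s)\<^sup>2) (at 0)"
    if "\<eta> \<in> {1, \<i>}" for \<eta> z s
    using d(1)[OF that, of z s] d(2)[OF that, of z s] pos[of z s]
    by (auto intro!: derivative_eq_intros simp: power2_eq_square diff_divide_distrib)
qed (use assms in \<open>auto simp: smooth_flow_def intro!: flow_intros flow_fun_ln flow_fun_divide\<close>)

text \<open>The mean over the torus of the Laplacian is the second derivative in \<open>\<sigma>\<close> alone, because the
  mean is invariant under vertical translations.\<close>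

lemma smooth_flow_mean_derivatives:
  assumes "smooth_flow u D D2" "- 1 < \<sigma>"
  shows "((\<lambda>\<sigma>. LINT z|torus_measure. u z (of_real \<sigma>)) has_real_derivative
      (LINT z|torus_measure. D 1 z (of_real \<sigma>))) (at \<sigma>)"
    and "((\<lambda>\<sigma>. LINT z|torus_measure. D 1 z (of_real \<sigma>)) has_real_derivative
      (LINT z|torus_measure. D2 1 z (of_real \<sigma>) + D2 \<i> z (of_real \<sigma>))) (at \<sigma>)"
proof -
  have line: "((\<lambda>x. v z (s + of_real x * \<eta>)) has_real_derivative dv z (s + of_real x * \<eta>)) (at x)"
    if "\<And>z s. ((\<lambda>x. v z (s + of_real x * \<eta>)) has_real_derivative dv z s) (at 0)" for v dv z s \<eta> x
    using that[of z "s + of_real x * \<eta>"] unfolding DERIV_def by (simp add: algebra_simps)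
  have leib: "((\<lambda>x. LINT z|torus_measure. v z (s + of_real x * \<eta>)) has_real_derivative
      (LINT z|torus_measure. dv z (s + of_real x * \<eta>))) (at x)"
    if v: "flow_fun v" "flow_fun dv" "\<And>z s. ((\<lambda>x. v z (s + of_real x * \<eta>)) has_real_derivative dv z s) (at 0)"
      and S: "open S" "convex S" "x \<in> S" "\<And>x. x \<in> S \<Longrightarrow> - 1 \<le> Re (s + of_real x * \<eta>)"
    for v dv s \<eta> x S
  proof -
    obtain B where B: "\<And>z s. z \<in> space torus_measure \<Longrightarrow> - 1 \<le> Re s \<Longrightarrow> norm (dv z s) \<le> B"
      using flow_fun_bound[OF v(2)] by metis
    show ?thesis
      by (rule has_real_derivative_integral[where S = S and B = B])
         (use S B torus.finite_measure_axioms flow_fun_integrable[OF v(1)] flow_fun_measurable[OF v(2)] line[OF v(3)]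
           in \<open>simp_all del: plus_complex.sel\<close>)
  qed
  \<comment> \<open>Flow functions are bounded from Re s = -1 on, so \<sigma> = 0 is an interior
    point and two-sided derivatives are available there.\<close>
  have S: "open {- 1::real<..}" "convex {- 1::real<..}" "\<sigma> \<in> {- 1<..}" "\<And>x. x \<in> {- 1<..} \<Longrightarrow> - 1 \<le> Re (0 + of_real x * 1)"
    using assms(2) by auto
  note d = smooth_flowD[OF assms(1)]
  have 1: "1 \<in> {1, \<i>}" and i: "\<i> \<in> {1, \<i>}" by auto
  show "((\<lambda>\<sigma>. LINT z|torus_measure. u z (of_real \<sigma>)) has_real_derivative
      (LINT z|torus_measure. D 1 z (of_real \<sigma>))) (at \<sigma>)"
    using leib[OF d(1) d(2)[OF 1] d(4)[OF 1] S] by simp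
  have D2: "((\<lambda>\<sigma>. LINT z|torus_measure. D 1 z (of_real \<sigma>)) has_real_derivative
      (LINT z|torus_measure. D2 1 z (of_real \<sigma>))) (at \<sigma>)"
    using leib[OF d(2)[OF 1] d(3)[OF 1] d(5)[OF 1] S] by simp
  have const: "(LINT z|torus_measure. v z (of_real \<sigma> + of_real x * \<i>)) = (LINT z|torus_measure. v z (of_real \<sigma>))"
    if "flow_fun v" for v :: "_ \<Rightarrow> _ \<Rightarrow> real" and x
  proof -
    have "(LINT z|torus_measure. v z (of_real \<sigma> + of_real x * \<i>)) = (LINT z|torus_measure. v (rot x z) (of_real \<sigma>))"
      using that by (intro Bochner_Integration.integral_cong) (simp_all add: flow_fun_rot mult.commute)
    then show ?thesis
      using integral_rot[OF flow_fun_measurable[OF that]] by simp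
  qed
  have T: "open (UNIV::real set)" "convex (UNIV::real set)" "0 \<in> (UNIV::real set)" 
     "\<And>x. x \<in> UNIV \<Longrightarrow> - 1 \<le> Re (of_real \<sigma> + of_real x * \<i>)"
    using assms(2) by auto
  have "((\<lambda>x. LINT z|torus_measure. D \<i> z (of_real \<sigma>)) has_real_derivative
      (LINT z|torus_measure. D2 \<i> z (of_real \<sigma>))) (at 0)"
    using leib[OF d(2)[OF i] d(3)[OF i] d(5)[OF i] T] const[OF d(2)[OF i]] by simp
  then have "(LINT z|torus_measure. D2 \<i> z (of_real \<sigma>)) = 0"
    using DERIV_unique[OF DERIV_const] by metis
  then show "((\<lambda>\<sigma>. LINT z|torus_measure. D 1 z (of_real \<sigma>)) has_real_derivative
      (LINT z|torus_measure. D2 1 z (of_real \<sigma>) + D2 \<i> z (of_real \<sigma>))) (at \<sigma>)"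
    using D2 assms(2) flow_fun_integrable[OF d(3)[OF 1]] flow_fun_integrable[OF d(3)[OF i]] by simp
qed

text \<open>The mean is a bounded convex function of \<open>\<sigma> \<ge> 0\<close>.\<close>

lemma subharmonic_mean_decreasing:
  assumes u: "smooth_flow u D D2"
    and lap: "\<And>z s. z \<in> space torus_measure \<Longrightarrow> 0 \<le> Re s \<Longrightarrow> 0 \<le> D2 1 z s + D2 \<i> z s"
    and \<sigma>: "0 \<le> \<sigma>" "\<sigma> \<le> \<tau>"
  shows "(LINT z|torus_measure. u z (of_real \<tau>)) \<le> (LINT z|torus_measure. u z (of_real \<sigma>))"
proof -
  define m where "m x = (LINT z|torus_measure. u z (of_real x))" for x :: real
  define m' where "m' x = (LINT z|torus_measure. D 1 z (of_real x))" for x :: real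
  have m: "(m has_real_derivative m' x) (at x)" if "0 \<le> x" for x
    unfolding m_def m'_def using smooth_flow_mean_derivatives(1)[OF u, of x] that by simp
  have m'_mono: "m' x \<le> m' y" if "0 \<le> x" "x \<le> y" for x y
  proof (rule DERIV_nonneg_imp_nondecreasing[OF that(2)])
    fix t assume "x \<le> t" "t \<le> y"
    then show "\<exists>d. (m' has_real_derivative d) (at t) \<and> 0 \<le> d"
      unfolding m'_def using that lap
      by (intro exI[where x = "LINT z|torus_measure. D2 1 z (of_real t) + D2 \<i> z (of_real t)"] conjI
            smooth_flow_mean_derivatives(2)[OF u] Bochner_Integration.integral_nonneg) auto
  qed
  obtain B where B: "\<And>z s. z \<in> space torus_measure \<Longrightarrow> - 1 \<le> Re s \<Longrightarrow> norm (u z s) \<le> B"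
    using flow_fun_bound smooth_flowD(1)[OF u] by metis
  have mB: "\<bar>m x\<bar> \<le> B" if "0 \<le> x" for x
  proof -
    have int: "integrable torus_measure (\<lambda>z. u z (of_real x))"
      using that by (intro flow_fun_integrable[OF smooth_flowD(1)[OF u]]) simp
    have "norm (m x) \<le> (LINT z|torus_measure. norm (u z (of_real x)))"
      unfolding m_def by (rule Bochner_Integration.integral_norm_bound)
    also have "\<dots> \<le> (LINT z|torus_measure. B)"
      using B that int by (intro Bochner_Integration.integral_mono) auto
    finally have "norm (m x) \<le> (LINT z|torus_measure. B)" .
    then show ?thesis by (simp add: torus.prob_space)
  qed
  have "m' x \<le> 0" if x0: "0 \<le> x" for x
  proof (rule ccontr)
    assume pos: "\<not> m' x \<le> 0"
    \<comment> \<open>A positive slope persists to the right because \<open>m'\<close> increases.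
      Over this length \<open>m\<close> would grow by at least 2 |B| + 1, more than the bound |m|
      \<le> B allows.\<close>
    define y where "y = x + (2 * \<bar>B\<bar> + 1) / m' x"
    have xy: "x < y"
      using pos by (simp add: y_def add_nonneg_pos)
    obtain \<xi> where "x < \<xi>" "\<xi> < y" "m y - m x = (y - x) * m' \<xi>"
      using MVT2[OF xy, of m m'] m x0 by auto
    moreover have "(y - x) * m' x \<le> (y - x) * m' \<xi>"
      using calculation m'_mono[of x \<xi>] that xy by (intro mult_left_mono) auto
    ultimately have "2 * \<bar>B\<bar> + 1 \<le> m y - m x"
      using pos by (simp add: y_def)
    then show False
      using mB[of x] mB[of y] that xy by (auto simp: abs_le_iff)
  qed
  then have "m \<tau> \<le> m \<sigma>"
    using \<sigma> m by (intro DERIV_nonpos_imp_nonincreasing[OF \<sigma>(2)]) (metis order_trans)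
  then show ?thesis
    by (simp add: m_def)
qed

section \<open>Bellman functions\<close>

text \<open>The Laplacian of exp u is exp u times the squared gradient of u plus the Laplacian of u.
  In complex notation the squared gradient is 4 times the squared modulus of the s-derivative of u,
  which is the first summand of the formula. The potential contributes 4 c |g1|^2, and q ln V
  contributes the last summand, nonnegative for q \<ge> 0 by Cauchy--Schwarz. Later \<open>c\<close>
  is 0 or 1 and switches the exponential weight off or on.\<close>

lemma smooth_flow_weight:
  fixes c q e :: real
  assumes a: "analytic_flow a a1 a2" and b: "analytic_flow b b1 b2"
    and g: "analytic_flow g g1 g2" and L: "analytic_flow L L1 L2" and e: "0 < e"
  defines "V \<equiv> \<lambda>z s. e + ((cmod (a z s))\<^sup>2 + (cmod (b z s))\<^sup>2)"
  defines "\<Theta> \<equiv> \<lambda>z s. exp (c * ((cmod (g z s))\<^sup>2 - Re (L z s)) + q * ln (V z s))"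
  defines "C \<equiv> \<lambda>z s. cnj (a z s) * a1 z s + cnj (b z s) * b1 z s"
  shows "\<exists>D D2. smooth_flow \<Theta> D D2 \<and>
    (\<forall>z s. D2 1 z s + D2 \<i> z s = \<Theta> z s *
      (4 * (cmod (of_real c * (cnj (g z s) * g1 z s - L1 z s / 2) + of_real (q / V z s) * C z s))\<^sup>2 +
       4 * c * (cmod (g1 z s))\<^sup>2 +
       4 * q * (((cmod (a1 z s))\<^sup>2 + (cmod (b1 z s))\<^sup>2) / V z s - (cmod (C z s))\<^sup>2 / (V z s)\<^sup>2)))"
proof -
  note V = smooth_flow_add[OF smooth_flow_const[of e]
     smooth_flow_add[OF smooth_flow_norm_square[OF a] smooth_flow_norm_square[OF b]]]
  have Ve: "e \<le> e + ((cmod (a z s))\<^sup>2 + (cmod (b z s))\<^sup>2)" for z s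
    by simp
  note \<phi> = smooth_flow_diff[OF smooth_flow_norm_square[OF g] smooth_flow_Re[OF L]]
  note \<Theta> = smooth_flow_exp[OF smooth_flow_add[OF smooth_flow_cmult[OF \<phi>, of c]
        smooth_flow_cmult[OF smooth_flow_ln[OF V e Ve], of q]]]
  \<comment> \<open>The claim with real and imaginary parts as independent real variables.
    \<open>G\<close>, \<open>l\<close>, \<open>Sa\<close> and \<open>Sb\<close> carry the second
    derivatives; they have opposite signs in the two directions and cancel.\<close>
  have identity: "((c * (2 * G1 - l1) + q * (2 * C1 / v))\<^sup>2 + (c * (2 * N + 2 * G - l) + q * ((2 * M1 + 2 * Sa + (2 * M2 + 2 * Sb)) / v - (2 * C1 / v)\<^sup>2))) +
     ((c * (- 2 * G2 + l2) + q * (- 2 * C2 / v))\<^sup>2 + (c * (2 * N - 2 * G + l) + q * ((2 * M1 - 2 * Sa + (2 * M2 - 2 * Sb)) / v - (- 2 * C2 / v)\<^sup>2))) =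
     4 * ((c * (G1 - l1 / 2) + q / v * C1)\<^sup>2 + (c * (G2 - l2 / 2) + q / v * C2)\<^sup>2) + 4 * c * N +
     4 * q * ((M1 + M2) / v - (C1\<^sup>2 + C2\<^sup>2) / v\<^sup>2)"
    for G1 G2 G C1 C2 N l1 l2 l M1 M2 Sa Sb v :: real
    by (cases "v = 0") (simp_all add: field_simps power2_eq_square)
  show ?thesis
    unfolding V_def \<Theta>_def
  proof (intro exI conjI allI, rule \<Theta>, rule trans[OF distrib_left[symmetric]], intro arg_cong2[where f = "(*)"] refl)
    fix z s
    let ?v = "e + ((cmod (a z s))\<^sup>2 + (cmod (b z s))\<^sup>2)"
    let ?g = "cnj (g z s) * g1 z s" and ?C = "C z s" and ?l = "L1 z s"
    have r1: "2 * Re (cnj (a z s) * (1 * a1 z s)) + 2 * Re (cnj (b z s) * (1 * b1 z s)) = 2 * Re ?C"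
      by (simp add: C_def)
    have r2: "2 * Re (cnj (a z s) * (\<i> * a1 z s)) + 2 * Re (cnj (b z s) * (\<i> * b1 z s)) = - 2 * Im ?C"
      by (simp add: C_def)
    have cm: "(cmod (of_real c * (?g - ?l / 2) + of_real (q / ?v) * ?C))\<^sup>2 =
       (c * (Re ?g - Re ?l / 2) + q / ?v * Re ?C)\<^sup>2 + (c * (Im ?g - Im ?l / 2) + q / ?v * Im ?C)\<^sup>2"
      by (simp only: cmod_power2 plus_complex.sel Re_complex_of_real Im_complex_of_real times_complex.sel
          minus_complex.sel) simp
    show "(c * (2 * Re (cnj (g z s) * (1 * g1 z s)) - Re (1 * L1 z s)) +
         q * ((0 + (2 * Re (cnj (a z s) * (1 * a1 z s)) + 2 * Re (cnj (b z s) * (1 * b1 z s)))) / ?v))\<^sup>2 +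
        (c * (2 * (cmod (g1 z s))\<^sup>2 + 2 * Re (cnj (g z s) * (1\<^sup>2 * g2 z s)) - Re (1\<^sup>2 * L2 z s)) +
         q * ((0 + (2 * (cmod (a1 z s))\<^sup>2 + 2 * Re (cnj (a z s) * (1\<^sup>2 * a2 z s)) +
               (2 * (cmod (b1 z s))\<^sup>2 + 2 * Re (cnj (b z s) * (1\<^sup>2 * b2 z s))))) / ?v -
            ((0 + (2 * Re (cnj (a z s) * (1 * a1 z s)) + 2 * Re (cnj (b z s) * (1 * b1 z s)))) / ?v)\<^sup>2)) +
       ((c * (2 * Re (cnj (g z s) * (\<i> * g1 z s)) - Re (\<i> * L1 z s)) +
         q * ((0 + (2 * Re (cnj (a z s) * (\<i> * a1 z s)) + 2 * Re (cnj (b z s) * (\<i> * b1 z s)))) / ?v))\<^sup>2 +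
        (c * (2 * (cmod (g1 z s))\<^sup>2 + 2 * Re (cnj (g z s) * (\<i>\<^sup>2 * g2 z s)) - Re (\<i>\<^sup>2 * L2 z s)) +
         q * ((0 + (2 * (cmod (a1 z s))\<^sup>2 + 2 * Re (cnj (a z s) * (\<i>\<^sup>2 * a2 z s)) +
               (2 * (cmod (b1 z s))\<^sup>2 + 2 * Re (cnj (b z s) * (\<i>\<^sup>2 * b2 z s))))) / ?v -
            ((0 + (2 * Re (cnj (a z s) * (\<i> * a1 z s)) + 2 * Re (cnj (b z s) * (\<i> * b1 z s)))) / ?v)\<^sup>2))) =
      4 * (cmod (of_real c * (?g - ?l / 2) + of_real (q / ?v) * ?C))\<^sup>2 + 4 * c * (cmod (g1 z s))\<^sup>2 +
      4 * q * (((cmod (a1 z s))\<^sup>2 + (cmod (b1 z s))\<^sup>2) / ?v - (cmod ?C)\<^sup>2 / ?v\<^sup>2)"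
      unfolding r1 r2 add_0 cm
      using identity[of "Re ?g" "Re ?l" "Re ?C" ?v "(cmod (g1 z s))\<^sup>2" "Re (cnj (g z s) * g2 z s)" "Re (L2 z s)"
          "(cmod (a1 z s))\<^sup>2" "Re (cnj (a z s) * a2 z s)" "(cmod (b1 z s))\<^sup>2" "Re (cnj (b z s) * b2 z s)"
          "Im ?g" "Im ?l" "Im ?C"]
      unfolding cmod_power2[of ?C]
      by (simp add: algebra_simps)
  qed
qed

lemma analytic_flow_zero: "analytic_flow (\<lambda>z s. 0) (\<lambda>z s. 0) (\<lambda>z s. 0)"
  by (simp add: analytic_flow_def flow_fun_const)

text \<open>With one function, |C|^2 = |a|^2 |a1|^2, so the last summand collapses to a multiple of
  e |a1|^2 / V^2: only the contribution of the regularization is left, and its sign is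
  evident.\<close>

lemma smooth_flow_weight_single:
  fixes c q e :: real
  assumes a: "analytic_flow a a1 a2" and g: "analytic_flow g g1 g2" and L: "analytic_flow L L1 L2" and e: "0 < e"
  defines "V \<equiv> \<lambda>z s. e + (cmod (a z s))\<^sup>2"
  defines "\<Theta> \<equiv> \<lambda>z s. exp (c * ((cmod (g z s))\<^sup>2 - Re (L z s)) + q * ln (V z s))"
  shows "\<exists>D D2. smooth_flow \<Theta> D D2 \<and>
    (\<forall>z s. D2 1 z s + D2 \<i> z s = \<Theta> z s *
      (4 * (cmod (of_real c * (cnj (g z s) * g1 z s - L1 z s / 2) + of_real (q / V z s) * (cnj (a z s) * a1 z s)))\<^sup>2 +
       4 * c * (cmod (g1 z s))\<^sup>2 + 4 * q * e * (cmod (a1 z s) / V z s)\<^sup>2))"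
proof -
  have V: "0 < V z s" for z s
    using e by (simp add: V_def add_pos_nonneg)
  have "(cmod (a1 z s))\<^sup>2 / V z s - (cmod (a z s))\<^sup>2 * (cmod (a1 z s))\<^sup>2 / (V z s)\<^sup>2 = e * (cmod (a1 z s) / V z s)\<^sup>2" for z s
  proof -
    have "(cmod (a1 z s))\<^sup>2 / V z s = (cmod (a1 z s))\<^sup>2 * V z s / (V z s)\<^sup>2"
      using V[of z s] by (simp add: power2_eq_square)
    also have "\<dots> - (cmod (a z s))\<^sup>2 * (cmod (a1 z s))\<^sup>2 / (V z s)\<^sup>2 = e * (cmod (a1 z s) / V z s)\<^sup>2"
      unfolding diff_divide_distrib[symmetric] by (simp add: V_def power_divide algebra_simps)
    finally show ?thesis .
  qed
  then have M: "((cmod (a1 z s))\<^sup>2 + (cmod 0)\<^sup>2) / V z s - (cmod (cnj (a z s) * a1 z s))\<^sup>2 / (V z s)\<^sup>2 =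
      e * (cmod (a1 z s) / V z s)\<^sup>2" for z s
    by (simp add: norm_mult power_mult_distrib)
  have V0: "e + ((cmod (a z s))\<^sup>2 + (cmod 0)\<^sup>2) = V z s" for z s
    by (simp add: V_def)
  have C0: "cnj (a z s) * a1 z s + cnj 0 * 0 = cnj (a z s) * a1 z s" for z s
    by simp
  show ?thesis
    using smooth_flow_weight[OF a analytic_flow_zero g L e, of c q]
    unfolding V0 C0 M \<Theta>_def mult.assoc .
qed

text \<open>The Bellman functions below end up at least \<open>- R\<close> at height \<open>\<tau>\<close>, with \<open>R\<close> negligible as
  \<open>\<tau> \<rightarrow> \<infinity>\<close>; since their means decrease in the height, the means are nonnegative at height \<open>0\<close>.\<close>

lemma subharmonic_mean_nonneg:
  assumes W: "smooth_flow W D D2"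
    and lap: "\<And>z s. z \<in> space torus_measure \<Longrightarrow> 0 \<le> Re s \<Longrightarrow> 0 \<le> D2 1 z s + D2 \<i> z s"
    and R: "flow_fun R" "\<And>z \<tau>. z \<in> space torus_measure \<Longrightarrow> 0 \<le> \<tau> \<Longrightarrow> - R z (of_real \<tau>) \<le> W z (of_real \<tau>)"
      "\<And>z. z \<in> space torus_measure \<Longrightarrow> ((\<lambda>\<tau>. R z (of_real \<tau>)) \<longlongrightarrow> 0) at_top"
  shows "0 \<le> (LINT z|torus_measure. W z 0)"
proof -
  obtain B where B: "\<And>z s. z \<in> space torus_measure \<Longrightarrow> - 1 \<le> Re s \<Longrightarrow> norm (R z s) \<le> B"
    using flow_fun_bound[OF R(1)] by metis
  have "((\<lambda>\<tau>. LINT z|torus_measure. R z (of_real \<tau>)) \<longlongrightarrow> (LINT z|torus_measure. 0)) at_top"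
  proof (rule integral_dominated_convergence_at_top[where w = "\<lambda>_. B"])
    show "\<forall>\<^sub>F \<tau> in at_top. AE z in torus_measure. norm (R z (of_real \<tau>)) \<le> B"
      using eventually_ge_at_top[of 0] by eventually_elim (intro AE_I2 B, auto)
    show "(\<lambda>z. R z (of_real \<tau>)) \<in> borel_measurable torus_measure" for \<tau>
      by (rule flow_fun_measurable[OF R(1)])
  qed (use R(3) in simp_all)
  then have "((\<lambda>\<tau>. - (LINT z|torus_measure. R z (of_real \<tau>))) \<longlongrightarrow> 0) at_top"
    using tendsto_minus[of _ 0] by fastforce
  moreover have "\<forall>\<^sub>F \<tau> in at_top. - (LINT z|torus_measure. R z (of_real \<tau>)) \<le> (LINT z|torus_measure. W z 0)"
    using eventually_ge_at_top[of 0]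
  proof eventually_elim
    fix \<tau> :: real assume \<tau>: "0 \<le> \<tau>"
    have "- (LINT z|torus_measure. R z (of_real \<tau>)) = (LINT z|torus_measure. - R z (of_real \<tau>))"
      by simp
    also have "\<dots> \<le> (LINT z|torus_measure. W z (of_real \<tau>))"
      using \<tau> R(2) flow_fun_integrable[OF R(1), of \<tau>] flow_fun_integrable[OF smooth_flowD(1)[OF W], of \<tau>]
      by (intro Bochner_Integration.integral_mono) auto
    also have "\<dots> \<le> (LINT z|torus_measure. W z (of_real 0))"
      using \<tau> by (intro subharmonic_mean_decreasing[OF W lap]) auto
    finally show "- (LINT z|torus_measure. R z (of_real \<tau>)) \<le> (LINT z|torus_measure. W z 0)" by simp
  qed
  ultimately show ?thesis
    by (intro tendsto_upperbound) auto
qed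

text \<open>\<open>H\<close> is the Volterra transform of \<open>f\<close> along the flow. Since \<open>L\<close> is analytic, \<open>\<bar>g\<bar>\<^sup>2 - Re L\<close> has the
  Laplacian \<open>4 \<bar>g1\<bar>\<^sup>2\<close>; its boundedness lets it serve as an exponent in the Bellman functions.\<close>

locale volterra_flow =
  fixes f f1 f2 H H1 H2 g g1 g2 L L1 L2 :: "(nat \<Rightarrow> complex) \<Rightarrow> complex \<Rightarrow> complex" and K :: real
  assumes f: "analytic_flow f f1 f2" and H: "analytic_flow H H1 H2"
    and g: "analytic_flow g g1 g2" and L: "analytic_flow L L1 L2"
    and H1: "\<And>z s. H1 z s = f z s * g1 z s"
    and K: "\<And>z s. z \<in> space torus_measure \<Longrightarrow> 0 \<le> Re s \<Longrightarrow> \<bar>(cmod (g z s))\<^sup>2 - Re (L z s)\<bar> \<le> K"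
    and H_lim: "\<And>z. z \<in> space torus_measure \<Longrightarrow> ((\<lambda>\<tau>. H z (of_real \<tau>)) \<longlongrightarrow> 0) at_top"
begin

abbreviation \<phi> :: "(nat \<Rightarrow> complex) \<Rightarrow> complex \<Rightarrow> real" where
  "\<phi> z s \<equiv> (cmod (g z s))\<^sup>2 - Re (L z s)"

lemma exp_\<phi>_bounds:
  assumes "z \<in> space torus_measure" "0 \<le> Re s"
  shows "exp (- K) \<le> exp (\<phi> z s)" "exp (\<phi> z s) \<le> exp K"
  using K[OF assms] by (auto simp: abs_le_iff)

text \<open>For q \<le> 1 the Laplacian of V^q is at most 4 q V^(q-1) (|f1|^2 + |f|^2 |g1|^2).
  Keeping |f|^2 inside V gives V \<ge> U, hence V^(q-1) \<le> U^(q-1), and |f|^2 U^(q-1) \<le> U^q.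
  The part with |f1|^2 is absorbed by U^q / q, whose Laplacian is at least 4 q U^(q-1) |f1|^2; the
  part with |g1|^2 is absorbed by q exp K times exp \<phi> U^q.\<close>

lemma mean_bound_small:
  assumes q: "0 < q" "q \<le> 1" and e: "0 < e"
  shows "(LINT z|torus_measure. (e + ((cmod (f z 0))\<^sup>2 + (cmod (H z 0))\<^sup>2)) powr q) \<le>
    (q * exp K * exp K + 1 / q) * (LINT z|torus_measure. (e + (cmod (f z 0))\<^sup>2) powr q)"
proof -
  define U where "U z s = e + (cmod (f z s))\<^sup>2" for z s
  define V where "V z s = e + ((cmod (f z s))\<^sup>2 + (cmod (H z s))\<^sup>2)" for z s
  define T1 where "T1 z s = exp (1 * \<phi> z s + q * ln (U z s))" for z s
  define T2 where "T2 z s = exp (0 * \<phi> z s + q * ln (U z s))" for z s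
  define T3 where "T3 z s = exp (0 * \<phi> z s + q * ln (V z s))" for z s
  have U: "e \<le> U z s" "0 < U z s" and UV: "U z s \<le> V z s" and V: "0 < V z s" for z s
    using e by (auto simp: U_def V_def add_pos_nonneg)
  obtain D1 E1 where T1: "smooth_flow T1 D1 E1" and
    E1: "\<And>z s. E1 1 z s + E1 \<i> z s = T1 z s *
      (4 * (cmod (of_real 1 * (cnj (g z s) * g1 z s - L1 z s / 2) + of_real (q / U z s) * (cnj (f z s) * f1 z s)))\<^sup>2 +
       4 * 1 * (cmod (g1 z s))\<^sup>2 + 4 * q * e * (cmod (f1 z s) / U z s)\<^sup>2)"
    using smooth_flow_weight_single[OF f g L e, of 1 q] unfolding U_def T1_def by blast
  obtain D2 E2 where T2: "smooth_flow T2 D2 E2" and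
    E2: "\<And>z s. E2 1 z s + E2 \<i> z s = T2 z s *
      (4 * (cmod (of_real 0 * (cnj (g z s) * g1 z s - L1 z s / 2) + of_real (q / U z s) * (cnj (f z s) * f1 z s)))\<^sup>2 +
       4 * 0 * (cmod (g1 z s))\<^sup>2 + 4 * q * e * (cmod (f1 z s) / U z s)\<^sup>2)"
    using smooth_flow_weight_single[OF f g L e, of 0 q] unfolding U_def T2_def by blast
  obtain D3 E3 where T3: "smooth_flow T3 D3 E3" and
    E3: "\<And>z s. E3 1 z s + E3 \<i> z s = T3 z s *
      (4 * (cmod (of_real 0 * (cnj (g z s) * g1 z s - L1 z s / 2) + of_real (q / V z s) * (cnj (f z s) * f1 z s + cnj (H z s) * H1 z s)))\<^sup>2 +
       4 * 0 * (cmod (g1 z s))\<^sup>2 +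
       4 * q * (((cmod (f1 z s))\<^sup>2 + (cmod (H1 z s))\<^sup>2) / V z s - (cmod (cnj (f z s) * f1 z s + cnj (H z s) * H1 z s))\<^sup>2 / (V z s)\<^sup>2))"
    using smooth_flow_weight[OF f H g L e, of 0 q] unfolding V_def T3_def by blast
  have Tpos: "0 < T1 z s" "0 < T2 z s" "0 < T3 z s" for z s
    by (simp_all add: T1_def T2_def T3_def)
  have T12: "T1 z s = exp (\<phi> z s) * T2 z s" for z s
    by (simp add: T1_def T2_def exp_add)
  have T23: "T2 z s \<le> T3 z s" for z s
    using UV[of z s] U[of z s] V[of z s] q by (simp add: T2_def T3_def)
  have T32: "T3 z s / V z s \<le> T2 z s / U z s" for z s
  proof -
    have "q * ln (V z s) - ln (V z s) \<le> q * ln (U z s) - ln (U z s)"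
      using mult_right_mono_neg[of "ln (U z s)" "ln (V z s)" "q - 1"] UV[of z s] U[of z s] V[of z s] q
      by (simp add: algebra_simps)
    then have "exp (q * ln (V z s) - ln (V z s)) \<le> exp (q * ln (U z s) - ln (U z s))" by simp
    then show ?thesis
      using U[of z s] V[of z s] by (simp add: T2_def T3_def exp_diff)
  qed
  let ?A = "q * exp K" and ?B = "1 / q"
  define W where "W z s = ?A * T1 z s + ?B * T2 z s - T3 z s" for z s
  note W = smooth_flow_diff[OF smooth_flow_add[OF smooth_flow_cmult[OF T1, of ?A] smooth_flow_cmult[OF T2, of ?B]] T3]
  have "0 \<le> (LINT z|torus_measure. W z 0)"
    unfolding W_def
  proof (rule subharmonic_mean_nonneg[OF W])
    fix z s assume zs: "z \<in> space torus_measure" "0 \<le> Re s"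
    have 1: "4 * T1 z s * (cmod (g1 z s))\<^sup>2 \<le> E1 1 z s + E1 \<i> z s"
      using q e Tpos[of z s] U[of z s]
      unfolding E1 by (simp add: algebra_simps del: of_real_divide)
    have "q * (T2 z s * exp K) * exp (- K) \<le> q * (T2 z s * exp K) * exp (\<phi> z s)"
      using exp_\<phi>_bounds(1)[OF zs] q Tpos[of z s] by (intro mult_left_mono) auto
    also have "q * (T2 z s * exp K) * exp (- K) = q * T2 z s"
      by (simp add: mult.assoc exp_add[symmetric])
    finally have "q * T2 z s \<le> ?A * T1 z s"
      by (simp add: T12 mult_ac)
    then have "4 * (q * T2 z s) * (cmod (g1 z s))\<^sup>2 \<le> 4 * (?A * T1 z s) * (cmod (g1 z s))\<^sup>2"
      by (intro mult_right_mono) auto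
    also have "\<dots> \<le> ?A * (E1 1 z s + E1 \<i> z s)"
      using mult_left_mono[OF 1, of ?A] q by (simp add: mult_ac)
    finally have 1: "4 * q * T2 z s * (cmod (g1 z s))\<^sup>2 \<le> ?A * (E1 1 z s + E1 \<i> z s)" by simp
    have "4 * q * (T2 z s / U z s) * (cmod (f1 z s))\<^sup>2 \<le> ?B * (E2 1 z s + E2 \<i> z s)"
    proof -
      have "4 * q * q * (cmod (f1 z s))\<^sup>2 / U z s = 4 * q * q * (U z s) * (cmod (f1 z s) / U z s)\<^sup>2"
        using U[of z s] by (simp add: power2_eq_square)
      also have "\<dots> = 4 * q * q * (cmod (f z s))\<^sup>2 * (cmod (f1 z s) / U z s)\<^sup>2 + 4 * q * (q * e) * (cmod (f1 z s) / U z s)\<^sup>2"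
        by (simp add: U_def algebra_simps)
      also have "\<dots> \<le> 4 * q * q * (cmod (f z s))\<^sup>2 * (cmod (f1 z s) / U z s)\<^sup>2 + 4 * q * e * (cmod (f1 z s) / U z s)\<^sup>2"
        using q e by (intro add_left_mono mult_right_mono mult_left_mono) (auto simp: mult_left_le_one_le)
      also have "\<dots> = 4 * (cmod (of_real (q / U z s) * (cnj (f z s) * f1 z s)))\<^sup>2 + 4 * q * e * (cmod (f1 z s) / U z s)\<^sup>2"
        by (simp add: norm_mult norm_divide power_mult_distrib power_divide power2_eq_square)
      finally have "T2 z s * (4 * q * q * (cmod (f1 z s))\<^sup>2 / U z s) \<le> E2 1 z s + E2 \<i> z s"
        unfolding E2 using Tpos[of z s] by (intro mult_left_mono) (auto simp del: of_real_divide)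
      then show ?thesis
        using q by (simp add: field_simps)
    qed
    moreover have "E3 1 z s + E3 \<i> z s \<le> 4 * q * (T2 z s / U z s) * (cmod (f1 z s))\<^sup>2 + 4 * q * T2 z s * (cmod (g1 z s))\<^sup>2"
    proof -
      let ?M = "(cmod (f1 z s))\<^sup>2 + (cmod (H1 z s))\<^sup>2" and ?C = "cnj (f z s) * f1 z s + cnj (H z s) * H1 z s"
      have "q * q * ((cmod ?C)\<^sup>2 / (V z s)\<^sup>2) \<le> q * ((cmod ?C)\<^sup>2 / (V z s)\<^sup>2)"
        using q by (intro mult_right_mono) (auto simp: mult_left_le_one_le)
      moreover have "(cmod (of_real (q / V z s) * ?C))\<^sup>2 = q * q * ((cmod ?C)\<^sup>2 / (V z s)\<^sup>2)"
        unfolding norm_mult norm_of_real power_mult_distrib power2_abs power_divide by (simp add: power2_eq_square)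
      ultimately have "4 * (cmod (of_real (q / V z s) * ?C))\<^sup>2 + 4 * q * (?M / V z s - (cmod ?C)\<^sup>2 / (V z s)\<^sup>2) \<le> 4 * q * (?M / V z s)"
        by (simp only: right_diff_distrib)
      then have "E3 1 z s + E3 \<i> z s \<le> T3 z s * (4 * q * (?M / V z s))"
        unfolding E3 using Tpos[of z s] by (intro mult_left_mono) (auto simp del: of_real_divide)
      also have "\<dots> = 4 * q * ?M * (T3 z s / V z s)" by simp
      also have "\<dots> \<le> 4 * q * ?M * (T2 z s / U z s)"
        using q T32[of z s] by (intro mult_left_mono) auto
      also have "\<dots> = 4 * q * (T2 z s / U z s) * (cmod (f1 z s))\<^sup>2 + 4 * q * T2 z s * ((cmod (f z s))\<^sup>2 / U z s * (cmod (g1 z s))\<^sup>2)"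
        by (simp add: H1 norm_mult power_mult_distrib algebra_simps add_divide_distrib)
      also have "(cmod (f z s))\<^sup>2 / U z s * (cmod (g1 z s))\<^sup>2 \<le> 1 * (cmod (g1 z s))\<^sup>2"
        using U[of z s] e by (intro mult_right_mono) (auto simp: U_def)
      finally show ?thesis
        using q Tpos[of z s] by (simp add: mult_left_mono)
    qed
    ultimately have "0 \<le> ?A * (E1 1 z s + E1 \<i> z s) + ?B * (E2 1 z s + E2 \<i> z s) - (E3 1 z s + E3 \<i> z s)"
      using 1 by linarith
    then show "0 \<le> (?A * E1 1 z s + ?B * E2 1 z s - E3 1 z s) + (?A * E1 \<i> z s + ?B * E2 \<i> z s - E3 \<i> z s)"
      by (simp add: algebra_simps)
  next
    \<comment> \<open>The remainder V^q - U^q suffices because U^q / q \<ge> U^q, and it vanishes at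
      infinity because V - U = |H|^2 does.\<close>
    show "flow_fun (\<lambda>z s. T3 z s - T2 z s)"
      by (intro flow_intros smooth_flowD(1)[OF T3] smooth_flowD(1)[OF T2])
  next
    fix z :: "nat \<Rightarrow> complex" and \<tau> :: real
    have "0 \<le> ?A * T1 z \<tau>"
      using q Tpos[of z \<tau>] by simp
    moreover have "1 * T2 z \<tau> \<le> ?B * T2 z \<tau>"
      using q Tpos[of z \<tau>] by (intro mult_right_mono) auto
    ultimately show "- (T3 z \<tau> - T2 z \<tau>) \<le> ?A * T1 z \<tau> + ?B * T2 z \<tau> - T3 z \<tau>"
      by simp
  next
    fix z assume z: "z \<in> space torus_measure"
    obtain B where B: "\<And>s. - 1 \<le> Re s \<Longrightarrow> norm (T2 z s) \<le> B"
      using flow_fun_bound[OF smooth_flowD(1)[OF T2]] z by metis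
    have "((\<lambda>\<tau>. B * (exp (q * ((cmod (H z (of_real \<tau>)))\<^sup>2 / e)) - 1)) \<longlongrightarrow> B * (exp (q * ((cmod 0)\<^sup>2 / e)) - 1)) at_top"
      by (intro tendsto_intros H_lim z) (use e in auto)
    then have lim: "((\<lambda>\<tau>. B * (exp (q * ((cmod (H z (of_real \<tau>)))\<^sup>2 / e)) - 1)) \<longlongrightarrow> 0) at_top"
      by simp
    show "((\<lambda>\<tau>. T3 z (of_real \<tau>) - T2 z (of_real \<tau>)) \<longlongrightarrow> 0) at_top"
    proof (rule tendsto_sandwich[OF _ _ tendsto_const lim])
      show "\<forall>\<^sub>F \<tau> in at_top. 0 \<le> T3 z (of_real \<tau>) - T2 z (of_real \<tau>)"
        using T23 by simp
      show "\<forall>\<^sub>F \<tau> in at_top. T3 z (of_real \<tau>) - T2 z (of_real \<tau>) \<le> B * (exp (q * ((cmod (H z (of_real \<tau>)))\<^sup>2 / e)) - 1)"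
        using eventually_ge_at_top[of 0]
      proof eventually_elim
        fix \<tau> :: real assume \<tau>: "0 \<le> \<tau>"
        let ?u = "U z (of_real \<tau>)" and ?v = "V z (of_real \<tau>)"
        \<comment> \<open>Concavity of \<open>ln\<close> together with U \<ge> e bounds the quotient
          V^q / U^q by exp (q |H|^2 / e).\<close>
        have "ln ?v - ln ?u \<le> (?v - ?u) / ?u"
          using U V ln_diff_le by blast
        also have "\<dots> \<le> (?v - ?u) / e"
          using U UV e by (intro divide_left_mono) auto
        also have "?v - ?u = (cmod (H z (of_real \<tau>)))\<^sup>2"
          by (simp add: U_def V_def)
        finally have d: "q * (ln ?v - ln ?u) \<le> q * ((cmod (H z (of_real \<tau>)))\<^sup>2 / e)"
          using q by (intro mult_left_mono) auto
        have "T3 z (of_real \<tau>) - T2 z (of_real \<tau>) = T2 z (of_real \<tau>) * (exp (q * (ln ?v - ln ?u)) - 1)"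
          by (simp add: T2_def T3_def right_diff_distrib exp_add[symmetric])
        also have "\<dots> \<le> T2 z (of_real \<tau>) * (exp (q * ((cmod (H z (of_real \<tau>)))\<^sup>2 / e)) - 1)"
          using d Tpos by (intro mult_left_mono) (auto intro: less_imp_le)
        also have "\<dots> \<le> B * (exp (q * ((cmod (H z (of_real \<tau>)))\<^sup>2 / e)) - 1)"
          using B[of "of_real \<tau>"] \<tau> q e by (intro mult_right_mono) auto
        finally show "T3 z (of_real \<tau>) - T2 z (of_real \<tau>) \<le> B * (exp (q * ((cmod (H z (of_real \<tau>)))\<^sup>2 / e)) - 1)" .
      qed
    qed
  qed
  also have "(LINT z|torus_measure. W z 0) \<le> (LINT z|torus_measure. (?A * exp K + ?B) * T2 z 0 - T3 z 0)"
  proof (rule Bochner_Integration.integral_mono)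
    show "integrable torus_measure (\<lambda>z. W z 0)"
      unfolding W_def by (rule flow_fun_integrable[OF smooth_flowD(1)[OF W]]) simp
    show "integrable torus_measure (\<lambda>z. (?A * exp K + ?B) * T2 z 0 - T3 z 0)"
      using flow_fun_integrable[OF smooth_flowD(1)[OF T2], of 0] flow_fun_integrable[OF smooth_flowD(1)[OF T3], of 0] by simp
    fix z assume z: "z \<in> space torus_measure"
    have "?A * T1 z 0 \<le> ?A * (exp K * T2 z 0)"
      unfolding T12 using q exp_\<phi>_bounds(2)[OF z, of 0] Tpos[of z 0]
      by (intro mult_left_mono mult_right_mono) auto
    then show "W z 0 \<le> (?A * exp K + ?B) * T2 z 0 - T3 z 0"
      by (simp add: W_def algebra_simps)
  qed
  also have "\<dots> = (?A * exp K + ?B) * (LINT z|torus_measure. T2 z 0) - (LINT z|torus_measure. T3 z 0)"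
    using flow_fun_integrable[OF smooth_flowD(1)[OF T2], of 0] flow_fun_integrable[OF smooth_flowD(1)[OF T3], of 0] by simp
  also have "(\<lambda>z. T2 z 0) = (\<lambda>z. (e + (cmod (f z 0))\<^sup>2) powr q)"
  proof
    show "T2 z 0 = (e + (cmod (f z 0))\<^sup>2) powr q" for z
      using U(2)[of z 0] by (simp add: T2_def U_def powr_def)
  qed
  also have "(\<lambda>z. T3 z 0) = (\<lambda>z. (e + ((cmod (f z 0))\<^sup>2 + (cmod (H z 0))\<^sup>2)) powr q)"
  proof
    show "T3 z 0 = (e + ((cmod (f z 0))\<^sup>2 + (cmod (H z 0))\<^sup>2)) powr q" for z
      using V[of z 0] by (simp add: T3_def V_def powr_def)
  qed
  finally show ?thesis by simp
qed

text \<open>For \<open>q > 1\<close> the Laplacian of \<open>V powr q\<close> produces \<open>V powr (q - 1) * U\<close>, which is at most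
  \<open>\<delta> * V powr q + \<delta> powr (1 - q) * U powr q\<close>; \<open>\<delta>\<close> is so small that the first part is absorbed by the
  Laplacian of \<open>exp \<phi> * V powr q / (2 * exp K)\<close>.\<close>

lemma mean_bound_large:
  assumes q: "1 \<le> q" and e: "0 < e"
  defines "A \<equiv> exp K * (1 + q * q * (exp (- 2 * K) / (2 * (q * q))) powr (1 - q))"
  shows "(LINT z|torus_measure. (e + (cmod (H z 0))\<^sup>2) powr q) \<le>
    2 * A * exp K * (LINT z|torus_measure. (e + (cmod (f z 0))\<^sup>2) powr q)"
proof -
  \<comment> \<open>Chosen so that q^2 \<delta> = \<open>?\<eta>\<close> exp (- K); then
    \<open>?\<eta>\<close> times the Laplacian of exp \<phi> V^q absorbs the part with
    \<delta>.\<close>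
  define \<delta> where "\<delta> = exp (- 2 * K) / (2 * (q * q))"
  have \<delta>: "0 < \<delta>"
    using q by (simp add: \<delta>_def)
  have A_eq: "A = exp K * (1 + q * q * \<delta> powr (1 - q))"
    by (simp add: A_def \<delta>_def)
  \<comment> \<open>At height 0, exp \<phi> \<le> exp K makes this multiple of exp \<phi> V^q at
    most V^q / 2, so half of V^q remains to be estimated.\<close>
  let ?\<eta> = "exp (- K) / 2"
  define U where "U z s = e + (cmod (f z s))\<^sup>2" for z s
  define V where "V z s = e + (cmod (H z s))\<^sup>2" for z s
  define T1 where "T1 z s = exp (1 * \<phi> z s + q * ln (U z s))" for z s
  define T2 where "T2 z s = exp (1 * \<phi> z s + q * ln (V z s))" for z s
  define T3 where "T3 z s = exp (0 * \<phi> z s + q * ln (V z s))" for z s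
  have U: "e \<le> U z s" "0 < U z s" and V: "e \<le> V z s" "0 < V z s" for z s
    using e by (auto simp: U_def V_def add_pos_nonneg)
  have T1_eq: "T1 z s = exp (\<phi> z s) * U z s powr q" for z s
    using U[of z s] by (simp add: T1_def powr_def exp_add)
  have T2_eq: "T2 z s = exp (\<phi> z s) * V z s powr q" for z s
    using V[of z s] by (simp add: T2_def powr_def exp_add)
  have T3_eq: "T3 z s = V z s powr q" for z s
    using V[of z s] by (simp add: T3_def powr_def)
  obtain D1 E1 where T1: "smooth_flow T1 D1 E1" and
    E1: "\<And>z s. E1 1 z s + E1 \<i> z s = T1 z s *
      (4 * (cmod (of_real 1 * (cnj (g z s) * g1 z s - L1 z s / 2) + of_real (q / U z s) * (cnj (f z s) * f1 z s)))\<^sup>2 +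
       4 * 1 * (cmod (g1 z s))\<^sup>2 + 4 * q * e * (cmod (f1 z s) / U z s)\<^sup>2)"
    using smooth_flow_weight_single[OF f g L e, of 1 q] unfolding U_def T1_def by blast
  obtain D2 E2 where T2: "smooth_flow T2 D2 E2" and
    E2: "\<And>z s. E2 1 z s + E2 \<i> z s = T2 z s *
      (4 * (cmod (of_real 1 * (cnj (g z s) * g1 z s - L1 z s / 2) + of_real (q / V z s) * (cnj (H z s) * H1 z s)))\<^sup>2 +
       4 * 1 * (cmod (g1 z s))\<^sup>2 + 4 * q * e * (cmod (H1 z s) / V z s)\<^sup>2)"
    using smooth_flow_weight_single[OF H g L e, of 1 q] unfolding V_def T2_def by blast
  obtain D3 E3 where T3: "smooth_flow T3 D3 E3" and
    E3: "\<And>z s. E3 1 z s + E3 \<i> z s = T3 z s *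
      (4 * (cmod (of_real 0 * (cnj (g z s) * g1 z s - L1 z s / 2) + of_real (q / V z s) * (cnj (H z s) * H1 z s)))\<^sup>2 +
       4 * 0 * (cmod (g1 z s))\<^sup>2 + 4 * q * e * (cmod (H1 z s) / V z s)\<^sup>2)"
    using smooth_flow_weight_single[OF H g L e, of 0 q] unfolding V_def T3_def by blast
  have Tpos: "0 < T1 z s" "0 < T2 z s" "0 < T3 z s" for z s
    by (simp_all add: T1_def T2_def T3_def)
  define W where "W z s = A * T1 z s + ?\<eta> * T2 z s - T3 z s" for z s
  note W = smooth_flow_diff[OF smooth_flow_add[OF smooth_flow_cmult[OF T1, of A] smooth_flow_cmult[OF T2, of ?\<eta>]] T3]
  \<comment> \<open>The first bound serves at infinity, where A exp \<phi> U^q has to dominate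
    \<open>e powr q\<close>, the limit of V^q; it comes from the summand 1 in \<open>A\<close>. The
    second bound serves the splitting of V^(q-1) |f|^2.\<close>
  have A: "exp K \<le> A" "exp K * (q * q) * \<delta> powr (1 - q) \<le> A" "0 \<le> A"
    using q by (simp_all add: A_eq algebra_simps)
  have "0 \<le> (LINT z|torus_measure. W z 0)"
    unfolding W_def
  proof (rule subharmonic_mean_nonneg[OF W])
    fix z s assume zs: "z \<in> space torus_measure" "0 \<le> Re s"
    note \<phi> = exp_\<phi>_bounds[OF zs]
    have "q * q * \<delta> powr (1 - q) * U z s powr q = (exp K * (q * q) * \<delta> powr (1 - q)) * (exp (- K) * U z s powr q)"
      by (simp add: exp_minus)
    also have "\<dots> \<le> A * T1 z s"
      unfolding T1_eq using A \<phi> by (intro mult_mono) auto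
    finally have "q * q * \<delta> powr (1 - q) * U z s powr q * (4 * (cmod (g1 z s))\<^sup>2) \<le> A * T1 z s * (4 * (cmod (g1 z s))\<^sup>2)"
      by (intro mult_right_mono) auto
    also have "\<dots> \<le> A * (E1 1 z s + E1 \<i> z s)"
      unfolding E1 mult.assoc using q e A Tpos(1)[of z s] by (intro mult_left_mono) auto
    finally have 1: "q * q * \<delta> powr (1 - q) * U z s powr q * (4 * (cmod (g1 z s))\<^sup>2) \<le> A * (E1 1 z s + E1 \<i> z s)" .
    have "q * q * \<delta> * V z s powr q = ?\<eta> * (exp (- K) * V z s powr q)"
      using q by (simp add: \<delta>_def exp_add[symmetric])
    also have "\<dots> \<le> ?\<eta> * T2 z s"
      unfolding T2_eq using \<phi> by (intro mult_left_mono mult_right_mono) auto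
    finally have "q * q * \<delta> * V z s powr q * (4 * (cmod (g1 z s))\<^sup>2) \<le> ?\<eta> * T2 z s * (4 * (cmod (g1 z s))\<^sup>2)"
      by (intro mult_right_mono) auto
    also have "\<dots> \<le> ?\<eta> * (E2 1 z s + E2 \<i> z s)"
      unfolding E2 mult.assoc using q e Tpos(2)[of z s] by (intro mult_left_mono) auto
    finally have 2: "q * q * \<delta> * V z s powr q * (4 * (cmod (g1 z s))\<^sup>2) \<le> ?\<eta> * (E2 1 z s + E2 \<i> z s)" .
    have young: "V z s powr (q - 1) * (cmod (f z s))\<^sup>2 \<le> \<delta> * V z s powr q + \<delta> powr (1 - q) * U z s powr q"
    \<comment> \<open>Either |f|^2 is a small multiple of V, or V \<le> U / \<delta>, and V^(q-1)
      can be traded for U^(q-1) because q - 1 \<ge> 0.\<close>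
    proof (cases "(cmod (f z s))\<^sup>2 \<le> \<delta> * V z s")
      case True
      then have "V z s powr (q - 1) * (cmod (f z s))\<^sup>2 \<le> V z s powr (q - 1) * (\<delta> * V z s)"
        by (intro mult_left_mono) auto
      also have "\<dots> = \<delta> * V z s powr q"
        using V[of z s] by (simp add: powr_diff)
      finally show ?thesis
        by (simp add: add_increasing2)
    next
      case False
      then have "\<delta> * V z s \<le> U z s"
        using e by (simp add: U_def)
      then have "(\<delta> * V z s) powr (q - 1) \<le> U z s powr (q - 1)"
        using V[of z s] \<delta> q by (intro powr_mono2) auto
      then have "(\<delta> * V z s) powr (q - 1) * (cmod (f z s))\<^sup>2 \<le> U z s powr (q - 1) * U z s"
        using e by (intro mult_mono) (auto simp: U_def)
      also have "\<dots> = U z s powr q"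
        using U[of z s] by (simp add: powr_diff)
      finally have "\<delta> powr (1 - q) * ((\<delta> * V z s) powr (q - 1) * (cmod (f z s))\<^sup>2) \<le> \<delta> powr (1 - q) * U z s powr q"
        by (intro mult_left_mono) auto
      also have "\<delta> powr (1 - q) * ((\<delta> * V z s) powr (q - 1) * (cmod (f z s))\<^sup>2) = V z s powr (q - 1) * (cmod (f z s))\<^sup>2"
        using \<delta> V[of z s] by (simp add: powr_mult powr_diff)
      finally show ?thesis
        using \<delta> by (simp add: add_increasing)
    qed
    have "E3 1 z s + E3 \<i> z s \<le> V z s powr q * (4 * q * q * (cmod (H1 z s))\<^sup>2 / V z s)"
      unfolding E3 T3_eq
    proof (rule mult_left_mono)
      \<comment> \<open>Here q \<ge> 1 enters: the regularizing term grows when 4 q is replaced by 4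
        q^2, and it then combines with the gradient term, since e + |H|^2 = V.\<close>
      have "4 * q * e * (cmod (H1 z s) / V z s)\<^sup>2 \<le> 4 * q * q * e * (cmod (H1 z s) / V z s)\<^sup>2"
        using q e by (intro mult_right_mono) auto
      moreover have "(cmod (of_real (q / V z s) * (cnj (H z s) * H1 z s)))\<^sup>2 = q * q * (cmod (H z s))\<^sup>2 * (cmod (H1 z s) / V z s)\<^sup>2"
        unfolding norm_mult norm_of_real power_mult_distrib power2_abs power_divide by (simp add: power2_eq_square)
      moreover have "4 * q * q * (cmod (H1 z s))\<^sup>2 / V z s = 4 * (q * q * (cmod (H z s))\<^sup>2 * (cmod (H1 z s) / V z s)\<^sup>2) + 4 * q * q * e * (cmod (H1 z s) / V z s)\<^sup>2"
      proof -
        have "4 * q * q * (cmod (H1 z s))\<^sup>2 / V z s = 4 * q * q * V z s * (cmod (H1 z s) / V z s)\<^sup>2"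
          using V[of z s] by (simp add: power2_eq_square)
        then show ?thesis
          by (simp add: V_def algebra_simps)
      qed
      ultimately show "4 * (cmod (of_real 0 * (cnj (g z s) * g1 z s - L1 z s / 2) + of_real (q / V z s) * (cnj (H z s) * H1 z s)))\<^sup>2 +
          4 * 0 * (cmod (g1 z s))\<^sup>2 + 4 * q * e * (cmod (H1 z s) / V z s)\<^sup>2 \<le> 4 * q * q * (cmod (H1 z s))\<^sup>2 / V z s"
        by (simp only: of_real_0 mult_zero_left mult_zero_right add_0_left add_0_right)
    qed simp
    also have "\<dots> = q * q * (V z s powr (q - 1) * (cmod (f z s))\<^sup>2) * (4 * (cmod (g1 z s))\<^sup>2)"
      using V[of z s] by (simp add: H1 norm_mult power_mult_distrib powr_diff)
    also have "\<dots> \<le> q * q * (\<delta> * V z s powr q + \<delta> powr (1 - q) * U z s powr q) * (4 * (cmod (g1 z s))\<^sup>2)"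
      using young q by (intro mult_right_mono mult_left_mono) auto
    also have "\<dots> = q * q * \<delta> powr (1 - q) * U z s powr q * (4 * (cmod (g1 z s))\<^sup>2) + q * q * \<delta> * V z s powr q * (4 * (cmod (g1 z s))\<^sup>2)"
      by (simp add: algebra_simps)
    also have "\<dots> \<le> A * (E1 1 z s + E1 \<i> z s) + ?\<eta> * (E2 1 z s + E2 \<i> z s)"
      by (rule add_mono[OF 1 2])
    finally show "0 \<le> (A * E1 1 z s + ?\<eta> * E2 1 z s - E3 1 z s) + (A * E1 \<i> z s + ?\<eta> * E2 \<i> z s - E3 \<i> z s)"
      by (simp add: algebra_simps)
  next
    show "flow_fun (\<lambda>z s. T3 z s - e powr q)"
      by (intro flow_intros smooth_flowD(1)[OF T3])
  next
    fix z :: "nat \<Rightarrow> complex" and \<tau> :: real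
    assume z: "z \<in> space torus_measure" "0 \<le> \<tau>"
    have "e powr q = exp K * (exp (- K) * e powr q)"
      by (simp add: exp_minus)
    also have "\<dots> \<le> A * T1 z \<tau>"
      unfolding T1_eq using A exp_\<phi>_bounds(1)[of z "of_real \<tau>"] z e q U[of z \<tau>]
      by (intro mult_mono powr_mono2) auto
    finally show "- (T3 z \<tau> - e powr q) \<le> A * T1 z \<tau> + ?\<eta> * T2 z \<tau> - T3 z \<tau>"
      using Tpos(2)[of z \<tau>] by (simp add: add_increasing2)
  next
    fix z assume z: "z \<in> space torus_measure"
    have "((\<lambda>\<tau>. (e + (cmod (H z (of_real \<tau>)))\<^sup>2) powr q - e powr q) \<longlongrightarrow> (e + (cmod 0)\<^sup>2) powr q - e powr q) at_top"
      by (intro tendsto_intros H_lim z) (use e in auto)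
    then show "((\<lambda>\<tau>. T3 z (of_real \<tau>) - e powr q) \<longlongrightarrow> 0) at_top"
      by (simp add: T3_eq V_def)
  qed
  also have "(LINT z|torus_measure. W z 0) \<le> (LINT z|torus_measure. A * exp K * U z 0 powr q - T3 z 0 / 2)"
  proof (rule Bochner_Integration.integral_mono)
    show "integrable torus_measure (\<lambda>z. W z 0)"
      unfolding W_def by (rule flow_fun_integrable[OF smooth_flowD(1)[OF W]]) simp
    have "flow_fun (\<lambda>z s. exp (q * ln (U z s)))"
      using f e unfolding U_def analytic_flow_def
      by (intro flow_intros flow_fun_ln[where e = e]) auto
    from flow_fun_integrable[OF this, of 0] have "integrable torus_measure (\<lambda>z. U z 0 powr q)"
      using U[of _ 0] by (simp add: powr_def less_imp_neq[symmetric])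
    then show "integrable torus_measure (\<lambda>z. A * exp K * U z 0 powr q - T3 z 0 / 2)"
      using flow_fun_integrable[OF smooth_flowD(1)[OF T3], of 0] by simp
    fix z assume z: "z \<in> space torus_measure"
    have "A * T1 z 0 \<le> A * (exp K * U z 0 powr q)"
      unfolding T1_eq using A exp_\<phi>_bounds(2)[OF z, of 0]
      by (intro mult_left_mono mult_right_mono) auto
    moreover have "?\<eta> * T2 z 0 \<le> ?\<eta> * (exp K * T3 z 0)"
      unfolding T2_eq T3_eq using exp_\<phi>_bounds(2)[OF z, of 0]
      by (intro mult_left_mono mult_right_mono) auto
    moreover have "?\<eta> * (exp K * T3 z 0) = T3 z 0 / 2"
      by (simp add: exp_minus)
    ultimately show "W z 0 \<le> A * exp K * U z 0 powr q - T3 z 0 / 2"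
      unfolding W_def mult.assoc by linarith
  qed
  also have "\<dots> = A * exp K * (LINT z|torus_measure. U z 0 powr q) - (LINT z|torus_measure. T3 z 0) / 2"
  proof -
    have "flow_fun (\<lambda>z s. exp (q * ln (U z s)))"
      using f e unfolding U_def analytic_flow_def
      by (intro flow_intros flow_fun_ln[where e = e]) auto
    from flow_fun_integrable[OF this, of 0] have "integrable torus_measure (\<lambda>z. U z 0 powr q)"
      using U[of _ 0] by (simp add: powr_def less_imp_neq[symmetric])
    then show ?thesis
      using flow_fun_integrable[OF smooth_flowD(1)[OF T3], of 0] by simp
  qed
  finally show ?thesis
    by (simp add: T3_eq U_def V_def)
qed

end

section \<open>Removing the regularization\<close>

lemma powr_add_le:
  fixes x y p :: real
  assumes "0 \<le> x" "0 \<le> y" "0 < p"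
  shows "(x + y) powr p \<le> 2 powr p * (x powr p + y powr p)"
proof -
  have "(x + y) powr p \<le> (2 * max x y) powr p"
    using assms by (intro powr_mono2) auto
  also have "\<dots> = 2 powr p * max x y powr p"
    by (rule powr_mult)
  also have "\<dots> \<le> 2 powr p * (x powr p + y powr p)"
    by (intro mult_left_mono) (auto simp: max_def)
  finally show ?thesis .
qed

lemma cmod_square_powr: "(cmod w)\<^sup>2 powr (p / 2) = cmod w powr p"
  using powr_powr[of "cmod w" 2 "p / 2"] by simp

lemma integrable_flow_powr:
  assumes "flow_fun f" "0 < p" "- 1 \<le> Re s" "0 \<le> e"
  shows "integrable torus_measure (\<lambda>z. (e + (cmod (f z s))\<^sup>2) powr p)"
proof -
  have "continuous_on {0..} (\<lambda>x::real. x powr p)"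
    using assms(2) by (intro continuous_on_powr' continuous_intros) auto
  then have "flow_fun (\<lambda>z s. (e + (cmod (f z s))\<^sup>2) powr p)"
    using assms by (intro flow_fun_comp[of "\<lambda>z s. e + (cmod (f z s))\<^sup>2" "{0..}" "\<lambda>x. x powr p"] flow_intros) auto
  then show ?thesis
    by (rule flow_fun_integrable) fact
qed

lemma integrable_flow_cmod_powr:
  assumes "flow_fun f" "0 < p" "- 1 \<le> Re s"
  shows "integrable torus_measure (\<lambda>z. cmod (f z s) powr p)"
  using integrable_flow_powr[OF assms(1), of "p / 2" s 0] assms by (simp add: cmod_square_powr)

text \<open>No limit is taken under the integral: (e + |f|^2)^(p/2) is at most 2^(p/2) (e^(p/2) +
  |f|^p), and \<open>e\<close> is fixed so small that the first part costs at most the prescribed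
  error. The price is the factor 2^(p/2).\<close>

lemma regularized_mean_limit:
  assumes f: "flow_fun f" and p: "0 < p" and C: "0 \<le> C"
    and bound: "\<And>e. 0 < e \<Longrightarrow> I \<le> C * (LINT z|torus_measure. (e + (cmod (f z 0))\<^sup>2) powr (p / 2))"
  shows "I \<le> 2 powr (p / 2) * C * (LINT z|torus_measure. cmod (f z 0) powr p)"
proof (rule field_le_epsilon)
  fix x :: real assume x: "0 < x"
  define y where "y = x / (2 powr (p / 2) * C + 1)"
  define e where "e = y powr (2 / p)"
  have c: "0 < 2 powr (p / 2) * C + 1"
    using C by (simp add: add_nonneg_pos)
  then have y: "0 < y"
    using x by (simp add: y_def)
  have e: "0 < e" "e powr (p / 2) = y"
    using y p by (simp_all add: e_def powr_powr)
  have int: "integrable torus_measure (\<lambda>z. cmod (f z 0) powr p)"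
    using f p by (intro integrable_flow_cmod_powr) auto
  have "I \<le> C * (LINT z|torus_measure. (e + (cmod (f z 0))\<^sup>2) powr (p / 2))"
    by (rule bound) fact
  also have "\<dots> \<le> C * (LINT z|torus_measure. 2 powr (p / 2) * (y + cmod (f z 0) powr p))"
    using e p int f powr_add_le[of e "(cmod (f z 0))\<^sup>2" "p / 2" for z]
    by (intro mult_left_mono C Bochner_Integration.integral_mono integrable_flow_powr) (auto simp: cmod_square_powr)
  also have "\<dots> = 2 powr (p / 2) * C * y + 2 powr (p / 2) * C * (LINT z|torus_measure. cmod (f z 0) powr p)"
    using int by (simp add: torus.prob_space algebra_simps)
  also have "2 powr (p / 2) * C * y \<le> (2 powr (p / 2) * C + 1) * y"
    using y by (intro mult_right_mono) auto
  also have "\<dots> = x"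
    using c by (simp add: y_def)
  finally show "I \<le> 2 powr (p / 2) * C * (LINT z|torus_measure. cmod (f z 0) powr p) + x"
    by simp
qed

text \<open>The constant is fixed before the flow. It depends on \<open>p\<close> and
  \<open>K\<close> only, and is therefore uniform in the polynomial and in the truncation of the
  symbol.\<close>

lemma volterra_mean_bound:
  fixes p K :: real
  assumes p: "0 < p"
  obtains C where "0 < C"
    "\<And>f f1 f2 H H1 H2 g g1 g2 L L1 L2. volterra_flow f f1 f2 H H1 H2 g g1 g2 L L1 L2 K \<Longrightarrow>
      (LINT z|torus_measure. cmod (H z 0) powr p) \<le> C * (LINT z|torus_measure. cmod (f z 0) powr p)"
proof -
  define q where "q = p / 2"
  define A where "A = exp K * (1 + q * q * (exp (- 2 * K) / (2 * (q * q))) powr (1 - q))"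
  define C where "C = (if q \<le> 1 then q * exp K * exp K + 1 / q else 2 * A * exp K)"
  have q: "0 < q"
    using p by (simp add: q_def)
  have C: "0 < C"
    using q by (auto simp: C_def A_def intro!: add_pos_pos add_pos_nonneg mult_pos_pos)
  show ?thesis
  proof (rule that)
    show "0 < 2 powr (p / 2) * C"
      using C by simp
    fix f f1 f2 H H1 H2 g g1 g2 L L1 L2
    assume "volterra_flow f f1 f2 H H1 H2 g g1 g2 L L1 L2 K"
    then interpret volterra_flow f f1 f2 H H1 H2 g g1 g2 L L1 L2 K .
    have flow: "flow_fun f" "flow_fun H"
      using f H by (simp_all add: analytic_flow_def)
    show "(LINT z|torus_measure. cmod (H z 0) powr p) \<le> 2 powr (p / 2) * C * (LINT z|torus_measure. cmod (f z 0) powr p)"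
    proof (rule regularized_mean_limit[OF flow(1) p less_imp_le[OF C]])
      fix e :: real assume e: "0 < e"
      have int: "integrable torus_measure (\<lambda>z. cmod (H z 0) powr p)"
        using flow p by (intro integrable_flow_cmod_powr) auto
      \<comment> \<open>The pair (f, H) is replaced by one function of modulus sqrt (|f|^2 + |H|^2),
        so that the integrability lemma for a single function applies.\<close>
      have "flow_fun (\<lambda>z s. complex_of_real (sqrt ((cmod (f z s))\<^sup>2 + (cmod (H z s))\<^sup>2)))"
        using flow_fun_comp_UNIV[of "\<lambda>z s. (cmod (f z s))\<^sup>2 + (cmod (H z s))\<^sup>2" "\<lambda>x. complex_of_real (sqrt x)"] flow
        by (simp add: flow_intros continuous_intros)
      from integrable_flow_powr[OF this q, of 0 e]
      have int': "integrable torus_measure (\<lambda>z. (e + ((cmod (f z 0))\<^sup>2 + (cmod (H z 0))\<^sup>2)) powr q)"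
        using e by simp
      show "(LINT z|torus_measure. cmod (H z 0) powr p) \<le> C * (LINT z|torus_measure. (e + (cmod (f z 0))\<^sup>2) powr (p / 2))"
      proof (cases "q \<le> 1")
        case True
        have "(LINT z|torus_measure. cmod (H z 0) powr p) \<le> (LINT z|torus_measure. (e + ((cmod (f z 0))\<^sup>2 + (cmod (H z 0))\<^sup>2)) powr q)"
          using e q by (intro Bochner_Integration.integral_mono int int')
            (auto simp: q_def cmod_square_powr[symmetric] intro!: powr_mono2)
        with mean_bound_small[OF q True e] show ?thesis
          using True by (simp add: C_def q_def)
      next
        case False
        have "(LINT z|torus_measure. cmod (H z 0) powr p) \<le> (LINT z|torus_measure. (e + (cmod (H z 0))\<^sup>2) powr q)"
          using e q flow by (intro Bochner_Integration.integral_mono int integrable_flow_powr)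
            (auto simp: q_def cmod_square_powr[symmetric] intro!: powr_mono2)
        with mean_bound_large[of q e] show ?thesis
          using False e by (simp add: C_def A_def q_def)
      qed
    qed
  qed
qed

text \<open>The weight with vanishing potential is (e + |f|^2)^(p/2) itself; its Laplacian is
  nonnegative, so its mean decreases with the height.\<close>

lemma dilated_mean_bound:
  assumes f: "analytic_flow f f1 f2" and p: "0 < p" and \<tau>: "0 \<le> \<tau>"
  shows "(LINT z|torus_measure. cmod (f z (of_real \<tau>)) powr p) \<le>
    2 powr (p / 2) * 1 * (LINT z|torus_measure. cmod (f z 0) powr p)"
proof (rule regularized_mean_limit)
  show flow: "flow_fun f"
    using f by (simp add: analytic_flow_def)
  fix e :: real assume e: "0 < e"
  define q where "q = p / 2"
  have q: "0 < q"
    using p by (simp add: q_def)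
  define T where "T z s = exp (0 * ((cmod (0::complex))\<^sup>2 - Re 0) + q * ln (e + (cmod (f z s))\<^sup>2))" for z s
  obtain D D2 where T: "smooth_flow T D D2" and D2: "\<forall>z s. D2 1 z s + D2 \<i> z s = T z s *
      (4 * (cmod (of_real 0 * (cnj 0 * 0 - 0 / 2) + of_real (q / (e + (cmod (f z s))\<^sup>2)) * (cnj (f z s) * f1 z s)))\<^sup>2 +
       4 * 0 * (cmod 0)\<^sup>2 + 4 * q * e * (cmod (f1 z s) / (e + (cmod (f z s))\<^sup>2))\<^sup>2)"
    using smooth_flow_weight_single[OF f analytic_flow_zero analytic_flow_zero e, of 0 q]
    unfolding T_def by blast
  have T_eq: "T z s = (e + (cmod (f z s))\<^sup>2) powr q" for z s
  proof -
    have "e + (cmod (f z s))\<^sup>2 \<noteq> 0"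
      using e by (simp add: add_pos_nonneg less_imp_neq[symmetric])
    then show ?thesis
      by (simp add: T_def powr_def)
  qed
  have "(LINT z|torus_measure. cmod (f z (of_real \<tau>)) powr p) \<le> (LINT z|torus_measure. T z (of_real \<tau>))"
    unfolding T_eq using e q \<tau> flow p
    by (intro Bochner_Integration.integral_mono integrable_flow_cmod_powr integrable_flow_powr)
       (auto simp: q_def cmod_square_powr[symmetric] intro!: powr_mono2)
  also have "\<dots> \<le> (LINT z|torus_measure. T z (of_real 0))"
    using \<tau> q e by (intro subharmonic_mean_decreasing[OF T]) (auto simp: D2 T_def)
  finally show "(LINT z|torus_measure. cmod (f z (of_real \<tau>)) powr p) \<le>
      1 * (LINT z|torus_measure. (e + (cmod (f z 0))\<^sup>2) powr (p / 2))"
    by (simp add: T_eq q_def)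
qed (use p in auto)

section \<open>The potential of the symbol\<close>

text \<open>Exponential sums with the frequencies ln \<mu> - ln \<nu>. Dirichlet polynomials have
  \<nu> = 1; the potential \<open>L\<close> needs quotients of two integers. With \<nu> \<le> \<mu>
  all frequencies are nonnegative, which gives boundedness to the right.\<close>

definition exp_sum ::
  "'i set \<Rightarrow> ('i \<Rightarrow> nat) \<Rightarrow> ('i \<Rightarrow> nat) \<Rightarrow> ('i \<Rightarrow> complex) \<Rightarrow> (nat \<Rightarrow> complex) \<Rightarrow> complex \<Rightarrow> complex" where
  "exp_sum I \<mu> \<nu> c z s = (\<Sum>i\<in>I. c i * (dchar (\<mu> i) z * cnj (dchar (\<nu> i) z)) *
     exp (- of_real (ln (real (\<mu> i)) - ln (real (\<nu> i))) * s))"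

lemma dchar_rot_exp:
  assumes "n \<ge> 1"
  shows "dchar n (rot t z) = exp (- of_real (ln (real n)) * (\<i> * of_real t)) * dchar n z"
proof -
  have "of_nat n powr (- (\<i> * of_real t)) = exp (- (\<i> * of_real t) * of_real (ln (real n)))"
    using assms by (simp add: powr_def Ln_of_nat)
  also have "- (\<i> * of_real t) * of_real (ln (real n)) = - of_real (ln (real n)) * (\<i> * of_real t)"
    by simp
  finally have "of_nat n powr (- (\<i> * of_real t)) = exp (- of_real (ln (real n)) * (\<i> * of_real t))" .
  with dchar_rot[OF assms] show ?thesis by simp
qed

lemma flow_fun_exp_sum:
  assumes I: "finite I" "\<And>i. i \<in> I \<Longrightarrow> 1 \<le> \<nu> i \<and> \<nu> i \<le> \<mu> i"
  shows "flow_fun (exp_sum I \<mu> \<nu> c)"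
proof (rule flow_funI)
  have cnj: "(\<lambda>z. cnj (dchar n z)) \<in> borel_measurable torus_measure" for n
  proof -
    have "cnj \<in> borel_measurable borel"
      by (intro borel_measurable_continuous_onI continuous_on_cnj continuous_on_id)
    then show ?thesis
      by (rule measurable_compose[OF measurable_dchar])
  qed
  fix s show "(\<lambda>z. exp_sum I \<mu> \<nu> c z s) \<in> borel_measurable torus_measure"
    unfolding exp_sum_def
    by (intro borel_measurable_sum borel_measurable_times borel_measurable_const measurable_dchar cnj)
next
  fix z s assume zs: "z \<in> space torus_measure" "- 1 \<le> Re s"
  show "norm (exp_sum I \<mu> \<nu> c z s) \<le> (\<Sum>i\<in>I. norm (c i) * exp (ln (real (\<mu> i)) - ln (real (\<nu> i))))"
    unfolding exp_sum_def
  proof (rule sum_norm_le)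
    fix i assume i: "i \<in> I"
    let ?l = "ln (real (\<mu> i)) - ln (real (\<nu> i))"
    have l: "0 \<le> ?l"
      using I(2)[OF i] by (simp add: ln_le_cancel_iff)
    have "norm (exp (- of_real ?l * s)) = exp (- ?l * Re s)"
      by simp
    also have "\<dots> \<le> exp ?l"
    proof -
      have "- l * r \<le> l" if "0 \<le> l" "- 1 \<le> r" for l r :: real
        using mult_left_mono[OF that(2,1)] by simp
      from this[OF l zs(2)] show ?thesis
        by (simp only: exp_le_cancel_iff)
    qed
    finally show "norm (c i * (dchar (\<mu> i) z * cnj (dchar (\<nu> i) z)) * exp (- of_real ?l * s)) \<le> norm (c i) * exp ?l"
      using zs by (simp only: norm_mult norm_dchar complex_mod_cnj) (simp add: mult_left_mono)
  qed
next
  fix z s t assume "z \<in> space torus_measure"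
  show "exp_sum I \<mu> \<nu> c (rot t z) s = exp_sum I \<mu> \<nu> c z (s + \<i> * of_real t)"
    unfolding exp_sum_def
  proof (rule sum.cong[OF refl])
    fix i assume i: "i \<in> I"
    have regroup: "k * A * exp (x * s) = k * B * exp (x * (s + y))" if "A = B * exp (x * y)" for k A B x y :: complex
      by (simp add: that distrib_left exp_add mult_ac)
    have "dchar (\<mu> i) (rot t z) * cnj (dchar (\<nu> i) (rot t z)) = dchar (\<mu> i) z * cnj (dchar (\<nu> i) z) *
       exp (- of_real (ln (real (\<mu> i)) - ln (real (\<nu> i))) * (\<i> * of_real t))"
      using I(2)[OF i]
      by (simp add: dchar_rot_exp exp_cnj algebra_simps exp_diff exp_add exp_minus divide_simps)
    then show "c i * (dchar (\<mu> i) (rot t z) * cnj (dchar (\<nu> i) (rot t z))) * exp (- of_real (ln (real (\<mu> i)) - ln (real (\<nu> i))) * s) =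
        c i * (dchar (\<mu> i) z * cnj (dchar (\<nu> i) z)) * exp (- of_real (ln (real (\<mu> i)) - ln (real (\<nu> i))) * (s + \<i> * of_real t))"
      by (rule regroup)
  qed
qed

lemma analytic_flow_exp_sum:
  assumes I: "finite I" "\<And>i. i \<in> I \<Longrightarrow> 1 \<le> \<nu> i \<and> \<nu> i \<le> \<mu> i"
  defines "rate \<equiv> \<lambda>i. complex_of_real (ln (real (\<mu> i)) - ln (real (\<nu> i)))"
  shows "analytic_flow (exp_sum I \<mu> \<nu> c) (exp_sum I \<mu> \<nu> (\<lambda>i. - rate i * c i))
    (exp_sum I \<mu> \<nu> (\<lambda>i. - rate i * (- rate i * c i)))"
proof -
  have d: "(exp_sum I \<mu> \<nu> b z has_field_derivative exp_sum I \<mu> \<nu> (\<lambda>i. - rate i * b i) z s) (at s)" for b z s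
    unfolding exp_sum_def rate_def
  proof (rule DERIV_sum)
    fix i
    let ?l = "complex_of_real (ln (real (\<mu> i)) - ln (real (\<nu> i)))"
    have "((\<lambda>s. exp (- ?l * s)) has_field_derivative exp (- ?l * s) * - ?l) (at s)"
      by (rule derivative_eq_intros refl | simp)+
    from DERIV_cmult[OF this, of "b i * (dchar (\<mu> i) z * cnj (dchar (\<nu> i) z))"]
    show "((\<lambda>s. b i * (dchar (\<mu> i) z * cnj (dchar (\<nu> i) z)) * exp (- ?l * s)) has_field_derivative
       - ?l * b i * (dchar (\<mu> i) z * cnj (dchar (\<nu> i) z)) * exp (- ?l * s)) (at s)"
      by (simp only: mult_ac)
  qed
  show ?thesis
    unfolding analytic_flow_def using flow_fun_exp_sum[of I \<nu> \<mu>, OF I] d by blast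
qed

text \<open>\<open>G\<close> telescopes the sum: \<open>G'(u) = 6 e\<^sup>u (1 + u\<^sup>2) / (1 + u)\<^sup>3\<close> dominates \<open>3 e\<^sup>u / (1 + u)\<close>, which in turn
  dominates \<open>(e\<^sup>u - e\<^sup>-\<^sup>u) / u\<close>.\<close>

lemma sinh_sum_step:
  fixes \<sigma> :: real
  assumes \<sigma>: "0 \<le> \<sigma>" and n: "2 \<le> n"
  defines "G \<equiv> \<lambda>u. 6 * exp u * u / (1 + u)\<^sup>2"
  shows "(exp (\<sigma> * ln (real n)) - exp (- (\<sigma> * ln (real n)))) / (real n * ln (real n)) \<le>
    2 * (G (\<sigma> * ln (real (Suc n))) - G (\<sigma> * ln (real n)))"
proof (cases "\<sigma> = 0")
  case False
  then have \<sigma>: "0 < \<sigma>"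
    using assms by simp
  define u where "u = \<sigma> * ln (real n)"
  have u: "0 < u"
    using \<sigma> n by (simp add: u_def)
  have G': "(G has_real_derivative 6 * exp x * (x\<^sup>2 + 1) / (1 + x)^3) (at x)" if "0 \<le> x" for x
  proof -
    have "(G has_real_derivative ((6 * exp x + 6 * exp x * x) * (1 + x)\<^sup>2 - 6 * exp x * x * (2 * (1 + x))) / ((1 + x)\<^sup>2 * (1 + x)\<^sup>2)) (at x)"
      unfolding G_def using that by (auto intro!: derivative_eq_intros)
    also have "((6 * exp x + 6 * exp x * x) * (1 + x)\<^sup>2 - 6 * exp x * x * (2 * (1 + x))) = (6 * exp x * (x\<^sup>2 + 1)) * (1 + x)"
      by (simp add: algebra_simps power2_eq_square)
    also have "(1 + x)\<^sup>2 * (1 + x)\<^sup>2 = (1 + x)^3 * (1 + x)"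
      by (simp add: algebra_simps power2_eq_square power3_eq_cube)
    finally show ?thesis
      using that by simp
  qed
  have G'_lower: "3 * (exp u / (1 + u)) \<le> 6 * exp x * (x\<^sup>2 + 1) / (1 + x)^3" if "u \<le> x" for x
  proof -
    have x: "0 < x" using u that by simp
    \<comment> \<open>Monotonicity of exp x / (1 + x).\<close>
    have "(1 + x) \<le> (1 + u) * (1 + (x - u))"
      using u that by (simp add: algebra_simps mult_left_mono)
    also have "\<dots> \<le> (1 + u) * exp (x - u)"
      using u by (intro mult_left_mono) auto
    finally have "exp u / (1 + u) \<le> exp x / (1 + x)"
      using u x by (simp add: field_simps exp_diff)
    then have "3 * (exp u / (1 + u)) \<le> 3 * (exp x / (1 + x))" by simp
    also have "\<dots> = 3 * exp x * (1 + x)\<^sup>2 / (1 + x)^3"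
      using x by (simp add: power2_eq_square power3_eq_cube)
    also have "\<dots> \<le> 6 * exp x * (x\<^sup>2 + 1) / (1 + x)^3"
    proof (rule divide_right_mono)
      have "(1 + x)\<^sup>2 \<le> 2 * (x\<^sup>2 + 1)"
        using zero_le_power2[of "x - 1"] by (simp add: power2_eq_square algebra_simps)
      then have "3 * exp x * (1 + x)\<^sup>2 \<le> 3 * exp x * (2 * (x\<^sup>2 + 1))"
        by (intro mult_left_mono) auto
      then show "3 * exp x * (1 + x)\<^sup>2 \<le> 6 * exp x * (x\<^sup>2 + 1)" by simp
    qed (use x in simp)
    finally show ?thesis .
  qed
  have "\<exists>\<xi>. real n < \<xi> \<and> \<xi> < real (Suc n) \<and> G (\<sigma> * ln (real (Suc n))) - G (\<sigma> * ln (real n)) =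
     (real (Suc n) - real n) * (6 * exp (\<sigma> * ln \<xi>) * ((\<sigma> * ln \<xi>)\<^sup>2 + 1) / (1 + \<sigma> * ln \<xi>)^3 * (\<sigma> / \<xi>))"
  proof (rule MVT2)
    fix x assume x: "real n \<le> x" "x \<le> real (Suc n)"
    have "((\<lambda>x. \<sigma> * ln x) has_real_derivative \<sigma> / x) (at x)"
      using x n by (auto intro!: derivative_eq_intros)
    then show "((\<lambda>x. G (\<sigma> * ln x)) has_real_derivative
       6 * exp (\<sigma> * ln x) * ((\<sigma> * ln x)\<^sup>2 + 1) / (1 + \<sigma> * ln x)^3 * (\<sigma> / x)) (at x)"
      using x n \<sigma> by (intro DERIV_chain2[OF G']) auto
  qed simp
  then obtain \<xi> where \<xi>: "real n < \<xi>" "\<xi> < real (Suc n)"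
    and eq: "G (\<sigma> * ln (real (Suc n))) - G (\<sigma> * ln (real n)) =
      6 * exp (\<sigma> * ln \<xi>) * ((\<sigma> * ln \<xi>)\<^sup>2 + 1) / (1 + \<sigma> * ln \<xi>)^3 * (\<sigma> / \<xi>)"
    by auto
  have "exp u - exp (- u) = exp u * (1 - exp (- 2 * u))"
    by (simp add: right_diff_distrib exp_add[symmetric])
  moreover have "exp u * (1 - exp (- 2 * u)) \<le> exp u * 1" "exp u * (1 - exp (- 2 * u)) \<le> exp u * (2 * u)"
    using exp_ge_add_one_self[of "- 2 * u"] by (auto intro!: mult_left_mono)
  ultimately have b: "exp u - exp (- u) \<le> exp u" "exp u - exp (- u) \<le> exp u * (2 * u)"
    by simp_all
  \<comment> \<open>Of the two bounds, the first is good for large u and the second for small u; u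
    times the first plus the second covers both ranges at once.\<close>
  have "(1 + u) * (exp u - exp (- u)) \<le> 3 * u * exp u"
  proof -
    have "(1 + u) * D \<le> 3 * u * E" if "D \<le> E" "D \<le> E * (2 * u)" for D E
      using mult_left_mono[OF that(1) less_imp_le[OF u]] that(2) by (simp add: algebra_simps)
    then show ?thesis
      using b by blast
  qed
  then have "(exp u - exp (- u)) / u \<le> 3 * (exp u / (1 + u))"
    using u by (simp add: field_simps)
  then have "(exp u - exp (- u)) / u * (\<sigma> / real n) \<le> 3 * (exp u / (1 + u)) * (\<sigma> / real n)"
    using \<sigma> by (intro mult_right_mono) auto
  \<comment> \<open>The intermediate point satisfies \<xi> < n + 1 \<le> 2 n; this is the origin of
    the factor 2 in the claim.\<close>
  also have "\<dots> \<le> 3 * (exp u / (1 + u)) * (2 * (\<sigma> / \<xi>))"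
  proof (rule mult_left_mono)
    have "\<sigma> * \<xi> \<le> \<sigma> * (real n * 2)"
      using \<xi> n \<sigma> by (intro mult_left_mono) auto
    then show "\<sigma> / real n \<le> 2 * (\<sigma> / \<xi>)"
      using \<xi> n by (simp add: field_simps)
  qed (use u in simp)
  also have "\<dots> = 2 * (3 * (exp u / (1 + u)) * (\<sigma> / \<xi>))" by simp
  also have "\<dots> \<le> 2 * (G (\<sigma> * ln (real (Suc n))) - G (\<sigma> * ln (real n)))"
    unfolding eq using \<xi> n \<sigma>
    by (intro mult_left_mono mult_right_mono G'_lower) (auto simp: u_def)
  finally show ?thesis
    using \<sigma> n by (simp add: u_def mult.commute[of "ln (real n)" "real n"])
qed (simp add: G_def)

lemma sinh_sum_bound:
  fixes \<sigma> :: real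
  assumes "0 \<le> \<sigma>" "2 \<le> m"
  shows "(\<Sum>n\<in>{2..<m}. (exp (\<sigma> * ln (real n)) - exp (- (\<sigma> * ln (real n)))) / (real n * ln (real n))) \<le>
    12 * exp (\<sigma> * ln (real m)) * (\<sigma> * ln (real m)) / (1 + \<sigma> * ln (real m))\<^sup>2"
  using assms(2)
proof (induction m rule: dec_induct)
  case (step m)
  then show ?case
    using sinh_sum_step[OF assms(1), of m] by simp
qed (use assms in simp)

text \<open>The summand is, as a function of m, the derivative of - 1 / (1 + \<sigma> ln m), whose
  total increase is at most 1 whatever \<sigma> is. This uniformity in \<sigma> is the
  point.\<close>

lemma log_telescope:
  fixes \<sigma> :: real
  assumes "0 \<le> \<sigma>" "1 \<le> N"
  shows "(\<Sum>m\<in>{2..N}. \<sigma> / (real m * (1 + \<sigma> * ln (real m))\<^sup>2)) \<le> 1 - 1 / (1 + \<sigma> * ln (real N))"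
  using assms(2)
proof (induction N rule: dec_induct)
  case (step N)
  define A where "A = 1 + \<sigma> * ln (real N)"
  define B where "B = 1 + \<sigma> * ln (real (Suc N))"
  have N: "1 \<le> N" using step by simp
  have AB: "1 \<le> A" "A \<le> B"
    using N assms by (auto simp: A_def B_def intro!: mult_left_mono)
  have "ln (real N) - ln (real (Suc N)) \<le> (real N - real (Suc N)) / real (Suc N)"
    using N by (intro ln_diff_le) auto
  then have "1 / real (Suc N) \<le> ln (real (Suc N)) - ln (real N)"
    by (simp add: field_simps)
  then have "\<sigma> * (1 / real (Suc N)) \<le> \<sigma> * (ln (real (Suc N)) - ln (real N))"
    using assms(1) by (rule mult_left_mono)
  then have BA: "\<sigma> / real (Suc N) \<le> B - A"
    by (simp add: A_def B_def algebra_simps)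
  have "\<sigma> / (real (Suc N) * B\<^sup>2) = (\<sigma> / real (Suc N)) / (B * B)"
    by (simp add: power2_eq_square)
  also have "\<dots> \<le> (B - A) / (B * B)"
    using BA by (intro divide_right_mono) auto
  also have "\<dots> \<le> (B - A) / (A * B)"
    using AB by (intro divide_left_mono mult_right_mono) auto
  also have "\<dots> = 1 / A - 1 / B"
    using AB by (simp add: field_simps)
  finally have "\<sigma> / (real (Suc N) * B\<^sup>2) \<le> 1 / A - 1 / B" .
  then show ?case
    using step N by (simp add: A_def B_def)
qed simp

lemma inverse_square_telescope:
  assumes "1 \<le> N"
  shows "(\<Sum>m\<in>{2..N}. 1 / (real m)\<^sup>2) \<le> 1 - 1 / real N"
  using assms
proof (induction N rule: dec_induct)
  case (step N)
  have "1 / (real (Suc N))\<^sup>2 \<le> 1 / (real N * real (Suc N))"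
    using step unfolding power2_eq_square by (intro divide_left_mono mult_right_mono) auto
  also have "\<dots> = 1 / real N - 1 / real (Suc N)"
    using step by (simp add: field_simps)
  finally show ?case
    using step by simp
qed simp

lemma ln_ge_half: "2 \<le> n \<Longrightarrow> 1 / 2 \<le> ln (real n)"
proof -
  assume "2 \<le> n"
  then have "ln 2 \<le> ln (real n)" by simp
  moreover have "1 / 2 \<le> ln (2::real)"
    using ln_diff_le[of 1 "2::real"] by simp
  ultimately show ?thesis by simp
qed

text \<open>In row m the inner sum over n < m is of order m^\<sigma> \<sigma> ln m / (1 + \<sigma>
  ln m)^2. Its factor m^\<sigma> cancels against m^(-\<sigma>) and its ln m against the logarithm in
  1 / (m ln m), leaving 12 \<sigma> / (m (1 + \<sigma> ln m)^2). The diagonal term is at most 4 /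
  m^2. The sums over m are at most 12 and 4, and symmetry doubles them to 32.\<close>

lemma symbol_double_sum_bound:
  fixes \<sigma> :: real
  assumes \<sigma>: "0 \<le> \<sigma>"
  defines "F \<equiv> \<lambda>m n. 1 / (real m * ln (real m)) * (1 / (real n * ln (real n))) *
     (exp (- (\<sigma> * ln (real m))) * (exp (\<sigma> * ln (real n)) - exp (- (\<sigma> * ln (real n)))))"
  shows "(\<Sum>m\<in>{2..N}. \<Sum>n\<in>{2..N}. F (max m n) (min m n)) \<le> 32"
proof -
  have F_nonneg: "0 \<le> F m n" if "2 \<le> m" "2 \<le> n" for m n
  proof -
    have "0 \<le> \<sigma> * ln (real n)"
      using that \<sigma> by simp
    then show ?thesis
      using that by (simp add: F_def)
  qed
  have row: "(\<Sum>n\<in>{2..m}. F m n) \<le> 12 * (\<sigma> / (real m * (1 + \<sigma> * ln (real m))\<^sup>2)) + 4 * (1 / (real m)\<^sup>2)"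
    if m: "2 \<le> m" for m
  proof -
    let ?c = "1 / (real m * ln (real m)) * exp (- (\<sigma> * ln (real m)))"
    have lm: "0 < ln (real m)" using m by simp
    have "{2..m} = insert m {2..<m}" using m by auto
    then have "(\<Sum>n\<in>{2..m}. F m n) = F m m + (\<Sum>n\<in>{2..<m}. F m n)" by simp
    also have "(\<Sum>n\<in>{2..<m}. F m n) = ?c * (\<Sum>n\<in>{2..<m}. (exp (\<sigma> * ln (real n)) - exp (- (\<sigma> * ln (real n)))) / (real n * ln (real n)))"
      by (simp add: F_def sum_distrib_left)
    also have "\<dots> \<le> ?c * (12 * exp (\<sigma> * ln (real m)) * (\<sigma> * ln (real m)) / (1 + \<sigma> * ln (real m))\<^sup>2)"
      using lm m \<sigma> by (intro mult_left_mono sinh_sum_bound) auto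
    also have "\<dots> = 12 * (\<sigma> / (real m * (1 + \<sigma> * ln (real m))\<^sup>2)) * (exp (- (\<sigma> * ln (real m))) * exp (\<sigma> * ln (real m)))"
      using lm by (simp add: field_simps)
    also have "\<dots> = 12 * (\<sigma> / (real m * (1 + \<sigma> * ln (real m))\<^sup>2))"
      by (simp add: exp_add[symmetric])
    also have "F m m \<le> 4 * (1 / (real m)\<^sup>2)"
    proof -
      let ?e = "exp (- (\<sigma> * ln (real m))) * (exp (\<sigma> * ln (real m)) - exp (- (\<sigma> * ln (real m))))"
      have "?e \<le> exp (- (\<sigma> * ln (real m))) * exp (\<sigma> * ln (real m))"
        by (intro mult_left_mono) auto
      also have "\<dots> = 1"
        by (simp add: exp_add[symmetric])
      finally have e: "?e \<le> 1" .
      have "1 / (real m * ln (real m)) \<le> 1 / (real m * (1 / 2))"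
        using ln_ge_half[OF m] m by (intro divide_left_mono mult_left_mono) auto
      then have "1 / (real m * ln (real m)) \<le> 2 / real m" by simp
      then have "1 / (real m * ln (real m)) * (1 / (real m * ln (real m))) \<le> 2 / real m * (2 / real m)"
        using lm by (intro mult_mono) auto
      moreover have "F m m \<le> 1 / (real m * ln (real m)) * (1 / (real m * ln (real m))) * 1"
        unfolding F_def using e lm by (intro mult_left_mono) auto
      ultimately show ?thesis
        by (simp add: power2_eq_square)
    qed
    finally show ?thesis by simp
  qed
  \<comment> \<open>The square is covered by two triangles that overlap in the diagonal; counting it
    twice only enlarges the right-hand side, as the terms are nonnegative.\<close>
  have "(\<Sum>m\<in>{2..N}. \<Sum>n\<in>{2..N}. F (max m n) (min m n)) \<le>
      (\<Sum>m\<in>{2..N}. \<Sum>n\<in>{2..N}. (if n \<le> m then F m n else 0) + (if m \<le> n then F n m else 0))"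
    using F_nonneg by (intro sum_mono) (auto simp: max_def min_def)
  also have "\<dots> = (\<Sum>m\<in>{2..N}. \<Sum>n\<in>{2..N}. if n \<le> m then F m n else 0) + (\<Sum>m\<in>{2..N}. \<Sum>n\<in>{2..N}. if m \<le> n then F n m else 0)"
    by (simp add: sum.distrib)
  also have "(\<Sum>m\<in>{2..N}. \<Sum>n\<in>{2..N}. if m \<le> n then F n m else 0) = (\<Sum>m\<in>{2..N}. \<Sum>n\<in>{2..N}. if n \<le> m then F m n else 0)"
    by (rule sum.swap)
  also have "(\<Sum>m\<in>{2..N}. \<Sum>n\<in>{2..N}. if n \<le> m then F m n else 0) = (\<Sum>m\<in>{2..N}. \<Sum>n\<in>{2..m}. F m n)"
    by (intro sum.cong refl sum.mono_neutral_cong_right) auto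
  also have "\<dots> \<le> (\<Sum>m\<in>{2..N}. 12 * (\<sigma> / (real m * (1 + \<sigma> * ln (real m))\<^sup>2)) + 4 * (1 / (real m)\<^sup>2))"
    by (intro sum_mono row) auto
  also have "\<dots> = 12 * (\<Sum>m\<in>{2..N}. \<sigma> / (real m * (1 + \<sigma> * ln (real m))\<^sup>2)) + 4 * (\<Sum>m\<in>{2..N}. 1 / (real m)\<^sup>2)"
    by (simp add: sum.distrib sum_distrib_left)
  also have "\<dots> \<le> 12 * 1 + 4 * 1"
  proof (cases "1 \<le> N")
    case True
    have "0 \<le> 1 / (1 + \<sigma> * ln (real N))"
      using \<sigma> True by simp
    moreover have "0 \<le> 1 / real N" by simp
    ultimately show ?thesis
      using log_telescope[OF \<sigma> True] inverse_square_telescope[OF True]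
      by (intro add_mono mult_left_mono) linarith+
  qed simp
  finally show ?thesis by simp
qed

abbreviation (input) symbol_coeff :: "nat \<Rightarrow> real" where
  "symbol_coeff n \<equiv> 1 / (real n * ln (real n))"

text \<open>Expand |g|^2 and Re L over the same pairs. The two terms of a pair share a unimodular
  factor; the larger index m contributes m^(-\<sigma>) to both, the smaller index n contributes
  n^(-\<sigma>) to |g|^2 but n^\<sigma> to L. The difference is thus controlled by the summand of
  \<open>symbol_double_sum_bound\<close>.\<close>

lemma symbol_potential_bound:
  assumes z: "z \<in> space torus_measure" and s: "0 \<le> Re s"
  shows "\<bar>(cmod (exp_sum {2..N} id (\<lambda>_. 1) (\<lambda>n. of_real (symbol_coeff n)) z s))\<^sup>2 -
    Re (exp_sum ({2..N} \<times> {2..N}) (\<lambda>(m, n). max m n) (\<lambda>(m, n). min m n)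
      (\<lambda>(m, n). of_real (symbol_coeff m * symbol_coeff n)) z s)\<bar> \<le> 32"
proof -
  define x where "x n = dchar n z * exp (- of_real (ln (real n)) * s)" for n
  define l where "l m n = dchar m z * cnj (dchar n z) * exp (- of_real (ln (real m) - ln (real n)) * s)" for m n
  define F where "F m n = symbol_coeff m * symbol_coeff n *
     (exp (- (Re s * ln (real m))) * (exp (Re s * ln (real n)) - exp (- (Re s * ln (real n)))))" for m n
  let ?g = "exp_sum {2..N} id (\<lambda>_. 1) (\<lambda>n. of_real (symbol_coeff n)) z s"
  have g: "?g = (\<Sum>n\<in>{2..N}. of_real (symbol_coeff n) * x n)"
    by (simp add: exp_sum_def x_def mult.assoc)
  have "(cmod ?g)\<^sup>2 = Re (?g * cnj ?g)"
    by (simp add: complex_norm_square[symmetric] del: of_real_power)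
  also have "?g * cnj ?g = (\<Sum>m\<in>{2..N}. \<Sum>n\<in>{2..N}. of_real (symbol_coeff m * symbol_coeff n) * (x m * cnj (x n)))"
    unfolding g by (simp add: sum_product mult_ac)
  also have "Re \<dots> = (\<Sum>m\<in>{2..N}. \<Sum>n\<in>{2..N}. symbol_coeff m * symbol_coeff n * Re (x m * cnj (x n)))"
    by (simp only: Re_sum Re_complex_of_real times_complex.sel Im_complex_of_real mult_zero_left diff_zero)
  \<comment> \<open>Exchanging the indices conjugates \<open>x m * cnj (x n)\<close>, so the real
    part depends on the unordered pair only.\<close>
  also have "\<dots> = (\<Sum>m\<in>{2..N}. \<Sum>n\<in>{2..N}. symbol_coeff (max m n) * symbol_coeff (min m n) * Re (x (max m n) * cnj (x (min m n))))"
    by (intro sum.cong refl) (auto simp: max_def min_def mult_ac)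
  finally have 1: "(cmod ?g)\<^sup>2 = \<dots>" .
  have "Re (exp_sum ({2..N} \<times> {2..N}) (\<lambda>(m, n). max m n) (\<lambda>(m, n). min m n)
      (\<lambda>(m, n). of_real (symbol_coeff m * symbol_coeff n)) z s) =
    (\<Sum>m\<in>{2..N}. \<Sum>n\<in>{2..N}. symbol_coeff m * symbol_coeff n * Re (l (max m n) (min m n)))"
    unfolding exp_sum_def l_def
    by (simp only: sum.cartesian_product case_prod_unfold fst_conv snd_conv mult.assoc Re_sum
        Re_complex_of_real times_complex.sel(1)[of "of_real _"] Im_complex_of_real mult_zero_left diff_zero)
  also have "\<dots> = (\<Sum>m\<in>{2..N}. \<Sum>n\<in>{2..N}. symbol_coeff (max m n) * symbol_coeff (min m n) * Re (l (max m n) (min m n)))"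
    by (intro sum.cong refl) (auto simp: max_def min_def mult_ac)
  finally have 2: "Re (exp_sum ({2..N} \<times> {2..N}) (\<lambda>(m, n). max m n) (\<lambda>(m, n). min m n)
      (\<lambda>(m, n). of_real (symbol_coeff m * symbol_coeff n)) z s) = \<dots>" .
  have diff: "\<bar>symbol_coeff m * symbol_coeff n * Re (x m * cnj (x n)) - symbol_coeff m * symbol_coeff n * Re (l m n)\<bar> \<le> F m n"
    if "2 \<le> m" "2 \<le> n" for m n
  proof -
    have "x m * cnj (x n) - l m n = dchar m z * cnj (dchar n z) * exp (- of_real (ln (real m)) * s) *
       (exp (- of_real (ln (real n)) * cnj s) - exp (of_real (ln (real n)) * s))"
      by (simp add: x_def l_def exp_cnj algebra_simps exp_add[symmetric] exp_diff)
    also have "exp (- of_real (ln (real n)) * cnj s) - exp (of_real (ln (real n)) * s) =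
       exp (of_real (ln (real n)) * (\<i> * of_real (Im s))) * of_real (exp (- (Re s * ln (real n))) - exp (Re s * ln (real n)))"
    proof -
      have "- of_real (ln (real n)) * cnj s = of_real (ln (real n)) * (\<i> * of_real (Im s)) + of_real (- (Re s * ln (real n)))"
        "of_real (ln (real n)) * s = of_real (ln (real n)) * (\<i> * of_real (Im s)) + of_real (Re s * ln (real n))"
        by (simp_all add: complex_eq_iff)
      then show ?thesis
        by (simp only: exp_add exp_of_real of_real_diff right_diff_distrib)
    qed
    finally have "cmod (x m * cnj (x n) - l m n) = exp (- (Re s * ln (real m))) * \<bar>exp (- (Re s * ln (real n))) - exp (Re s * ln (real n))\<bar>"
      using z by (simp only: norm_mult norm_dchar complex_mod_cnj norm_of_real norm_exp_eq_Re) (simp add: mult.commute)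
    also have "\<bar>exp (- (Re s * ln (real n))) - exp (Re s * ln (real n))\<bar> = exp (Re s * ln (real n)) - exp (- (Re s * ln (real n)))"
    proof -
      have "0 \<le> Re s * ln (real n)" using s that by simp
      then show ?thesis by simp
    qed
    finally have "\<bar>Re (x m * cnj (x n)) - Re (l m n)\<bar> \<le> exp (- (Re s * ln (real m))) * (exp (Re s * ln (real n)) - exp (- (Re s * ln (real n))))"
      using abs_Re_le_cmod[of "x m * cnj (x n) - l m n"] by simp
    then have "symbol_coeff m * symbol_coeff n * \<bar>Re (x m * cnj (x n)) - Re (l m n)\<bar> \<le> F m n"
      unfolding F_def using that by (intro mult_left_mono) auto
    moreover have "0 \<le> symbol_coeff m * symbol_coeff n"
      using that by simp
    moreover have "\<bar>k * x - k * y\<bar> = k * \<bar>x - y\<bar>" if "0 \<le> k" for k x y :: real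
      using that by (simp add: right_diff_distrib[symmetric] abs_mult)
    ultimately show ?thesis by metis
  qed
  have "\<bar>(cmod ?g)\<^sup>2 - Re (exp_sum ({2..N} \<times> {2..N}) (\<lambda>(m, n). max m n) (\<lambda>(m, n). min m n)
      (\<lambda>(m, n). of_real (symbol_coeff m * symbol_coeff n)) z s)\<bar> \<le>
     (\<Sum>m\<in>{2..N}. \<Sum>n\<in>{2..N}. F (max m n) (min m n))"
    unfolding 1 2 sum_subtractf[symmetric]
  proof (intro order_trans[OF sum_abs] sum_mono)
    fix m n assume "m \<in> {2..N}" "n \<in> {2..N}"
    then show "\<bar>symbol_coeff (max m n) * symbol_coeff (min m n) * Re (x (max m n) * cnj (x (min m n))) -
        symbol_coeff (max m n) * symbol_coeff (min m n) * Re (l (max m n) (min m n))\<bar> \<le> F (max m n) (min m n)"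
      by (intro diff) auto
  qed
  also have "\<dots> \<le> 32"
    unfolding F_def using symbol_double_sum_bound[OF s] .
  finally show ?thesis .
qed

text \<open>The coefficients of the transform under the symbol cut off at \<open>N\<close>: those of
  f g' are the negative of the divisor sum, and integrating n^(-w) from s to infinity divides by ln
  n. At n = 1 the divisor sum is empty and 0 / ln 1 is 0, in accordance with the vanishing of the
  transform at infinity.\<close>

definition volterra_coeff_upto :: "nat \<Rightarrow> (nat \<Rightarrow> complex) \<Rightarrow> nat \<Rightarrow> complex" where
  "volterra_coeff_upto N a n = (\<Sum>d | d dvd n \<and> d \<in> {2..N}. a (n div d) / of_nat d) / of_real (ln (real n))"

section \<open>Polynomials and their transforms as exponential sums\<close>

lemma bohr_polynomial_eq_sum:
  assumes "finite S" "0 \<notin> S" "\<And>n. 1 \<le> n \<Longrightarrow> a n \<noteq> 0 \<Longrightarrow> n \<in> S"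
  shows "bohr_polynomial a z = (\<Sum>n\<in>S. a n * dchar n z)"
  unfolding bohr_polynomial_def dchar_def
  by (rule sum.mono_neutral_left) (use assms in \<open>auto simp: Suc_le_eq intro!: gr0I\<close>)

lemma finite_support: "dirichlet_polynomial a \<Longrightarrow> finite {n. 1 \<le> n \<and> a n \<noteq> 0}"
  unfolding dirichlet_polynomial_def by (rule finite_subset[rotated]) auto

lemma bohr_polynomial_exp_sum:
  assumes "finite S" "0 \<notin> S" "\<And>n. 1 \<le> n \<Longrightarrow> a n \<noteq> 0 \<Longrightarrow> n \<in> S"
  shows "exp_sum S id (\<lambda>_. 1) a z (of_real \<tau>) = bohr_polynomial (\<lambda>n. a n * of_real (real n powr - \<tau>)) z"
proof -
  have "bohr_polynomial (\<lambda>n. a n * of_real (real n powr - \<tau>)) z = (\<Sum>n\<in>S. a n * of_real (real n powr - \<tau>) * dchar n z)"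
    using assms by (intro bohr_polynomial_eq_sum) auto
  also have "\<dots> = exp_sum S id (\<lambda>_. 1) a z (of_real \<tau>)"
    unfolding exp_sum_def
  proof (rule sum.cong[OF refl])
    fix n assume "n \<in> S"
    then have n: "n \<noteq> 0" using assms(2) by metis
    have "exp (- complex_of_real (ln (real n)) * of_real \<tau>) = of_real (real n powr - \<tau>)"
      using n by (simp add: powr_def exp_of_real[symmetric] mult.commute)
    then show "a n * of_real (real n powr - \<tau>) * dchar n z =
       a n * (dchar (id n) z * cnj (dchar 1 z)) * exp (- of_real (ln (real (id n)) - ln (real 1)) * of_real \<tau>)"
      by (simp add: mult_ac)
  qed
  finally show ?thesis ..
qed

lemma dirichlet_polynomial_volterra_coeff_upto:
  assumes "dirichlet_polynomial a"
  shows "dirichlet_polynomial (volterra_coeff_upto N a)"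
proof -
  have "{n. volterra_coeff_upto N a n \<noteq> 0} \<subseteq> (\<lambda>(k, d). k * d) ` ({n. a n \<noteq> 0} \<times> {2..N})"
  proof
    fix n assume "n \<in> {n. volterra_coeff_upto N a n \<noteq> 0}"
    then have "(\<Sum>d | d dvd n \<and> d \<in> {2..N}. a (n div d) / of_nat d) \<noteq> 0"
      by (auto simp: volterra_coeff_upto_def)
    then obtain d where "d \<in> {d. d dvd n \<and> d \<in> {2..N}}" "a (n div d) / of_nat d \<noteq> 0"
      by (rule sum.not_neutral_contains_not_neutral)
    then show "n \<in> (\<lambda>(k, d). k * d) ` ({n. a n \<noteq> 0} \<times> {2..N})"
      by (intro image_eqI[where x = "(n div d, d)"]) auto
  qed
  then show ?thesis
    using assms unfolding dirichlet_polynomial_def by (auto intro: finite_subset)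
qed

lemma div_gt_0_of_dvd: "d dvd n \<Longrightarrow> 0 < n \<Longrightarrow> 0 < n div (d::nat)"
  by (auto intro!: gr0I simp: dvd_div_eq_0_iff)

text \<open>Ungrouping by the factorization n = k d. In the variables (k, d) the derivative along
  the flow splits term by term into a product, which is hidden in the coefficients indexed by
  n.\<close>

lemma bohr_polynomial_volterra_coeff_upto:
  assumes a: "dirichlet_polynomial a"
  defines "S \<equiv> {n. 1 \<le> n \<and> a n \<noteq> 0}"
  shows "bohr_polynomial (volterra_coeff_upto N a) z =
    (\<Sum>(k, d)\<in>S \<times> {2..N}. a k / (of_nat d * of_real (ln (real (k * d)))) * dchar (k * d) z)"
proof -
  let ?I = "S \<times> {2..N}"
  have fin: "finite ?I"
    using finite_support[OF a] by (simp add: S_def)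
  have "(\<Sum>(k, d)\<in>?I. a k / (of_nat d * of_real (ln (real (k * d)))) * dchar (k * d) z) =
     (\<Sum>n\<in>(\<lambda>(k, d). k * d) ` ?I. \<Sum>(k, d)\<in>{i\<in>?I. (\<lambda>(k, d). k * d) i = n}.
        a k / (of_nat d * of_real (ln (real (k * d)))) * dchar (k * d) z)"
    by (rule sum.image_gen[OF fin])
  also have "\<dots> = (\<Sum>n\<in>(\<lambda>(k, d). k * d) ` ?I. volterra_coeff_upto N a n * dchar n z)"
  proof (rule sum.cong[OF refl])
    fix n assume "n \<in> (\<lambda>(k, d). k * d) ` ?I"
    then have n: "1 \<le> n"
      by (auto simp: S_def Suc_le_eq)
    have "volterra_coeff_upto N a n * dchar n z =
       (\<Sum>d | d dvd n \<and> d \<in> {2..N}. a (n div d) / (of_nat d * of_real (ln (real n))) * dchar n z)"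
      by (simp add: volterra_coeff_upto_def sum_divide_distrib sum_distrib_right)
    also have "\<dots> = (\<Sum>d | d dvd n \<and> d \<in> {2..N} \<and> a (n div d) \<noteq> 0. a (n div d) / (of_nat d * of_real (ln (real n))) * dchar n z)"
      by (rule sum.mono_neutral_right) (auto intro: finite_subset[of _ "{2..N}"])
    also have "\<dots> = (\<Sum>(k, d)\<in>{i\<in>?I. (\<lambda>(k, d). k * d) i = n}.
        a k / (of_nat d * of_real (ln (real (k * d)))) * dchar (k * d) z)"
      using n
      by (intro sum.reindex_bij_witness[where i = snd and j = "\<lambda>d. (n div d, d)"])
         (auto simp: S_def Suc_le_eq div_gt_0_of_dvd)
    finally show "(\<Sum>(k, d)\<in>{i\<in>?I. (\<lambda>(k, d). k * d) i = n}.
        a k / (of_nat d * of_real (ln (real (k * d)))) * dchar (k * d) z) = volterra_coeff_upto N a n * dchar n z" ..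
  qed
  also have "\<dots> = bohr_polynomial (volterra_coeff_upto N a) z"
  proof (rule bohr_polynomial_eq_sum[symmetric])
    fix n :: nat assume n: "1 \<le> n" and "volterra_coeff_upto N a n \<noteq> 0"
    then have "(\<Sum>d | d dvd n \<and> d \<in> {2..N}. a (n div d) / of_nat d) \<noteq> 0"
      by (auto simp: volterra_coeff_upto_def)
    then obtain d where "d \<in> {d. d dvd n \<and> d \<in> {2..N}}" "a (n div d) / of_nat d \<noteq> 0"
      by (rule sum.not_neutral_contains_not_neutral)
    then show "n \<in> (\<lambda>(k, d). k * d) ` ?I"
      using n by (intro image_eqI[where x = "(n div d, d)"]) (auto simp: S_def Suc_le_eq div_gt_0_of_dvd)
  qed (use fin in \<open>auto simp: S_def\<close>)
  finally show ?thesis ..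
qed

lemma volterra_flow_polynomial:
  assumes a: "dirichlet_polynomial a"
  shows "\<exists>f f1 f2 H H1 H2 g g1 g2 L L1 L2. volterra_flow f f1 f2 H H1 H2 g g1 g2 L L1 L2 32 \<and>
    (\<forall>z. f z 0 = bohr_polynomial a z) \<and> (\<forall>z. H z 0 = bohr_polynomial (volterra_coeff_upto N a) z)"
proof -
  define S where "S = {n. 1 \<le> n \<and> a n \<noteq> 0}"
  define b where "b = (\<lambda>(k, d). a k / (complex_of_nat d * of_real (ln (real (k * d)))))"
  have S: "finite S" "0 \<notin> S" "\<And>n. 1 \<le> n \<Longrightarrow> a n \<noteq> 0 \<Longrightarrow> n \<in> S"
    using finite_support[OF a] by (auto simp: S_def)
  have S1: "1 \<le> n" if "n \<in> S" for n
    using that by (simp add: S_def)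
  have f: "finite S" "\<And>i. i \<in> S \<Longrightarrow> 1 \<le> (\<lambda>_. 1::nat) i \<and> (\<lambda>_. 1) i \<le> id i"
    using S S1 by auto
  have g: "finite {2..N}" "\<And>i. i \<in> {2..N} \<Longrightarrow> 1 \<le> (\<lambda>_. 1::nat) i \<and> (\<lambda>_. 1) i \<le> id i"
    by auto
  have H: "finite (S \<times> {2..N})" "\<And>i. i \<in> S \<times> {2..N} \<Longrightarrow> 1 \<le> (\<lambda>_. 1::nat) i \<and> (\<lambda>_. 1) i \<le> (\<lambda>(k, d). k * d) i"
    using S S1 by (auto simp: Suc_le_eq)
  have L: "finite ({2..N} \<times> {2..N})" "\<And>i. i \<in> {2..N} \<times> {2..N} \<Longrightarrow>
      1 \<le> (\<lambda>(m, n). min m n) i \<and> (\<lambda>(m, n). min m n) i \<le> (\<lambda>(m, n). max m n) i"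
    by auto
  let ?c = "\<lambda>n. complex_of_real (symbol_coeff n)"
  let ?cc = "\<lambda>(m, n). complex_of_real (symbol_coeff m * symbol_coeff n)"
  have at0: "exp_sum I \<mu> (\<lambda>_. 1) e z 0 = (\<Sum>i\<in>I. e i * dchar (\<mu> i) z)" for I :: "'i set" and \<mu> e z
    by (simp add: exp_sum_def)
  have f0: "exp_sum S id (\<lambda>_. 1) a z 0 = bohr_polynomial a z" for z
    unfolding at0 using bohr_polynomial_eq_sum[OF S] by simp
  have H0: "exp_sum (S \<times> {2..N}) (\<lambda>(k, d). k * d) (\<lambda>_. 1) b z 0 = bohr_polynomial (volterra_coeff_upto N a) z" for z
    unfolding at0 bohr_polynomial_volterra_coeff_upto[OF a] S_def[symmetric]
    by (simp add: b_def case_prod_beta)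
  \<comment> \<open>Differentiation multiplies the term of (k, d) by - ln (k d), which cancels the
    denominator of \<open>b\<close>; likewise - ln d cancels the logarithm in the symbol
    coefficient. Both sides then have the coefficients - a k / d.\<close>
  have H1: "exp_sum (S \<times> {2..N}) (\<lambda>(k, d). k * d) (\<lambda>_. 1)
         (\<lambda>i. - complex_of_real (ln (real (case i of (k, d) \<Rightarrow> k * d)) - ln (real 1)) * b i) z s =
         exp_sum S id (\<lambda>_. 1) a z s * exp_sum {2..N} id (\<lambda>_. 1)
           (\<lambda>n. - complex_of_real (ln (real (id n)) - ln (real 1)) * ?c n) z s" for z s
        unfolding exp_sum_def sum_product sum.cartesian_product
      proof (rule sum.cong[OF refl], clarify)
        fix k d :: nat assume kd: "k \<in> S" "d \<in> {2..N}"
        have k: "1 \<le> k" and d: "2 \<le> d" using kd S1 by auto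
        have "1 < k * d"
          using mult_le_mono[OF k d] by simp
        then have "0 < ln (real (k * d))"
          by (intro ln_gt_zero) (simp del: of_nat_mult)
        then have b: "- complex_of_real (ln (real (k * d))) * b (k, d) = - (a k / of_nat d)"
          by (simp add: b_def del: of_nat_mult)
        have c: "- complex_of_real (ln (real d)) * ?c d = - (1 / of_nat d)"
          using d by simp
        have e: "exp (- complex_of_real (ln (real (k * d))) * s) = exp (- complex_of_real (ln (real k)) * s) * exp (- complex_of_real (ln (real d)) * s)"
          using k d by (simp add: ln_mult exp_add[symmetric] algebra_simps)
        show "- complex_of_real (ln (real (k * d)) - ln (real 1)) * b (k, d) * (dchar (k * d) z * cnj (dchar 1 z)) *
             exp (- complex_of_real (ln (real (k * d)) - ln (real 1)) * s) =
           a k * (dchar (id k) z * cnj (dchar 1 z)) * exp (- complex_of_real (ln (real (id k)) - ln (real 1)) * s) *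
           (- complex_of_real (ln (real (id d)) - ln (real 1)) * ?c d * (dchar (id d) z * cnj (dchar 1 z)) *
            exp (- complex_of_real (ln (real (id d)) - ln (real 1)) * s))"
          unfolding of_nat_1 ln_one diff_0_right id_def b c e
          using k d by (simp add: dchar_mult mult_ac)
      qed
  \<comment> \<open>As d \<ge> 2, every frequency ln (k d) is positive: there is no constant term,
    and the transform vanishes at infinity.\<close>
  have lim: "((\<lambda>\<tau>. exp_sum (S \<times> {2..N}) (\<lambda>(k, d). k * d) (\<lambda>_. 1) b z (of_real \<tau>)) \<longlongrightarrow> 0) at_top" for z
        unfolding exp_sum_def
      proof (rule tendsto_null_sum)
        fix i assume "i \<in> S \<times> {2..N}"
        then obtain k d where i: "i = (k, d)" and kd: "k \<in> S" "d \<in> {2..N}" by auto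
        have k: "1 \<le> k" and d: "2 \<le> d" using kd S1 by auto
        have "1 < k * d"
          using mult_le_mono[OF k d] by simp
        then have pos: "0 < ln (real (k * d))"
          by (intro ln_gt_zero) (simp del: of_nat_mult)
        have "((\<lambda>\<tau>. exp (- ln (real (k * d)) * \<tau>)) \<longlongrightarrow> 0) at_top"
          by (rule filterlim_compose[OF exp_at_bot])
             (use pos in \<open>intro filterlim_tendsto_neg_mult_at_bot[OF tendsto_const _ filterlim_ident], simp del: of_nat_mult\<close>)
        then have "((\<lambda>\<tau>. complex_of_real (exp (- ln (real (k * d)) * \<tau>))) \<longlongrightarrow> 0) at_top"
          using tendsto_of_real[of _ 0] by fastforce
        then have "((\<lambda>\<tau>. exp (- complex_of_real (ln (real (k * d))) * of_real \<tau>)) \<longlongrightarrow> 0) at_top"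
          by (simp add: exp_of_real[symmetric] del: of_nat_mult)
        from tendsto_mult_right_zero[OF this, of "b i * (dchar (k * d) z * cnj (dchar 1 z))"]
        show "((\<lambda>\<tau>. b i * (dchar (case i of (k, d) \<Rightarrow> k * d) z * cnj (dchar 1 z)) *
           exp (- complex_of_real (ln (real (case i of (k, d) \<Rightarrow> k * d)) - ln (real 1)) * complex_of_real \<tau>)) \<longlongrightarrow> 0) at_top"
          by (simp add: i del: of_nat_mult)
      qed
  note flow = volterra_flow.intro[OF analytic_flow_exp_sum[of S "\<lambda>_. 1" id, OF f, where c = a] analytic_flow_exp_sum[of "S \<times> {2..N}" "\<lambda>_. 1" "\<lambda>(k, d). k * d", OF H, where c = b]
        analytic_flow_exp_sum[of "{2..N}" "\<lambda>_. 1" id, OF g, where c = ?c] analytic_flow_exp_sum[of "{2..N} \<times> {2..N}" "\<lambda>(m, n). min m n" "\<lambda>(m, n). max m n", OF L, where c = ?cc]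
        H1 symbol_potential_bound lim]
  show ?thesis
    by (intro exI conjI allI, rule flow, assumption+, rule f0, rule H0)
qed

lemma integral_bohr_volterra_coeff_upto_le:
  fixes p :: real
  assumes "0 < p"
  obtains C where "0 < C"
    "\<And>a N. dirichlet_polynomial a \<Longrightarrow>
      (LINT z|torus_measure. cmod (bohr_polynomial (volterra_coeff_upto N a) z) powr p) \<le>
      C * (LINT z|torus_measure. cmod (bohr_polynomial a z) powr p)"
proof -
  obtain C where C: "0 < C" "\<And>f f1 f2 H H1 H2 g g1 g2 L L1 L2. volterra_flow f f1 f2 H H1 H2 g g1 g2 L L1 L2 32 \<Longrightarrow>
      (LINT z|torus_measure. cmod (H z 0) powr p) \<le> C * (LINT z|torus_measure. cmod (f z 0) powr p)"
    using volterra_mean_bound[OF assms] by blast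
  show ?thesis
  proof (rule that[OF C(1)])
    fix a N assume "dirichlet_polynomial a"
    from volterra_flow_polynomial[OF this, of N] obtain f f1 f2 H H1 H2 g g1 g2 L L1 L2 where
      flow: "volterra_flow f f1 f2 H H1 H2 g g1 g2 L L1 L2 32"
      and "\<forall>z. f z 0 = bohr_polynomial a z" "\<forall>z. H z 0 = bohr_polynomial (volterra_coeff_upto N a) z"
      by (elim exE conjE) (rule that)
    then have eq: "\<And>z. f z 0 = bohr_polynomial a z" "\<And>z. H z 0 = bohr_polynomial (volterra_coeff_upto N a) z"
      by blast+
    show "(LINT z|torus_measure. cmod (bohr_polynomial (volterra_coeff_upto N a) z) powr p) \<le>
      C * (LINT z|torus_measure. cmod (bohr_polynomial a z) powr p)"
      using C(2)[OF flow] by (simp only: eq)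
  qed
qed

lemma integral_bohr_dilated_le:
  assumes a: "dirichlet_polynomial a" and p: "0 < p" and \<tau>: "0 \<le> \<tau>"
  shows "(LINT z|torus_measure. cmod (bohr_polynomial (\<lambda>n. a n * of_real (real n powr - \<tau>)) z) powr p) \<le>
    2 powr (p / 2) * (LINT z|torus_measure. cmod (bohr_polynomial a z) powr p)"
proof -
  define S where "S = {n. 1 \<le> n \<and> a n \<noteq> 0}"
  have S: "finite S" "0 \<notin> S" "\<And>n. 1 \<le> n \<Longrightarrow> a n \<noteq> 0 \<Longrightarrow> n \<in> S"
    using finite_support[OF a] by (auto simp: S_def)
  have f: "finite S" "\<And>i. i \<in> S \<Longrightarrow> 1 \<le> (\<lambda>_. 1::nat) i \<and> (\<lambda>_. 1) i \<le> id i"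
    using S by (auto simp: S_def)
  have at0: "exp_sum S id (\<lambda>_. 1) a z 0 = bohr_polynomial a z" for z
    using bohr_polynomial_eq_sum[OF S] by (simp add: exp_sum_def)
  have at\<tau>: "exp_sum S id (\<lambda>_. 1) a z (of_real \<tau>) = bohr_polynomial (\<lambda>n. a n * of_real (real n powr - \<tau>)) z" for z
    using S by (intro bohr_polynomial_exp_sum) auto
  obtain f1 f2 where "analytic_flow (exp_sum S id (\<lambda>_. 1) a) f1 f2"
    using analytic_flow_exp_sum[of S "\<lambda>_. 1" id a] f by blast
  from dilated_mean_bound[OF this p \<tau>] show ?thesis
    by (simp only: at\<tau> at0 mult_1_right)
qed

section \<open>Hypercontractivity on the circle\<close>

lemma norm_circle: "w \<in> space circle_measure \<Longrightarrow> norm w = 1"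
  by (simp add: space_circle)

lemma measurable_circle_continuous:
  fixes f :: "complex \<Rightarrow> 'b::topological_space"
  assumes "continuous_on (sphere 0 1) f"
  shows "f \<in> borel_measurable circle_measure"
  using borel_measurable_continuous_on_restrict[OF assms]
  by (simp cong: measurable_cong_sets[OF sets_circle refl])

lemma integrable_circle_continuous:
  fixes f :: "complex \<Rightarrow> 'b::{banach, second_countable_topology}"
  assumes "continuous_on (sphere 0 1) f"
  shows "integrable circle_measure f"
proof -
  have "bounded (f ` sphere 0 1)"
    using assms by (intro compact_imp_bounded compact_continuous_image) auto
  then obtain B where "\<And>w. w \<in> sphere 0 1 \<Longrightarrow> norm (f w) \<le> B"
    unfolding bounded_iff by blast
  then show ?thesis
    using measurable_circle_continuous[OF assms]
    by (intro circle.integrable_const_bound[where B = B]) (auto simp: space_circle)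
qed

text \<open>For m \<noteq> n the rotation by the angle pi / (m - n) reverses the sign of the
  integrand.\<close>

lemma integral_circle_power:
  "(LINT w|circle_measure. w ^ m * cnj (w ^ n)) = (if m = n then 1 else 0)"
proof (cases "m = n")
  case True
  have "(LINT w|circle_measure. w ^ m * cnj (w ^ n)) = (LINT w|circle_measure. 1)"
  proof (intro Bochner_Integration.integral_cong refl)
    fix w assume "w \<in> space circle_measure"
    then show "w ^ m * cnj (w ^ n) = 1"
      using True by (simp add: complex_norm_square[symmetric] norm_power norm_circle del: of_real_power complex_cnj_power)
  qed
  then show ?thesis
    using True by (simp add: circle.prob_space)
next
  case False
  define f where "f w = w ^ m * cnj (w ^ n)" for w :: complex
  define c where "c = cis (pi / (real m - real n))"
  have "f c = cis (real m * (pi / (real m - real n))) * cis (- (real n * (pi / (real m - real n))))"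
    by (simp only: f_def c_def Complex.DeMoivre cis_cnj)
  also have "\<dots> = cis pi"
  proof -
    have "real m - real n \<noteq> 0" using False by simp
    then have "real m * (pi / (real m - real n)) - real n * (pi / (real m - real n)) = pi"
      by (simp add: diff_divide_distrib[symmetric] left_diff_distrib[symmetric])
    then show ?thesis by (simp add: cis_mult)
  qed
  finally have fc: "f c = - 1" by simp
  have "f \<in> borel_measurable circle_measure"
    unfolding f_def by (intro measurable_circle_continuous continuous_intros)
  from integral_circle_scale[OF _ this, of c]
  have "(LINT w|circle_measure. f (c * w)) = (LINT w|circle_measure. f w)"
    by (simp add: c_def)
  moreover have "f (c * w) = - f w" for w
  proof -
    have "f (c * w) = f c * f w"
      by (simp add: f_def power_mult_distrib)
    then show ?thesis by (simp add: fc)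
  qed
  ultimately have "(LINT w|circle_measure. f w) = 0"
    by simp
  then show ?thesis
    using False by (simp add: f_def)
qed

lemma circle_parseval:
  assumes "finite A"
  shows "(LINT w|circle_measure. (cmod (\<Sum>n\<in>A. c n * w ^ n))\<^sup>2) = (\<Sum>n\<in>A. (cmod (c n))\<^sup>2)"
proof -
  have "complex_of_real (LINT w|circle_measure. (cmod (\<Sum>n\<in>A. c n * w ^ n))\<^sup>2) =
     (LINT w|circle_measure. of_real ((cmod (\<Sum>n\<in>A. c n * w ^ n))\<^sup>2))"
    by (simp only: integral_complex_of_real)
  also have "\<dots> = (LINT w|circle_measure. (\<Sum>m\<in>A. \<Sum>n\<in>A. (c m * cnj (c n)) * (w ^ m * cnj (w ^ n))))"
    unfolding complex_norm_square
    by (intro Bochner_Integration.integral_cong refl) (simp add: sum_product mult_ac)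
  also have "\<dots> = (\<Sum>m\<in>A. \<Sum>n\<in>A. (c m * cnj (c n)) * (LINT w|circle_measure. w ^ m * cnj (w ^ n)))"
  proof -
    have "integrable circle_measure (\<lambda>w. (c m * cnj (c n)) * (w ^ m * cnj (w ^ n)))" for m n
      by (intro integrable_circle_continuous continuous_intros)
    then show ?thesis
      by (simp add: Bochner_Integration.integral_sum)
  qed
  also have "\<dots> = (\<Sum>m\<in>A. c m * cnj (c m))"
    using assms by (simp only: integral_circle_power) (simp add: if_distrib sum.delta cong: if_cong)
  also have "\<dots> = of_real (\<Sum>n\<in>A. (cmod (c n))\<^sup>2)"
    by (simp only: of_real_sum complex_norm_square)
  finally show ?thesis
    by (simp only: of_real_eq_iff)
qed

lemma circle_parseval_poly:
  "(LINT w|circle_measure. (cmod (poly h (of_real r * w)))\<^sup>2) = (\<Sum>n\<le>degree h. (cmod (coeff h n))\<^sup>2 * (r\<^sup>2) ^ n)"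
proof -
  have "poly h (of_real r * w) = (\<Sum>n\<le>degree h. (coeff h n * of_real r ^ n) * w ^ n)" for w
    by (simp add: poly_altdef power_mult_distrib mult_ac)
  then show ?thesis
    using circle_parseval[of "{..degree h}" "\<lambda>n. coeff h n * of_real r ^ n"]
    by (simp add: norm_mult norm_power power_mult_distrib power_mult[symmetric] mult.commute[of 2] power_even_abs)
qed

text \<open>The fourth power mean of \<open>h\<close> is the square mean of h^2. The n-th
  coefficient of h^2 has n + 1 summands, so Cauchy--Schwarz costs a factor n + 1, which the damping
  r^(2n) has to pay for.\<close>

lemma poly_hypercontractive:
  fixes r c :: real
  assumes c: "\<And>n. real (Suc n) * (r\<^sup>2) ^ n \<le> c"
  shows "(LINT w|circle_measure. cmod (poly h (of_real r * w)) ^ 4) \<le>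
    c * (LINT w|circle_measure. (cmod (poly h w))\<^sup>2)\<^sup>2"
proof -
  \<comment> \<open>The polynomial with the coefficients |h_n|^2: the sums of |h_i|^2 |h_(n-i)|^2
    are the coefficients of Q^2, and their total is Q(1)^2.\<close>
  define Q :: "real poly" where "Q = Abs_poly (\<lambda>n. (cmod (coeff h n))\<^sup>2)"
  have Q: "coeff Q n = (cmod (coeff h n))\<^sup>2" for n
    unfolding Q_def
    by (subst Abs_poly_inverse) (use MOST_coeff_eq_0[of h] in \<open>auto elim: MOST_mono\<close>)
  have deg: "degree Q \<le> degree h"
    by (intro degree_le) (simp add: Q coeff_eq_0)
  have sumQ: "poly R 1 = (\<Sum>n\<le>k. coeff R n)" if "degree R \<le> k" for R :: "real poly" and k
    unfolding poly_altdef using that by (simp, intro sum.mono_neutral_left) (auto simp: coeff_eq_0)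
  have cs: "(cmod (coeff (h * h) n))\<^sup>2 \<le> real (Suc n) * coeff (Q * Q) n" for n
  proof -
    have "(cmod (coeff (h * h) n))\<^sup>2 \<le> (\<Sum>i\<le>n. cmod (coeff h i * coeff h (n - i)))\<^sup>2"
      unfolding coeff_mult by (intro power_mono norm_sum) auto
    also have "\<dots> = (\<Sum>i\<le>n. 1 * cmod (coeff h i * coeff h (n - i)))\<^sup>2" by simp
    also have "\<dots> \<le> (\<Sum>i\<le>n. 1\<^sup>2) * (\<Sum>i\<le>n. (cmod (coeff h i * coeff h (n - i)))\<^sup>2)"
      by (rule Cauchy_Schwarz_ineq_sum)
    also have "\<dots> = real (Suc n) * coeff (Q * Q) n"
      by (simp add: coeff_mult Q norm_mult power_mult_distrib)
    finally show ?thesis .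
  qed
  have Q_nonneg: "0 \<le> coeff (Q * Q) n" for n
    by (auto simp: coeff_mult Q intro!: sum_nonneg)
  have "(LINT w|circle_measure. cmod (poly h (of_real r * w)) ^ 4) =
     (LINT w|circle_measure. (cmod (poly (h * h) (of_real r * w)))\<^sup>2)"
    by (simp add: norm_mult power_mult_distrib power4_eq_xxxx power2_eq_square mult.assoc)
  also have "\<dots> = (\<Sum>n\<le>degree (h * h). (cmod (coeff (h * h) n))\<^sup>2 * (r\<^sup>2) ^ n)"
    by (rule circle_parseval_poly)
  also have "\<dots> \<le> (\<Sum>n\<le>degree (h * h). c * coeff (Q * Q) n)"
  proof (rule sum_mono)
    fix n
    have "(cmod (coeff (h * h) n))\<^sup>2 * (r\<^sup>2) ^ n \<le> real (Suc n) * coeff (Q * Q) n * (r\<^sup>2) ^ n"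
      using cs by (rule mult_right_mono) simp
    also have "\<dots> = real (Suc n) * (r\<^sup>2) ^ n * coeff (Q * Q) n" by simp
    also have "\<dots> \<le> c * coeff (Q * Q) n"
      using c Q_nonneg by (rule mult_right_mono)
    finally show "(cmod (coeff (h * h) n))\<^sup>2 * (r\<^sup>2) ^ n \<le> c * coeff (Q * Q) n" .
  qed
  also have "\<dots> \<le> (\<Sum>n\<le>2 * degree h. c * coeff (Q * Q) n)"
  proof (rule sum_mono2)
    have "0 \<le> c" using c[of 0] by simp
    then show "0 \<le> c * coeff (Q * Q) n" for n
      using Q_nonneg by simp
    show "{..degree (h * h)} \<subseteq> {..2 * degree h}"
      using degree_mult_le[of h h] by auto
  qed auto
  also have "\<dots> = c * poly (Q * Q) 1"
    using deg degree_mult_le[of Q Q] by (subst sumQ[of "Q * Q" "2 * degree h"]) (auto simp: sum_distrib_left)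
  also have "poly (Q * Q) 1 = (\<Sum>n\<le>degree h. (cmod (coeff h n))\<^sup>2)\<^sup>2"
    by (simp add: sumQ[OF deg] Q power2_eq_square)
  also have "(\<Sum>n\<le>degree h. (cmod (coeff h n))\<^sup>2) = (LINT w|circle_measure. (cmod (poly h w))\<^sup>2)"
    using circle_parseval_poly[of h 1] by simp
  finally show ?thesis .
qed

text \<open>The Taylor polynomials inherit the estimate and converge on the circle of radius \<rho>
  < 1 with an integrable bound. The extra radius is needed because \<open>h\<close> need not extend
  to the unit circle.\<close>

lemma holomorphic_hypercontractive:
  fixes r c \<rho> :: real
  assumes h: "h holomorphic_on ball 0 1" and \<rho>: "0 < \<rho>" "\<rho> < 1" and r: "0 \<le> r" "r \<le> 1"
    and c: "\<And>n. real (Suc n) * (r\<^sup>2) ^ n \<le> c"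
  shows "(LINT w|circle_measure. cmod (h (of_real \<rho> * (of_real r * w))) ^ 4) \<le>
    c * (LINT w|circle_measure. (cmod (h (of_real \<rho> * w)))\<^sup>2)\<^sup>2"
proof -
  define b where "b n = (deriv ^^ n) h 0 / fact n" for n
  have sums: "(\<lambda>n. b n * w ^ n) sums h w" if "cmod w < 1" for w
    using holomorphic_power_series[OF h, of w] that by (simp add: b_def)
  have summ: "summable (\<lambda>n. cmod (b n) * \<rho> ^ n)"
  proof -
    \<comment> \<open>Convergence at the midpoint between \<rho> and 1 gives absolute convergence at
      \<rho>.\<close>
    have "summable (\<lambda>n. b n * of_real ((1 + \<rho>) / 2) ^ n)"
      using sums[of "of_real ((1 + \<rho>) / 2)"] \<rho> by (intro sums_summable[of _ "h (of_real ((1 + \<rho>) / 2))"]) (simp del: of_real_divide of_real_add)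
    from powser_insidea[OF this, of "of_real \<rho>"] show ?thesis
      using \<rho> by (simp add: norm_mult norm_power del: of_real_divide of_real_add)
  qed
  define B where "B = (\<Sum>n. cmod (b n) * \<rho> ^ n)"
  define P where "P N = (\<Sum>n<N. monom (b n * of_real \<rho> ^ n) n)" for N
  have P: "poly (P N) w = (\<Sum>n<N. b n * (of_real \<rho> * w) ^ n)" for N w
    by (simp add: P_def poly_sum poly_monom power_mult_distrib mult.assoc)
  have lim: "(\<lambda>N. poly (P N) w) \<longlonglongrightarrow> h (of_real \<rho> * w)" if "cmod w \<le> 1" for w
  proof -
    have "\<rho> * cmod w \<le> \<rho> * 1"
      using that \<rho> by (intro mult_left_mono) auto
    then have "cmod (of_real \<rho> * w) < 1"
      unfolding norm_mult norm_of_real abs_of_pos[OF \<rho>(1)] using \<rho>(2) by linarith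
    from sums[OF this] show ?thesis
      unfolding sums_def P .
  qed
  have bound: "cmod (poly (P N) w) \<le> B" if "cmod w \<le> 1" for N w
  proof -
    have "cmod (poly (P N) w) \<le> (\<Sum>n<N. cmod (b n) * \<rho> ^ n)"
      unfolding P
    proof (rule sum_norm_le)
      fix n
      have "cmod w ^ n \<le> 1"
        using that by (simp add: power_le_one)
      then have "cmod (b n) * \<rho> ^ n * cmod w ^ n \<le> cmod (b n) * \<rho> ^ n"
        using \<rho> by (simp add: mult_left_le)
      then show "cmod (b n * (of_real \<rho> * w) ^ n) \<le> cmod (b n) * \<rho> ^ n"
        using \<rho> by (simp add: norm_mult norm_power power_mult_distrib mult.assoc)
    qed
    also have "\<dots> \<le> B"
      unfolding B_def using \<rho> by (intro sum_le_suminf summ) auto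
    finally show ?thesis .
  qed
  have B: "0 \<le> B"
    using order_trans[OF norm_ge_zero bound[of 0 0]] by simp
  have cont: "continuous_on (sphere 0 1) (\<lambda>w. h (of_real \<rho> * (of_real t * w)))" if "0 \<le> t" "t \<le> 1" for t
  proof -
    have "\<rho> * t \<le> \<rho> * 1"
      using \<rho> that by (intro mult_left_mono) auto
    then have "\<rho> * t < 1"
      using \<rho> by linarith
    then have sub: "(\<lambda>w. of_real \<rho> * (of_real t * w)) ` sphere 0 1 \<subseteq> ball (0::complex) 1"
      using \<rho> that by (auto simp: norm_mult)
    show ?thesis
      by (rule continuous_on_compose2[OF holomorphic_on_imp_continuous_on[OF h] _ sub]) (intro continuous_intros)
  qed
  have conv: "(\<lambda>N. LINT w|circle_measure. cmod (poly (P N) (of_real t * w)) ^ k) \<longlonglongrightarrow>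
      (LINT w|circle_measure. cmod (h (of_real \<rho> * (of_real t * w))) ^ k)" if t: "0 \<le> t" "t \<le> 1" for t k
  proof (rule integral_dominated_convergence[where w = "\<lambda>_. B ^ k"])
    have n: "cmod (of_real t * w) \<le> 1" if "w \<in> space circle_measure" for w
      using t norm_circle[OF that] by (simp add: norm_mult)
    show "AE w in circle_measure. (\<lambda>N. cmod (poly (P N) (of_real t * w)) ^ k) \<longlonglongrightarrow> cmod (h (of_real \<rho> * (of_real t * w))) ^ k"
      using n by (intro AE_I2 tendsto_intros lim) auto
    show "AE w in circle_measure. norm (cmod (poly (P N) (of_real t * w)) ^ k) \<le> B ^ k" for N
      using n B by (intro AE_I2) (auto intro!: power_mono bound)
    show "(\<lambda>w. cmod (h (of_real \<rho> * (of_real t * w))) ^ k) \<in> borel_measurable circle_measure"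
      using t by (intro measurable_circle_continuous continuous_on_power continuous_on_norm cont)
    show "(\<lambda>w. cmod (poly (P N) (of_real t * w)) ^ k) \<in> borel_measurable circle_measure" for N
      by (intro measurable_circle_continuous continuous_intros)
  qed simp
  have "(\<lambda>N. c * (LINT w|circle_measure. (cmod (poly (P N) w))\<^sup>2)\<^sup>2) \<longlonglongrightarrow>
     c * (LINT w|circle_measure. (cmod (h (of_real \<rho> * w)))\<^sup>2)\<^sup>2"
    using conv[of 1 2] by (intro tendsto_intros) simp
  with conv[OF r, of 4] show ?thesis
    by (rule LIMSEQ_le) (use poly_hypercontractive[OF c] in auto)
qed

text \<open>Reflecting the zeros inside the disc makes the polynomial zero-free there without
  changing its modulus on the circle.\<close>

lemma reflect_zeros:
  fixes f :: "complex poly"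
  assumes "f \<noteq> 0"
  shows "\<exists>k. (\<forall>w. cmod w = 1 \<longrightarrow> cmod (poly k w) = cmod (poly f w)) \<and>
    (\<forall>w. cmod w \<le> 1 \<longrightarrow> cmod (poly f w) \<le> cmod (poly k w)) \<and>
    (\<forall>w. cmod w < 1 \<longrightarrow> poly k w \<noteq> 0)"
  using assms
proof (induction "degree f" arbitrary: f rule: less_induct)
  case less
  show ?case
  proof (cases "\<exists>a. cmod a < 1 \<and> poly f a = 0")
    case False
    then show ?thesis
      by (intro exI[of _ f]) auto
  next
    case True
    then obtain a where a: "cmod a < 1" "poly f a = 0" by blast
    then obtain f' where f': "f = [:- a, 1:] * f'"
      by (auto simp: poly_eq_0_iff_dvd)
    then have "f' \<noteq> 0" "degree f' < degree f"
      using less.prems by (auto simp: degree_mult_eq simp del: mult_pCons_left)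
    from less.hyps[OF this(2,1)] obtain k where
      k: "\<And>w. cmod w = 1 \<Longrightarrow> cmod (poly k w) = cmod (poly f' w)"
        "\<And>w. cmod w \<le> 1 \<Longrightarrow> cmod (poly f' w) \<le> cmod (poly k w)"
        "\<And>w. cmod w < 1 \<Longrightarrow> poly k w \<noteq> 0" by blast
    \<comment> \<open>The identity behind Blaschke factors: it gives equality of the moduli on the
      circle and the inequality inside.\<close>
    have diff: "(cmod (1 - cnj a * w))\<^sup>2 - (cmod (w - a))\<^sup>2 = (1 - (cmod a)\<^sup>2) * (1 - (cmod w)\<^sup>2)" for w
      unfolding cmod_power2 by (simp add: power2_eq_square algebra_simps)
    have eq: "cmod (1 - cnj a * w) = cmod (w - a)" if "cmod w = 1" for w
      using diff[of w] that by (simp add: power2_eq_iff_nonneg)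
    have le: "cmod (w - a) \<le> cmod (1 - cnj a * w)" if "cmod w \<le> 1" for w
    proof -
      have "0 \<le> (1 - (cmod a)\<^sup>2) * (1 - (cmod w)\<^sup>2)"
        using a that by (intro mult_nonneg_nonneg) (auto simp: power_le_one)
      then have "(cmod (w - a))\<^sup>2 \<le> (cmod (1 - cnj a * w))\<^sup>2"
        using diff[of w] by linarith
      then show ?thesis
        by (rule power2_le_imp_le) simp
    qed
    have nz: "1 - cnj a * w \<noteq> 0" if "cmod w < 1" for w
    proof
      assume "1 - cnj a * w = 0"
      then have "cmod (cnj a * w) = 1" by simp
      moreover have "cmod a * cmod w < 1"
        using a that mult_strict_mono[of "cmod a" 1 "cmod w" 1] by simp
      ultimately show False by (simp add: norm_mult)
    qed
    have pf: "poly f w = (w - a) * poly f' w" for w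
      by (simp add: f' algebra_simps)
    have pk: "poly ([:1, - cnj a:] * k) w = (1 - cnj a * w) * poly k w" for w
      by (simp add: algebra_simps)
    show ?thesis
      by (rule exI[of _ "[:1, - cnj a:] * k"], unfold pf pk)
         (use k eq le nz in \<open>auto simp: norm_mult intro!: mult_mono\<close>)
  qed
qed

text \<open>Weissler's inequality: after the reflection, \<open>k\<close> has a holomorphic power \<open>k^(q/2)\<close> in the disc,
  which reduces the claim to the \<open>L\<^sup>2\<close>--\<open>L\<^sup>4\<close> estimate.\<close>

lemma circle_hypercontractive:
  fixes f :: "complex poly" and r c q :: real
  assumes q: "0 < q" and r: "0 \<le> r" "r < 1" and c: "\<And>n. real (Suc n) * (r\<^sup>2) ^ n \<le> c"
  shows "(LINT w|circle_measure. cmod (poly f (of_real r * w)) powr (2 * q)) \<le>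
    c * (LINT w|circle_measure. cmod (poly f w) powr q)\<^sup>2"
proof (cases "f = 0")
  case False
  obtain k where k': "(\<forall>w. cmod w = 1 \<longrightarrow> cmod (poly k w) = cmod (poly f w)) \<and>
      (\<forall>w. cmod w \<le> 1 \<longrightarrow> cmod (poly f w) \<le> cmod (poly k w)) \<and>
      (\<forall>w. cmod w < 1 \<longrightarrow> poly k w \<noteq> 0)"
    using reflect_zeros[OF False] ..
  note k = k'[THEN conjunct1, rule_format] k'[THEN conjunct2, THEN conjunct1, rule_format]
    k'[THEN conjunct2, THEN conjunct2, rule_format]
  have "poly k holomorphic_on ball 0 1"
    unfolding holomorphic_on_def field_differentiable_def
    by (rule ballI, rule exI, rule has_field_derivative_at_within, rule poly_DERIV)
  then obtain l where l: "l holomorphic_on ball 0 1" "\<And>w. w \<in> ball 0 1 \<Longrightarrow> poly k w = exp (l w)"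
    by (rule contractible_imp_holomorphic_log)
       (use k(3) convex_imp_contractible[OF convex_ball] in auto)
  define h where "h w = exp (of_real (q / 2) * l w)" for w
  have h: "h holomorphic_on ball 0 1"
    unfolding h_def using l by (intro holomorphic_intros)
  have hk: "cmod (h w) = cmod (poly k w) powr (q / 2)" if "cmod w < 1" for w
    using that l(2)[of w] by (simp add: h_def powr_def mult.commute)
  have h4: "cmod (h w) ^ 4 = cmod (poly k w) powr (2 * q)" and h2: "(cmod (h w))\<^sup>2 = cmod (poly k w) powr q"
    if "cmod w < 1" for w
    using k(3)[OF that] by (simp_all add: hk[OF that] powr_power)
  \<comment> \<open>\<open>k\<close> may vanish on the unit circle, where no logarithm is available,
    so the estimate is made on circles of radius below 1 and passed to the limit.\<close>
  define \<rho> where "\<rho> i = 1 - 1 / real (i + 2)" for i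
  have \<rho>: "0 < \<rho> i" "\<rho> i < 1" for i
    by (simp_all add: \<rho>_def)
  have "\<rho> \<longlonglongrightarrow> 1 - 0"
    unfolding \<rho>_def by (intro tendsto_diff tendsto_const LIMSEQ_ignore_initial_segment[OF lim_1_over_n])
  then have \<rho>_lim: "\<rho> \<longlonglongrightarrow> 1"
    by simp
  have powr_cont: "continuous_on S (\<lambda>w. cmod (poly g (t * w)) powr s)" if "0 < s" for g t s and S :: "complex set"
    by (rule continuous_on_powr') (use that in \<open>auto intro!: continuous_on_norm continuous_on_poly continuous_intros\<close>)
  have conv: "(\<lambda>i. LINT w|circle_measure. cmod (poly g (of_real (\<rho> i) * (of_real t * w))) powr s) \<longlonglongrightarrow>
     (LINT w|circle_measure. cmod (poly g (of_real t * w)) powr s)"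
    if s: "0 < s" and t: "0 \<le> t" "t \<le> 1" for g s t
  proof -
    have cont1: "continuous_on UNIV (\<lambda>w. cmod (poly g w) powr s)"
      using powr_cont[OF s, of UNIV g 1] by simp
    have "bounded ((\<lambda>w. cmod (poly g w) powr s) ` cball 0 1)"
      using cont1 by (intro compact_imp_bounded compact_continuous_image) (auto intro: continuous_on_subset)
    then obtain B where "\<forall>w\<in>cball (0::complex) 1. norm (cmod (poly g w) powr s) \<le> B"
      by (auto simp: bounded_iff)
    then have B: "norm (cmod (poly g w) powr s) \<le> B" if "cmod w \<le> 1" for w
      using that by (simp add: dist_norm)
    show ?thesis
    proof (rule integral_dominated_convergence[where w = "\<lambda>_. B"])
      show "AE w in circle_measure. (\<lambda>i. cmod (poly g (of_real (\<rho> i) * (of_real t * w))) powr s) \<longlonglongrightarrow> cmod (poly g (of_real t * w)) powr s"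
      proof (rule AE_I2)
        fix w
        have "(\<lambda>i. complex_of_real (\<rho> i) * (of_real t * w)) \<longlonglongrightarrow> of_real 1 * (of_real t * w)"
          by (intro tendsto_intros \<rho>_lim)
        then show "(\<lambda>i. cmod (poly g (of_real (\<rho> i) * (of_real t * w))) powr s) \<longlonglongrightarrow> cmod (poly g (of_real t * w)) powr s"
          using continuous_on_tendsto_compose[OF cont1, of _ "of_real t * w" sequentially] by simp
      qed
      show "AE w in circle_measure. norm (cmod (poly g (of_real (\<rho> i) * (of_real t * w))) powr s) \<le> B" for i
      proof (intro AE_I2 B)
        fix w assume "w \<in> space circle_measure"
        then show "cmod (of_real (\<rho> i) * (of_real t * w)) \<le> 1"
          using \<rho>[of i] t by (simp add: norm_mult norm_circle mult_le_one less_imp_le)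
      qed
      show "(\<lambda>w. cmod (poly g (of_real t * w)) powr s) \<in> borel_measurable circle_measure"
        by (rule measurable_circle_continuous[OF powr_cont[OF s]])
      show "(\<lambda>w. cmod (poly g (of_real (\<rho> i) * (of_real t * w))) powr s) \<in> borel_measurable circle_measure" for i
        unfolding mult.assoc[symmetric] by (rule measurable_circle_continuous[OF powr_cont[OF s]])
    qed simp
  qed
  have "(LINT w|circle_measure. cmod (poly f (of_real (\<rho> i) * (of_real r * w))) powr (2 * q)) \<le>
      c * (LINT w|circle_measure. cmod (poly k (of_real (\<rho> i) * (of_real 1 * w))) powr q)\<^sup>2" for i
  proof -
    have lt: "cmod (of_real (\<rho> i) * (of_real t * w)) < 1" if "w \<in> space circle_measure" "0 \<le> t" "t \<le> 1" for t w
    proof -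
      have "\<rho> i * t \<le> \<rho> i * 1"
        using \<rho>[of i] that by (intro mult_left_mono) auto
      then have "\<rho> i * t < 1"
        using \<rho>(2)[of i] by linarith
      then show ?thesis
        using \<rho>(1)[of i] that by (simp add: norm_mult norm_circle)
    qed
    have int: "integrable circle_measure (\<lambda>w. cmod (poly g (of_real (\<rho> i) * (of_real r * w))) powr (2 * q))" for g
      unfolding mult.assoc[symmetric] using q by (intro integrable_circle_continuous powr_cont) simp
    have "(LINT w|circle_measure. cmod (poly f (of_real (\<rho> i) * (of_real r * w))) powr (2 * q)) \<le>
       (LINT w|circle_measure. cmod (poly k (of_real (\<rho> i) * (of_real r * w))) powr (2 * q))"
      using lt[of _ r] r q k(2) by (intro Bochner_Integration.integral_mono int powr_mono2) (auto intro: less_imp_le)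
    also have "\<dots> = (LINT w|circle_measure. cmod (h (of_real (\<rho> i) * (of_real r * w))) ^ 4)"
      using lt[of _ r] r by (intro Bochner_Integration.integral_cong refl) (simp add: h4)
    also have "\<dots> \<le> c * (LINT w|circle_measure. (cmod (h (of_real (\<rho> i) * w)))\<^sup>2)\<^sup>2"
      using r by (intro holomorphic_hypercontractive h \<rho> c) auto
    also have "(LINT w|circle_measure. (cmod (h (of_real (\<rho> i) * w)))\<^sup>2) =
       (LINT w|circle_measure. cmod (poly k (of_real (\<rho> i) * (of_real 1 * w))) powr q)"
      using lt[of _ 1] by (intro Bochner_Integration.integral_cong refl) (simp add: h2)
    finally show ?thesis .
  qed
  then have "(LINT w|circle_measure. cmod (poly f (of_real r * w)) powr (2 * q)) \<le>
    c * (LINT w|circle_measure. cmod (poly k (of_real 1 * w)) powr q)\<^sup>2"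
    using q r by (intro LIMSEQ_le[OF conv tendsto_mult[OF tendsto_const tendsto_power[OF conv]]]) auto
  \<comment> \<open>The reflection has kept the modulus on the circle, so \<open>f\<close> returns
    on the right; on the left |f| \<le> |k| inside the disc has been used.\<close>
  also have "(LINT w|circle_measure. cmod (poly k (of_real 1 * w)) powr q) = (LINT w|circle_measure. cmod (poly f w) powr q)"
    by (intro Bochner_Integration.integral_cong refl) (simp add: k norm_circle)
  finally show ?thesis .
qed simp

section \<open>Hypercontractivity on the infinite torus\<close>

lemma Cauchy_Schwarz_integral:
  fixes f g :: "'a \<Rightarrow> real"
  assumes f: "integrable M (\<lambda>x. (f x)\<^sup>2)" and g: "integrable M (\<lambda>x. (g x)\<^sup>2)" and fg: "integrable M (\<lambda>x. f x * g x)"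
  shows "(LINT x|M. f x * g x)\<^sup>2 \<le> (LINT x|M. (f x)\<^sup>2) * (LINT x|M. (g x)\<^sup>2)"
proof -
  define A where "A = (LINT x|M. (f x)\<^sup>2)"
  define B where "B = (LINT x|M. (g x)\<^sup>2)"
  define C where "C = (LINT x|M. f x * g x)"
  have quad: "0 \<le> s\<^sup>2 * A - 2 * (s * t) * C + t\<^sup>2 * B" for s t
  proof -
    have "0 \<le> (LINT x|M. (s * f x - t * g x)\<^sup>2)"
      by (intro Bochner_Integration.integral_nonneg) auto
    also have "(\<lambda>x. (s * f x - t * g x)\<^sup>2) = (\<lambda>x. s\<^sup>2 * (f x)\<^sup>2 - 2 * (s * t) * (f x * g x) + t\<^sup>2 * (g x)\<^sup>2)"
      by (simp add: fun_eq_iff power2_eq_square algebra_simps)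
    also have "(LINT x|M. \<dots> x) = s\<^sup>2 * A - 2 * (s * t) * C + t\<^sup>2 * B"
      using f g fg by (simp add: A_def B_def C_def)
    finally show ?thesis .
  qed
  have B: "0 \<le> B"
    unfolding B_def by (intro Bochner_Integration.integral_nonneg) auto
  show ?thesis
  proof (cases "B = 0")
    case True
    have "C = 0"
    proof (rule ccontr)
      assume "C \<noteq> 0"
      \<comment> \<open>With s = 1 this value of t turns the quadratic form into A - (A +
        1).\<close>
      then show False
        using quad[of 1 "(A + 1) / (2 * C)"] True by simp
    qed
    then show ?thesis
      using True by (simp add: A_def B_def C_def)
  next
    case False
    have "0 \<le> B * (A * B - C\<^sup>2)"
      using quad[of B C] by (simp add: power2_eq_square algebra_simps)
    then have "0 \<le> A * B - C\<^sup>2"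
      using False B by (simp add: zero_le_mult_iff)
    then show ?thesis
      by (simp add: A_def B_def C_def)
  qed
qed

text \<open>Minkowski's integral inequality in L^2, by self-improvement: the left-hand side S is the
  double integral of K k, Fubini and Cauchy--Schwarz in y bound it by sqrt S times the right-hand
  root, and sqrt S is divided out.\<close>

lemma (in pair_prob_space) minkowski_square:
  fixes k :: "'a \<Rightarrow> 'b \<Rightarrow> real"
  assumes k[measurable]: "case_prod k \<in> borel_measurable (M1 \<Otimes>\<^sub>M M2)"
    and bound: "\<And>x y. x \<in> space M1 \<Longrightarrow> y \<in> space M2 \<Longrightarrow> \<bar>k x y\<bar> \<le> B"
  shows "(LINT y|M2. (LINT x|M1. k x y)\<^sup>2) \<le> (LINT x|M1. sqrt (LINT y|M2. (k x y)\<^sup>2))\<^sup>2"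
proof -
  define K where "K y = (LINT x|M1. k x y)" for y
  define S where "S = (LINT y|M2. (K y)\<^sup>2)"
  define s where "s x = sqrt (LINT y|M2. (k x y)\<^sup>2)" for x
  have ksw[measurable]: "(\<lambda>(y, x). k x y) \<in> borel_measurable (M2 \<Otimes>\<^sub>M M1)"
    by measurable
  have K_meas[measurable]: "K \<in> borel_measurable M2"
    unfolding K_def by measurable
  have s_meas[measurable]: "s \<in> borel_measurable M1"
    unfolding s_def by measurable
  obtain x0 y0 where xy: "x0 \<in> space M1" "y0 \<in> space M2"
    using M1.not_empty M2.not_empty by blast
  have B: "0 \<le> B"
    using bound[OF xy] by linarith
  have kx: "integrable M1 (\<lambda>x. k x y)" if "y \<in> space M2" for y
    using bound that by (intro M1.integrable_const_bound[where B = B]) auto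
  have K_bound: "\<bar>K y\<bar> \<le> B" if y: "y \<in> space M2" for y
  proof -
    have "\<bar>K y\<bar> \<le> (LINT x|M1. \<bar>k x y\<bar>)"
      unfolding K_def by (rule integral_abs_bound)
    also have "\<dots> \<le> (LINT x|M1. B)"
      using kx[OF y] bound y by (intro Bochner_Integration.integral_mono) auto
    finally show ?thesis
      by (simp add: M1.prob_space)
  qed
  have sq: "u\<^sup>2 \<le> B\<^sup>2" if "\<bar>u\<bar> \<le> B" for u :: real
    using that B by (simp add: abs_le_square_iff[symmetric])
  have int_K2: "integrable M2 (\<lambda>y. (K y)\<^sup>2)"
    using K_bound sq by (intro M2.integrable_const_bound[where B = "B\<^sup>2"]) auto
  have int_k2: "integrable M2 (\<lambda>y. (k x y)\<^sup>2)" if "x \<in> space M1" for x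
    using bound sq that by (intro M2.integrable_const_bound[where B = "B\<^sup>2"]) auto
  have Kk: "\<bar>K y * k x y\<bar> \<le> B * B" if "x \<in> space M1" "y \<in> space M2" for x y
    unfolding abs_mult using K_bound bound that B by (intro mult_mono) auto
  have int_Kk: "integrable M2 (\<lambda>y. K y * k x y)" if "x \<in> space M1" for x
    using Kk that by (intro M2.integrable_const_bound[where B = "B * B"]) auto
  have S: "0 \<le> S"
    unfolding S_def by (intro Bochner_Integration.integral_nonneg) auto
  have s_nonneg: "0 \<le> s x" for x
    unfolding s_def by (auto intro!: Bochner_Integration.integral_nonneg)
  have s_le: "s x \<le> B" if "x \<in> space M1" for x
  proof -
    have "(LINT y|M2. (k x y)\<^sup>2) \<le> (LINT y|M2. B\<^sup>2)"
      using int_k2[OF that] bound sq that by (intro Bochner_Integration.integral_mono) auto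
    then show ?thesis
      unfolding s_def using B by (intro real_le_lsqrt) (auto simp: M2.prob_space)
  qed
  have int_s: "integrable M1 s"
    using s_le s_nonneg by (intro M1.integrable_const_bound[where B = B]) auto
  have int_pair: "integrable (M1 \<Otimes>\<^sub>M M2) (\<lambda>(x, y). K y * k x y)"
    using Kk by (intro P.integrable_const_bound[where B = "B * B"]) (auto simp: space_pair_measure)
  have "S = (LINT y|M2. (LINT x|M1. K y * k x y))"
    unfolding S_def by (simp add: K_def power2_eq_square)
  also have "\<dots> = (LINT x|M1. (LINT y|M2. K y * k x y))"
    using Fubini_integral[OF int_pair] .
  also have "\<dots> \<le> (LINT x|M1. sqrt S * s x)"
  proof (rule Bochner_Integration.integral_mono)
    show "integrable M1 (\<lambda>x. LINT y|M2. K y * k x y)"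
      using integrable_fst'[OF int_pair] by simp
    show "integrable M1 (\<lambda>x. sqrt S * s x)"
      using int_s by simp
    fix x assume x: "x \<in> space M1"
    have "(LINT y|M2. K y * k x y)\<^sup>2 \<le> S * (LINT y|M2. (k x y)\<^sup>2)"
      unfolding S_def by (rule Cauchy_Schwarz_integral[OF int_K2 int_k2[OF x] int_Kk[OF x]])
    then show "(LINT y|M2. K y * k x y) \<le> sqrt S * s x"
      unfolding s_def real_sqrt_mult[symmetric] by (rule real_le_rsqrt)
  qed
  also have "\<dots> = sqrt S * (LINT x|M1. s x)"
    by simp
  finally have le: "S \<le> sqrt S * (LINT x|M1. s x)" .
  show ?thesis
  proof (cases "S = 0")
    case True
    then show ?thesis by (simp add: S_def K_def)
  next
    case False
    then have pos: "0 < sqrt S" using S by simp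
    have "sqrt S * sqrt S \<le> sqrt S * (LINT x|M1. s x)"
      using le S by simp
    then have "sqrt S \<le> (LINT x|M1. s x)"
      using pos by (rule mult_left_le_imp_le)
    then have "(sqrt S)\<^sup>2 \<le> (LINT x|M1. s x)\<^sup>2"
      using S by (intro power_mono) auto
    then show ?thesis
      using S by (simp add: S_def K_def s_def)
  qed
qed

interpretation resample: pair_prob_space circle_measure torus_measure ..

text \<open>Replacing one coordinate by an independent uniform point of the circle does not change
  the mean. So a single variable can be integrated separately while the remaining integral still
  runs over the whole torus.\<close>

lemma torus_resample:
  fixes G :: "(nat \<Rightarrow> complex) \<Rightarrow> real"
  assumes G: "G \<in> borel_measurable torus_measure" and bound: "\<And>z. z \<in> space torus_measure \<Longrightarrow> \<bar>G z\<bar> \<le> B"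
  shows "case_prod (\<lambda>w z. G (z(j := w))) \<in> borel_measurable (circle_measure \<Otimes>\<^sub>M torus_measure)"
    and "(LINT z|torus_measure. (LINT w|circle_measure. G (z(j := w)))) = (LINT z|torus_measure. G z)"
    and "(LINT w|circle_measure. (LINT z|torus_measure. G (z(j := w)))) = (LINT z|torus_measure. G z)"
proof -
  show meas: "case_prod (\<lambda>w z. G (z(j := w))) \<in> borel_measurable (circle_measure \<Otimes>\<^sub>M torus_measure)"
    using measurable_compose[OF measurable_torus_fun_upd G] by (simp add: case_prod_beta')
  have int: "integrable (circle_measure \<Otimes>\<^sub>M torus_measure) (case_prod (\<lambda>w z. G (z(j := w))))"
    by (rule resample.P.integrable_const_bound[where B = B])
       (use bound fun_upd_torus meas in \<open>auto simp: space_pair_measure\<close>)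
  have "(LINT z|torus_measure. G z) = (LINT z|distr (circle_measure \<Otimes>\<^sub>M torus_measure) torus_measure (\<lambda>(w, z). z(j := w)). G z)"
    by (simp only: distr_torus_fun_upd)
  also have "\<dots> = integral\<^sup>L (circle_measure \<Otimes>\<^sub>M torus_measure) (case_prod (\<lambda>w z. G (z(j := w))))"
    using G measurable_torus_fun_upd by (subst integral_distr) (simp_all add: case_prod_beta')
  finally have eq: "(LINT z|torus_measure. G z) = \<dots>" .
  show "(LINT z|torus_measure. (LINT w|circle_measure. G (z(j := w)))) = (LINT z|torus_measure. G z)"
    unfolding eq by (rule resample.integral_snd[OF int])
  show "(LINT w|circle_measure. (LINT z|torus_measure. G (z(j := w)))) = (LINT z|torus_measure. G z)"
    unfolding eq using resample.integral_fst'[OF int] by simp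
qed

text \<open>Exponents form an indexed family that may repeat. This is needed for the induction over
  the variables: deleting a coordinate can make different exponents coincide.\<close>

definition torus_poly :: "nat set \<Rightarrow> (nat \<Rightarrow> complex) \<Rightarrow> (nat \<Rightarrow> nat \<Rightarrow> nat) \<Rightarrow> (nat \<Rightarrow> complex) \<Rightarrow> complex" where
  "torus_poly I c \<alpha> z = (\<Sum>i\<in>I. c i * monomial (\<alpha> i) z)"

lemma measurable_torus_poly [measurable]: "torus_poly I c \<alpha> \<in> borel_measurable torus_measure"
  unfolding torus_poly_def by measurable

lemma torus_poly_powr_bound:
  assumes "z \<in> space torus_measure" "0 < q"
  shows "\<bar>cmod (torus_poly I c \<alpha> z) powr q\<bar> \<le> (\<Sum>i\<in>I. cmod (c i)) powr q"
proof -
  have "cmod (torus_poly I c \<alpha> z) \<le> (\<Sum>i\<in>I. cmod (c i))"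
    unfolding torus_poly_def using assms by (intro sum_norm_le) (simp add: norm_mult norm_monomial)
  then show ?thesis
    using assms by (simp add: powr_mono2)
qed

lemma torus_poly_scale:
  "torus_poly I c \<alpha> (\<lambda>j. r j * z j) = torus_poly I (\<lambda>i. c i * monomial (\<alpha> i) r) \<alpha> z"
  by (simp add: torus_poly_def monomial_scale mult.assoc)

lemma torus_poly_fun_upd:
  assumes "\<And>i. i \<in> I \<Longrightarrow> finite {j. \<alpha> i j \<noteq> 0}"
  shows "torus_poly I c \<alpha> (z(j := w)) = torus_poly I (\<lambda>i. c i * w ^ \<alpha> i j) (\<lambda>i. (\<alpha> i)(j := 0)) z"
  unfolding torus_poly_def by (rule sum.cong) (use assms in \<open>simp_all add: monomial_fun_upd mult.assoc\<close>)

definition coordinate_poly where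
  "coordinate_poly I c \<alpha> j z = (\<Sum>i\<in>I. monom (c i * monomial ((\<alpha> i)(j := 0)) z) (\<alpha> i j))"

lemma poly_coordinate_poly:
  assumes "\<And>i. i \<in> I \<Longrightarrow> finite {j. \<alpha> i j \<noteq> 0}"
  shows "poly (coordinate_poly I c \<alpha> j z) w = torus_poly I c \<alpha> (z(j := w))"
  unfolding torus_poly_def coordinate_poly_def poly_sum poly_monom
  by (rule sum.cong) (use assms in \<open>simp_all add: monomial_fun_upd mult_ac\<close>)

lemma powr_square: "(x powr q)\<^sup>2 = x powr (2 * q)" for x q :: real
  by (simp add: power2_eq_square powr_add[symmetric])

text \<open>Induction over the damped variables. For fixed other coordinates the new variable is
  treated by the circle inequality, which leaves the integral of a squared mean; Minkowski exchanges
  the two integrations, and the induction hypothesis treats the polynomial obtained by freezing the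
  new variable. Hence \<open>c\<close> and \<open>\<alpha>\<close> must be arbitrary.\<close>

lemma torus_hypercontractive:
  fixes q :: real and r C :: "nat \<Rightarrow> real"
  assumes q: "0 < q" and r: "\<And>j. 0 \<le> r j" "\<And>j. r j < 1"
    and C: "\<And>j n. real (Suc n) * ((r j)\<^sup>2) ^ n \<le> C j"
    and J: "finite J" and I: "\<And>i j. i \<in> I \<Longrightarrow> \<alpha> i j \<noteq> 0 \<Longrightarrow> j \<in> J"
  shows "(LINT z|torus_measure. cmod (torus_poly I c \<alpha> (\<lambda>j. (if j \<in> J then of_real (r j) else 1) * z j)) powr (2 * q)) \<le>
    (\<Prod>j\<in>J. C j) * (LINT z|torus_measure. cmod (torus_poly I c \<alpha> z) powr q)\<^sup>2"
  using J I
proof (induction J arbitrary: c \<alpha> rule: finite_induct)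
  case (empty c \<alpha>)
  then have "\<alpha> i = (\<lambda>_. 0)" if "i \<in> I" for i
    using that by auto
  then have "torus_poly I c \<alpha> z = sum c I" for z
    unfolding torus_poly_def by (intro sum.cong) (simp_all add: monomial_def)
  then show ?case
    by (simp add: torus.prob_space powr_square)
next
  case (insert j J c \<alpha>)
  define sc where "sc J z = (\<lambda>i. (if i \<in> J then of_real (r i) else 1) * z i)" for J and z :: "nat \<Rightarrow> complex"
  have fin: "finite {j. \<alpha> i j \<noteq> 0}" if "i \<in> I" for i
    by (rule finite_subset[of _ "insert j J"]) (use insert.prems that insert.hyps in auto)
  let ?F = "torus_poly I c \<alpha>"
  let ?c = "\<lambda>w i. c i * w ^ \<alpha> i j" and ?\<alpha> = "\<lambda>i. (\<alpha> i)(j := 0)"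
  have upd: "?F (z(j := w)) = torus_poly I (?c w) ?\<alpha> z" for z w
    by (rule torus_poly_fun_upd) (rule fin)
  have sc_poly: "?F (sc L z) = torus_poly I (\<lambda>i. c i * monomial (\<alpha> i) (\<lambda>i. if i \<in> L then of_real (r i) else 1)) \<alpha> z" for L z
    unfolding sc_def by (rule torus_poly_scale)
  have meas: "(\<lambda>z. cmod (?F (sc L z)) powr s) \<in> borel_measurable torus_measure" for L s
    unfolding sc_poly by measurable
  have bound: "\<exists>B. \<forall>z\<in>space torus_measure. \<bar>cmod (?F (sc L z)) powr s\<bar> \<le> B" if "0 < s" for L s
    unfolding sc_poly using torus_poly_powr_bound[OF _ that] by blast
  have upd1: "sc (insert j J) (z(j := w)) = (sc J z)(j := of_real (r j) * w)" for z w
    using insert.hyps by (auto simp: sc_def fun_eq_iff)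
  have upd2: "sc J (z(j := w)) = (sc J z)(j := w)" for z w
    using insert.hyps by (auto simp: sc_def fun_eq_iff)
  have C0: "0 \<le> C i" for i
    using C[of 0 i] by simp
  have CJ: "0 \<le> (\<Prod>j\<in>J. C j)"
    using C0 by (intro prod_nonneg) auto
  obtain B2 where B2: "\<And>z. z \<in> space torus_measure \<Longrightarrow> \<bar>cmod (?F (sc (insert j J) z)) powr (2 * q)\<bar> \<le> B2"
    using bound[of "2 * q" "insert j J"] q by auto
  obtain BJ where BJ: "\<And>z. z \<in> space torus_measure \<Longrightarrow> \<bar>cmod (?F (sc J z)) powr q\<bar> \<le> BJ"
    using bound[of q J] q by auto
  have sc_empty: "sc {} z = z" for z
    by (simp add: sc_def)
  obtain B where B: "\<And>z. z \<in> space torus_measure \<Longrightarrow> \<bar>cmod (?F z) powr q\<bar> \<le> B"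
    using bound[of q "{}"] q by (auto simp: sc_empty)
  have measF: "(\<lambda>z. cmod (?F z) powr q) \<in> borel_measurable torus_measure"
    by measurable
  define k where "k w z = cmod (?F (sc J (z(j := w)))) powr q" for w z
  have k_meas: "case_prod k \<in> borel_measurable (circle_measure \<Otimes>\<^sub>M torus_measure)"
    unfolding k_def by (rule torus_resample(1)[OF meas BJ])
  have k_bound: "\<bar>k w z\<bar> \<le> BJ" if "w \<in> space circle_measure" "z \<in> space torus_measure" for w z
    unfolding k_def using fun_upd_torus that by (intro BJ) auto
  have k_nonneg: "0 \<le> k w z" for w z
    by (simp add: k_def)
  have k_swap: "(\<lambda>z. LINT w|circle_measure. k w z) \<in> borel_measurable torus_measure"
    using k_meas by (intro circle.borel_measurable_lebesgue_integral) simp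
  have "(LINT z|torus_measure. cmod (?F (sc (insert j J) z)) powr (2 * q)) =
     (LINT z|torus_measure. (LINT w|circle_measure. cmod (?F (sc (insert j J) (z(j := w)))) powr (2 * q)))"
    by (rule torus_resample(2)[OF meas B2, symmetric])
  also have "\<dots> = (LINT z|torus_measure. (LINT w|circle_measure. cmod (poly (coordinate_poly I c \<alpha> j (sc J z)) (of_real (r j) * w)) powr (2 * q)))"
    unfolding upd1 by (simp add: poly_coordinate_poly[OF fin])
  also have "\<dots> \<le> (LINT z|torus_measure. C j * (LINT w|circle_measure. k w z)\<^sup>2)"
  proof (rule Bochner_Integration.integral_mono)
    have pair: "case_prod (\<lambda>w z. cmod (?F (sc (insert j J) (z(j := w)))) powr (2 * q)) \<in> borel_measurable (circle_measure \<Otimes>\<^sub>M torus_measure)"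
      by (rule torus_resample(1)[OF meas B2])
    have "integrable (circle_measure \<Otimes>\<^sub>M torus_measure) (case_prod (\<lambda>w z. cmod (?F (sc (insert j J) (z(j := w)))) powr (2 * q)))"
      by (rule resample.P.integrable_const_bound[where B = B2])
         (use B2 fun_upd_torus pair in \<open>auto simp: space_pair_measure\<close>)
    from resample.integrable_snd[OF this]
    show "integrable torus_measure (\<lambda>z. LINT w|circle_measure. cmod (poly (coordinate_poly I c \<alpha> j (sc J z)) (of_real (r j) * w)) powr (2 * q))"
      unfolding upd1 by (simp add: poly_coordinate_poly[OF fin])
    show "integrable torus_measure (\<lambda>z. C j * (LINT w|circle_measure. k w z)\<^sup>2)"
    proof (rule torus.integrable_const_bound[where B = "C j * BJ\<^sup>2"])
      show "(\<lambda>z. C j * (LINT w|circle_measure. k w z)\<^sup>2) \<in> borel_measurable torus_measure"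
        using k_swap by measurable
      show "AE z in torus_measure. norm (C j * (LINT w|circle_measure. k w z)\<^sup>2) \<le> C j * BJ\<^sup>2"
      proof (rule AE_I2)
        fix z assume z: "z \<in> space torus_measure"
        have kz: "(\<lambda>w. k w z) \<in> borel_measurable circle_measure"
          using measurable_compose[OF measurable_Pair2'[OF z] k_meas] by simp
        have int: "integrable circle_measure (\<lambda>w. k w z)"
          using k_bound z kz by (intro circle.integrable_const_bound[where B = BJ]) auto
        have "(LINT w|circle_measure. k w z) \<le> (LINT w|circle_measure. BJ)"
          using int k_bound z k_nonneg by (intro Bochner_Integration.integral_mono) (auto intro: order_trans[OF abs_ge_self])
        then have "(LINT w|circle_measure. k w z) \<le> BJ"
          by (simp add: circle.prob_space)
        moreover have "0 \<le> (LINT w|circle_measure. k w z)"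
          using k_nonneg by (intro Bochner_Integration.integral_nonneg) auto
        ultimately have "(LINT w|circle_measure. k w z)\<^sup>2 \<le> BJ\<^sup>2"
          by (intro power_mono)
        then show "norm (C j * (LINT w|circle_measure. k w z)\<^sup>2) \<le> C j * BJ\<^sup>2"
          using C0[of j] by (simp add: abs_mult mult_left_mono)
      qed
    qed
    fix z
    show "(LINT w|circle_measure. cmod (poly (coordinate_poly I c \<alpha> j (sc J z)) (of_real (r j) * w)) powr (2 * q)) \<le>
      C j * (LINT w|circle_measure. k w z)\<^sup>2"
      using circle_hypercontractive[OF q r(1)[of j] r(2)[of j] C[where j = j], of "coordinate_poly I c \<alpha> j (sc J z)"]
      by (simp add: k_def upd2 poly_coordinate_poly[OF fin])
  qed
  also have "\<dots> = C j * (LINT z|torus_measure. (LINT w|circle_measure. k w z)\<^sup>2)"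
    by simp
  \<comment> \<open>Minkowski moves the square outside the integral over the new variable, so that
    the other variables can be handled for each fixed w.\<close>
  also have "\<dots> \<le> C j * (LINT w|circle_measure. sqrt (LINT z|torus_measure. (k w z)\<^sup>2))\<^sup>2"
    by (intro mult_left_mono C0 resample.minkowski_square[where B = BJ] k_meas k_bound)
  also have "\<dots> \<le> C j * (LINT w|circle_measure. sqrt (\<Prod>j\<in>J. C j) * (LINT z|torus_measure. cmod (?F (z(j := w))) powr q))\<^sup>2"
  proof (intro mult_left_mono C0 power_mono)
    show "0 \<le> (LINT w|circle_measure. sqrt (LINT z|torus_measure. (k w z)\<^sup>2))"
      by (intro Bochner_Integration.integral_nonneg) (auto intro!: Bochner_Integration.integral_nonneg)
    show "(LINT w|circle_measure. sqrt (LINT z|torus_measure. (k w z)\<^sup>2)) \<le>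
      (LINT w|circle_measure. sqrt (\<Prod>j\<in>J. C j) * (LINT z|torus_measure. cmod (?F (z(j := w))) powr q))"
    proof (rule Bochner_Integration.integral_mono)
      have k2_meas: "case_prod (\<lambda>w z. (k w z)\<^sup>2) \<in> borel_measurable (circle_measure \<Otimes>\<^sub>M torus_measure)"
        using borel_measurable_power[OF k_meas, of 2] by (simp add: case_prod_beta')
      have k2: "(k w z)\<^sup>2 \<le> BJ\<^sup>2" if "w \<in> space circle_measure" "z \<in> space torus_measure" for w z
        using k_bound[OF that] k_nonneg[of w z] by (intro power_mono) auto
      show "integrable circle_measure (\<lambda>w. sqrt (LINT z|torus_measure. (k w z)\<^sup>2))"
      proof (rule circle.integrable_const_bound[where B = "sqrt (BJ\<^sup>2)"])
        show "(\<lambda>w. sqrt (LINT z|torus_measure. (k w z)\<^sup>2)) \<in> borel_measurable circle_measure"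
          using torus.borel_measurable_lebesgue_integral[OF k2_meas] by measurable
        show "AE w in circle_measure. norm (sqrt (LINT z|torus_measure. (k w z)\<^sup>2)) \<le> sqrt (BJ\<^sup>2)"
        proof (rule AE_I2)
          fix w assume w: "w \<in> space circle_measure"
          have "(\<lambda>z. (k w z)\<^sup>2) \<in> borel_measurable torus_measure"
            using measurable_compose[OF measurable_Pair1'[OF w] k2_meas] by simp
          then have "integrable torus_measure (\<lambda>z. (k w z)\<^sup>2)"
            using k2 w by (intro torus.integrable_const_bound[where B = "BJ\<^sup>2"]) auto
          then have "(LINT z|torus_measure. (k w z)\<^sup>2) \<le> (LINT z|torus_measure. BJ\<^sup>2)"
            using k2 w by (intro Bochner_Integration.integral_mono) auto
          moreover have "0 \<le> (LINT z|torus_measure. (k w z)\<^sup>2)"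
            by (intro Bochner_Integration.integral_nonneg) auto
          ultimately show "norm (sqrt (LINT z|torus_measure. (k w z)\<^sup>2)) \<le> sqrt (BJ\<^sup>2)"
            by (simp add: torus.prob_space del: real_sqrt_abs)
        qed
      qed
      have "case_prod (\<lambda>w z. cmod (?F (z(j := w))) powr q) \<in> borel_measurable (circle_measure \<Otimes>\<^sub>M torus_measure)"
        by (rule torus_resample(1)[OF measF B])
      then have "integrable (circle_measure \<Otimes>\<^sub>M torus_measure) (case_prod (\<lambda>w z. cmod (?F (z(j := w))) powr q))"
        by (intro resample.P.integrable_const_bound[where B = B])
           (use B fun_upd_torus in \<open>auto simp: space_pair_measure\<close>)
      from resample.integrable_fst'[OF this]
      show "integrable circle_measure (\<lambda>w. sqrt (\<Prod>j\<in>J. C j) * (LINT z|torus_measure. cmod (?F (z(j := w))) powr q))"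
        by simp
      fix w assume "w \<in> space circle_measure"
      \<comment> \<open>With w frozen, its powers belong to the coefficients and the exponent at
        \<open>j\<close> is 0, so the support lies in the smaller set.\<close>
      have sup: "i \<in> J" if "n \<in> I" "?\<alpha> n i \<noteq> 0" for n i
        using insert.prems[of n i] that by (auto split: if_splits)
      have "(LINT z|torus_measure. (k w z)\<^sup>2) = (LINT z|torus_measure. cmod (torus_poly I (?c w) ?\<alpha> (sc J z)) powr (2 * q))"
        unfolding k_def upd2 upd by (simp add: powr_square)
      also have "\<dots> \<le> (\<Prod>j\<in>J. C j) * (LINT z|torus_measure. cmod (torus_poly I (?c w) ?\<alpha> z) powr q)\<^sup>2"
        unfolding sc_def by (rule insert.IH[OF sup])
      also have "\<dots> = (\<Prod>j\<in>J. C j) * (LINT z|torus_measure. cmod (?F (z(j := w))) powr q)\<^sup>2"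
        by (simp only: upd)
      finally have "sqrt (LINT z|torus_measure. (k w z)\<^sup>2) \<le> sqrt (\<Prod>j\<in>J. C j) * sqrt ((LINT z|torus_measure. cmod (?F (z(j := w))) powr q)\<^sup>2)"
        unfolding real_sqrt_mult[symmetric] by (rule real_sqrt_le_mono)
      also have "sqrt ((LINT z|torus_measure. cmod (?F (z(j := w))) powr q)\<^sup>2) = (LINT z|torus_measure. cmod (?F (z(j := w))) powr q)"
        by (simp add: Bochner_Integration.integral_nonneg)
      finally show "sqrt (LINT z|torus_measure. (k w z)\<^sup>2) \<le> sqrt (\<Prod>j\<in>J. C j) * (LINT z|torus_measure. cmod (?F (z(j := w))) powr q)" .
    qed
  qed
  also have "(LINT w|circle_measure. sqrt (\<Prod>j\<in>J. C j) * (LINT z|torus_measure. cmod (?F (z(j := w))) powr q)) =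
      sqrt (\<Prod>j\<in>J. C j) * (LINT z|torus_measure. cmod (?F z) powr q)"
    using torus_resample(3)[OF measF B, of j] by simp
  also have "C j * (sqrt (\<Prod>j\<in>J. C j) * (LINT z|torus_measure. cmod (?F z) powr q))\<^sup>2 =
      (\<Prod>j\<in>insert j J. C j) * (LINT z|torus_measure. cmod (?F z) powr q)\<^sup>2"
    using insert.hyps CJ by (simp add: power_mult_distrib)
  finally show ?case
    unfolding sc_def .
qed

section \<open>Damping by primes, with constants independent of the number of variables\<close>

lemma nth_prime_decay:
  fixes \<delta> x :: real
  assumes "0 < \<delta>" "0 < x"
  shows "finite {j. x < real (nth_prime j) powr - \<delta>}"
proof -
  have le: "real (nth_prime j) < x powr (- 1 / \<delta>)" if "x < real (nth_prime j) powr - \<delta>" for j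
  proof -
    have p: "0 < nth_prime j"
      using prime_nth_prime by (simp add: prime_gt_0_nat)
    have "(real (nth_prime j) powr - \<delta>) powr (- 1 / \<delta>) < x powr (- 1 / \<delta>)"
      using assms that by (intro powr_less_mono2_neg) auto
    then show ?thesis
      using assms p by (simp add: powr_powr)
  qed
  have "{j. x < real (nth_prime j) powr - \<delta>} \<subseteq> nth_prime -` {..nat \<lfloor>x powr (- 1 / \<delta>)\<rfloor>}"
  proof
    fix j assume "j \<in> {j. x < real (nth_prime j) powr - \<delta>}"
    then have "nth_prime j \<le> nat \<lfloor>x powr (- 1 / \<delta>)\<rfloor>"
      using le[of j] by (intro le_nat_floor) simp
    then show "j \<in> nth_prime -` {..nat \<lfloor>x powr (- 1 / \<delta>)\<rfloor>}" by simp
  qed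
  moreover have "finite (nth_prime -` {..nat \<lfloor>x powr (- 1 / \<delta>)\<rfloor>})"
    using bij_nth_prime by (intro finite_vimageI) (auto simp: bij_betw_def)
  ultimately show ?thesis
    by (rule finite_subset)
qed

text \<open>Consecutive terms have the ratio (n + 2) / (2 (n + 1)) \<le> 1. So a prime with r^2
  \<le> 1 / 2 satisfies the circle inequality with the constant 1.\<close>

lemma weight_bound_half: "real (Suc n) * (1 / 2) ^ n \<le> 1"
proof (induction n)
  case (Suc n)
  have "real (Suc (Suc n)) * (1 / 2) ^ Suc n \<le> real (Suc n) * (1 / 2) ^ n"
    by (simp add: field_simps)
  with Suc show ?case by linarith
qed simp

lemma weight_bound_exists:
  fixes x :: real
  assumes "0 \<le> x" "x < 1"
  obtains c where "1 \<le> c" "\<And>n. real (Suc n) * x ^ n \<le> c"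
proof -
  have "summable (\<lambda>n. real (Suc n) * x ^ n)"
    using assms termdiff_converges[of x 1 "\<lambda>_. 1"] by (auto simp: diffs_def)
  then have "Bseq (\<lambda>n. real (Suc n) * x ^ n)"
    by (intro convergent_imp_Bseq convergentI[OF summable_LIMSEQ_zero])
  then obtain K where "\<And>n. norm (real (Suc n) * x ^ n) \<le> K"
    by (auto simp: Bseq_def)
  then show ?thesis
    by (intro that[of "max 1 K"]) (force simp: abs_le_iff le_max_iff_disj)+
qed

text \<open>Only the finitely many primes with \<open>p powr (- 2 * \<delta>) > 1/2\<close> contribute to the constant.\<close>

lemma dirichlet_hypercontractive:
  fixes \<delta> :: real
  assumes \<delta>: "0 < \<delta>"
  obtains C where "1 \<le> C"
    "\<And>q a. 0 < q \<Longrightarrow> dirichlet_polynomial a \<Longrightarrow>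
      (LINT z|torus_measure. cmod (bohr_polynomial (\<lambda>n. a n * of_real (real n powr - \<delta>)) z) powr (2 * q)) \<le>
      C * (LINT z|torus_measure. cmod (bohr_polynomial a z) powr q)\<^sup>2"
proof -
  define r where "r j = real (nth_prime j) powr - \<delta>" for j
  have p: "2 \<le> nth_prime j" for j
    using prime_nth_prime by (simp add: prime_ge_2_nat)
  have r: "0 \<le> r j" "r j < 1" for j
    using p[of j] \<delta> by (auto simp: r_def powr_minus inverse_less_1_iff intro!: gr_one_powr)
  have "\<exists>c. 1 \<le> c \<and> (\<forall>n. real (Suc n) * ((r j)\<^sup>2) ^ n \<le> c)" for j
    using weight_bound_exists[of "(r j)\<^sup>2"] r[of j] by (metis power_less_one_iff zero_le_power2 pos2)
  then obtain c where c: "\<And>j. 1 \<le> c j" "\<And>j n. real (Suc n) * ((r j)\<^sup>2) ^ n \<le> c j"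
    by metis
  define J0 where "J0 = {j. 1 / 2 < real (nth_prime j) powr - (2 * \<delta>)}"
  have J0: "finite J0"
    unfolding J0_def using \<delta> by (intro nth_prime_decay) auto
  have r2: "(r j)\<^sup>2 = real (nth_prime j) powr - (2 * \<delta>)" for j
    by (simp add: r_def power2_eq_square powr_add[symmetric])
  define C where "C j = (if j \<in> J0 then c j else 1)" for j
  have C: "real (Suc n) * ((r j)\<^sup>2) ^ n \<le> C j" for j n
  proof (cases "j \<in> J0")
    case False
    then have "((r j)\<^sup>2) ^ n \<le> (1 / 2) ^ n"
      unfolding J0_def r2 by (intro power_mono) auto
    then have "real (Suc n) * ((r j)\<^sup>2) ^ n \<le> real (Suc n) * (1 / 2) ^ n"
      by (intro mult_left_mono) auto
    also have "\<dots> \<le> C j"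
      using False by (simp only: C_def if_False weight_bound_half)
    finally show ?thesis .
  qed (simp only: C_def c if_True)
  show ?thesis
  proof (rule that)
    show "1 \<le> (\<Prod>j\<in>J0. c j)"
      using c by (intro prod_ge_1) auto
    fix q a assume q: "0 < (q::real)" and a: "dirichlet_polynomial a"
    define S where "S = {n. 1 \<le> n \<and> a n \<noteq> 0}"
    have S: "finite S" "0 \<notin> S" "\<And>n. 1 \<le> n \<Longrightarrow> a n \<noteq> 0 \<Longrightarrow> n \<in> S"
      using finite_support[OF a] by (auto simp: S_def)
    define J where "J = (\<Union>n\<in>S. {j. kappa n j \<noteq> 0})"
    have J: "finite J"
      unfolding J_def by (intro finite_UN_I S finite_kappa) (simp add: S_def)
    have sup: "j \<in> J" if "n \<in> S" "kappa n j \<noteq> 0" for n j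
      using that by (auto simp: J_def)
    let ?r = "\<lambda>j. if j \<in> J then complex_of_real (r j) else 1"
    have eq: "torus_poly S a kappa (\<lambda>j. ?r j * z j) = bohr_polynomial (\<lambda>n. a n * of_real (real n powr - \<delta>)) z" for z
    proof -
      have "bohr_polynomial (\<lambda>n. a n * of_real (real n powr - \<delta>)) z = (\<Sum>n\<in>S. a n * of_real (real n powr - \<delta>) * dchar n z)"
        using S by (intro bohr_polynomial_eq_sum) auto
      also have "\<dots> = (\<Sum>n\<in>S. a n * monomial (kappa n) (\<lambda>j. ?r j * z j))"
      proof (rule sum.cong[OF refl])
        fix n assume n: "n \<in> S"
        have "monomial (kappa n) ?r = monomial (kappa n) (\<lambda>j. of_nat (nth_prime j) powr - of_real \<delta>)"
          unfolding monomial_def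
        proof (intro prod.cong refl)
          fix j assume "j \<in> {j. kappa n j \<noteq> 0}"
          then have "j \<in> J" using sup n by auto
          then show "?r j ^ kappa n j = (of_nat (nth_prime j) powr - of_real \<delta>) ^ kappa n j"
            using powr_of_real[of "real (nth_prime j)" "- \<delta>"] by (simp add: r_def)
        qed
        also have "\<dots> = of_nat n powr - of_real \<delta>"
          using dchar_powr[of n "- of_real \<delta>"] n by (simp add: dchar_def S_def)
        also have "\<dots> = of_real (real n powr - \<delta>)"
          using powr_of_real[of "real n" "- \<delta>"] by simp
        finally show "a n * of_real (real n powr - \<delta>) * dchar n z = a n * monomial (kappa n) (\<lambda>j. ?r j * z j)"
          by (simp add: monomial_scale dchar_def)
      qed
      finally show ?thesis
        by (simp add: torus_poly_def)
    qed
    have eq0: "torus_poly S a kappa z = bohr_polynomial a z" for z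
      using bohr_polynomial_eq_sum[OF S] by (simp add: torus_poly_def dchar_def)
    have "(LINT z|torus_measure. cmod (torus_poly S a kappa (\<lambda>j. ?r j * z j)) powr (2 * q)) \<le>
      (\<Prod>j\<in>J. C j) * (LINT z|torus_measure. cmod (torus_poly S a kappa z) powr q)\<^sup>2"
      using q r C J sup by (rule torus_hypercontractive)
    then have "(LINT z|torus_measure. cmod (bohr_polynomial (\<lambda>n. a n * of_real (real n powr - \<delta>)) z) powr (2 * q)) \<le>
      (\<Prod>j\<in>J. C j) * (LINT z|torus_measure. cmod (bohr_polynomial a z) powr q)\<^sup>2"
      unfolding eq eq0 .
    \<comment> \<open>\<open>J\<close> depends on the polynomial, \<open>J0\<close> does not.
      Factors outside \<open>J0\<close> are 1, and those of \<open>J0\<close> missing from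
      \<open>J\<close> are at least 1.\<close>
    also have "(\<Prod>j\<in>J. C j) \<le> (\<Prod>j\<in>J0. c j)"
    proof -
      have "(\<Prod>j\<in>J. C j) = (\<Prod>j\<in>J \<inter> J0. c j)"
        using J by (simp add: C_def prod.inter_restrict)
      also have "\<dots> \<le> (\<Prod>j\<in>J0. c j)"
        using J0 c by (intro prod_mono2) (auto intro: order_trans[OF zero_le_one])
      finally show ?thesis .
    qed
    finally show "(LINT z|torus_measure. cmod (bohr_polynomial (\<lambda>n. a n * of_real (real n powr - \<delta>)) z) powr (2 * q)) \<le>
      (\<Prod>j\<in>J0. c j) * (LINT z|torus_measure. cmod (bohr_polynomial a z) powr q)\<^sup>2"
      by (simp add: mult_right_mono)
  qed
qed

section \<open>Coefficient bounds\<close>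

definition lp_fun :: "'a measure \<Rightarrow> real \<Rightarrow> ('a \<Rightarrow> complex) \<Rightarrow> bool" where
  "lp_fun M p F \<longleftrightarrow> F \<in> borel_measurable M \<and> integrable M (\<lambda>z. cmod (F z) powr p)"

lemma cmod_add_powr:
  assumes "0 < p"
  shows "cmod (x + y) powr p \<le> 2 powr p * (cmod x powr p + cmod y powr p)"
proof -
  have "cmod (x + y) powr p \<le> (cmod x + cmod y) powr p"
    using assms by (intro powr_mono2 norm_triangle_ineq) auto
  then show ?thesis
    using powr_add_le[of "cmod x" "cmod y" p] assms by simp
qed

lemma lp_fun_add:
  assumes "0 < p" "lp_fun M p F" "lp_fun M p G"
  shows "lp_fun M p (\<lambda>z. F z + G z)"
    and "(LINT z|M. cmod (F z + G z) powr p) \<le> 2 powr p * ((LINT z|M. cmod (F z) powr p) + (LINT z|M. cmod (G z) powr p))"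
proof -
  have meas: "F \<in> borel_measurable M" "G \<in> borel_measurable M"
    and int: "integrable M (\<lambda>z. cmod (F z) powr p)" "integrable M (\<lambda>z. cmod (G z) powr p)"
    using assms by (auto simp: lp_fun_def)
  have int': "integrable M (\<lambda>z. 2 powr p * (cmod (F z) powr p + cmod (G z) powr p))"
    using int by simp
  have int_sum: "integrable M (\<lambda>z. cmod (F z + G z) powr p)"
    using int' by (rule Bochner_Integration.integrable_bound) (use meas cmod_add_powr[OF assms(1)] in auto)
  then show "lp_fun M p (\<lambda>z. F z + G z)"
    using meas by (simp add: lp_fun_def)
  have "(LINT z|M. cmod (F z + G z) powr p) \<le> (LINT z|M. 2 powr p * (cmod (F z) powr p + cmod (G z) powr p))"
    using int_sum int' cmod_add_powr[OF assms(1)] by (intro Bochner_Integration.integral_mono) auto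
  then show "(LINT z|M. cmod (F z + G z) powr p) \<le> 2 powr p * ((LINT z|M. cmod (F z) powr p) + (LINT z|M. cmod (G z) powr p))"
    using int by simp
qed

lemma lp_fun_uminus: "lp_fun M p F \<Longrightarrow> lp_fun M p (\<lambda>z. - F z)"
  by (simp add: lp_fun_def)

lemma lp_fun_diff:
  assumes "0 < p" "lp_fun M p F" "lp_fun M p G"
  shows "lp_fun M p (\<lambda>z. F z - G z)"
    and "(LINT z|M. cmod (F z - G z) powr p) \<le> 2 powr p * ((LINT z|M. cmod (F z) powr p) + (LINT z|M. cmod (G z) powr p))"
  using lp_fun_add[OF assms(1,2) lp_fun_uminus[OF assms(3)]] by simp_all

text \<open>Comparison of exponents with a factor 2: x^q \<le> \<eta>^q + \<eta>^(q-p) x^p holds by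
  splitting at x = \<eta>, and \<eta> = A^(1/p), with A the mean of order p, balances the two terms
  after integration. If A = 0, \<eta> is made arbitrarily small.\<close>

lemma (in prob_space) lp_fun_lower_exponent:
  assumes q: "0 < q" "q \<le> p" and F: "lp_fun M p F"
  shows "lp_fun M q F"
    and "(LINT z|M. cmod (F z) powr q) \<le> 2 * (LINT z|M. cmod (F z) powr p) powr (q / p)"
proof -
  have meas: "F \<in> borel_measurable M" and int: "integrable M (\<lambda>z. cmod (F z) powr p)"
    using F by (auto simp: lp_fun_def)
  have young: "x powr q \<le> \<eta> powr q + \<eta> powr (q - p) * x powr p" if "0 < \<eta>" "0 \<le> x" for x \<eta> :: real
  proof (cases "x \<le> \<eta>")
    case True
    then have "x powr q \<le> \<eta> powr q"
      using q that by (intro powr_mono2) auto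
    then show ?thesis
      by (simp add: add_increasing2)
  next
    case False
    then have "x powr (q - p) \<le> \<eta> powr (q - p)"
      using q that by (intro powr_mono2') auto
    then have "x powr (q - p) * x powr p \<le> \<eta> powr (q - p) * x powr p"
      by (intro mult_right_mono) auto
    then show ?thesis
      using False that by (simp add: powr_add[symmetric] add_increasing)
  qed
  have int': "integrable M (\<lambda>z. \<eta> powr q + \<eta> powr (q - p) * cmod (F z) powr p)" for \<eta>
    using int by simp
  have intq: "integrable M (\<lambda>z. cmod (F z) powr q)"
    by (rule Bochner_Integration.integrable_bound[OF int'[of 1]]) (use meas young[of 1] in auto)
  then show "lp_fun M q F"
    using meas by (simp add: lp_fun_def)
  have bound: "(LINT z|M. cmod (F z) powr q) \<le> \<eta> powr q + \<eta> powr (q - p) * (LINT z|M. cmod (F z) powr p)" if "0 < \<eta>" for \<eta>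
  proof -
    have "(LINT z|M. cmod (F z) powr q) \<le> (LINT z|M. \<eta> powr q + \<eta> powr (q - p) * cmod (F z) powr p)"
      using intq int' young that by (intro Bochner_Integration.integral_mono) auto
    then show ?thesis
      using int by (simp add: prob_space)
  qed
  define A where "A = (LINT z|M. cmod (F z) powr p)"
  have A: "0 \<le> A"
    unfolding A_def by (intro Bochner_Integration.integral_nonneg) auto
  show "(LINT z|M. cmod (F z) powr q) \<le> 2 * (LINT z|M. cmod (F z) powr p) powr (q / p)"
  proof (cases "A = 0")
    case False
    define \<eta> where "\<eta> = A powr (1 / p)"
    have "\<eta> powr q + \<eta> powr (q - p) * A = A powr (q / p) + A powr ((q - p) / p) * A powr 1"
      using A False by (simp add: \<eta>_def powr_powr)
    also have "\<dots> = 2 * A powr (q / p)"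
      unfolding powr_add[symmetric] using q by (simp add: diff_divide_distrib)
    finally show ?thesis
      using bound[of \<eta>] A False by (simp add: \<eta>_def A_def)
  next
    case True
    have "(LINT z|M. cmod (F z) powr q) \<le> 0"
    proof (rule field_le_epsilon)
      fix e :: real assume "0 < e"
      then show "(LINT z|M. cmod (F z) powr q) \<le> 0 + e"
        using bound[of "e powr (1 / q)"] True q by (simp add: A_def powr_powr)
    qed
    then show ?thesis
      using True by (simp add: A_def)
  qed
qed

text \<open>The weight (2^p)^k forces the increments to decay like 2^(-k), so they are absolutely
  summable, whatever p > 0 is.\<close>

lemma fast_cauchy_convergent:
  fixes u :: "nat \<Rightarrow> complex"
  assumes p: "0 < p" and B: "\<And>k. (2 powr p) ^ k * cmod (u (Suc k) - u k) powr p \<le> B"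
  shows "convergent u"
proof -
  have B0: "0 \<le> B"
    using B[of 0] by (simp add: order_trans[OF powr_ge_zero])
  have step: "cmod (u (Suc k) - u k) \<le> B powr (1 / p) * (1 / 2) ^ k" for k
  proof -
    have "cmod (u (Suc k) - u k) powr p \<le> B / (2 powr p) ^ k"
      using B[of k] by (simp add: field_simps)
    then have "(cmod (u (Suc k) - u k) powr p) powr (1 / p) \<le> (B / (2 powr p) ^ k) powr (1 / p)"
      using p by (intro powr_mono2) auto
    also have "(2 powr p) ^ k = 2 powr (p * real k)"
      using powr_realpow[of "2 powr p" k] by (simp add: powr_powr)
    also have "(B / 2 powr (p * real k)) powr (1 / p) = B powr (1 / p) / 2 powr real k"
      using p B0 by (simp add: powr_divide powr_powr)
    also have "\<dots> = B powr (1 / p) * (1 / 2) ^ k"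
      by (simp add: powr_realpow power_divide)
    finally show ?thesis
      using p by (simp add: powr_powr)
  qed
  have "summable (\<lambda>k. B powr (1 / p) * (1 / 2) ^ k :: real)"
    by (intro summable_mult summable_geometric) auto
  then have "summable (\<lambda>k. u (Suc k) - u k)"
    by (rule summable_comparison_test') (rule step)
  then have "(\<lambda>n. \<Sum>k<n. u (Suc k) - u k) \<longlonglongrightarrow> suminf (\<lambda>k. u (Suc k) - u k)"
    by (rule summable_LIMSEQ)
  then have "(\<lambda>n. (u n - u 0) + u 0) \<longlonglongrightarrow> suminf (\<lambda>k. u (Suc k) - u k) + u 0"
    unfolding sum_lessThan_telescope by (intro tendsto_intros)
  then show ?thesis
    by (auto simp: convergent_def)
qed

text \<open>Riesz--Fischer for every p > 0. For p < 1 there is no norm in which to sum increments,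
  so a subsequence is chosen whose weighted p-th powers of increments have a finite sum almost
  everywhere. This gives pointwise convergence, and Fatou upgrades it to convergence in the
  mean.\<close>

lemma lp_complete:
  fixes Q :: "nat \<Rightarrow> 'a \<Rightarrow> complex"
  assumes p: "0 < p" and Q: "\<And>k. lp_fun M p (Q k)"
    and cauchy: "\<And>e. 0 < e \<Longrightarrow> \<exists>K. \<forall>k\<ge>K. \<forall>l\<ge>K. (LINT z|M. cmod (Q k z - Q l z) powr p) \<le> e"
  obtains H where "lp_fun M p H" "(\<lambda>k. LINT z|M. cmod (H z - Q k z) powr p) \<longlonglongrightarrow> 0"
proof -
  have meas[measurable]: "Q k \<in> borel_measurable M" for k
    using Q by (simp add: lp_fun_def)
  have diff_int: "integrable M (\<lambda>z. cmod (Q k z - Q l z) powr p)" for k l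
    using lp_fun_diff(1)[OF p Q Q] by (simp add: lp_fun_def)
  \<comment> \<open>The factor 2^(-k) makes the integrals summable, the divisor (2^p)^k pays for the
    weight in \<open>w\<close>.\<close>
  define \<epsilon> where "\<epsilon> k = (1 / 2) ^ k / (2 powr p) ^ k" for k :: nat
  have "\<exists>K. \<forall>k. \<forall>i\<ge>K k. \<forall>j\<ge>K k. (LINT z|M. cmod (Q i z - Q j z) powr p) \<le> \<epsilon> k"
    by (rule choice) (use cauchy in \<open>simp add: \<epsilon>_def\<close>)
  then obtain K where K: "\<And>k i j. K k \<le> i \<Longrightarrow> K k \<le> j \<Longrightarrow> (LINT z|M. cmod (Q i z - Q j z) powr p) \<le> \<epsilon> k"
    by blast
  \<comment> \<open>Accumulating the thresholds keeps the index above \<open>K k\<close> and makes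
    it increasing.\<close>
  define r where "r k = k + (\<Sum>i\<le>k. K i)" for k
  have rK: "K k \<le> r k" for k
    using member_le_sum[of k "{..k}" K] by (simp add: r_def)
  have r_mono: "r k \<le> r (Suc k)" for k
    by (simp add: r_def)
  have r_ge: "k \<le> r k" for k
    by (simp add: r_def)
  define w where "w k z = (2 powr p) ^ k * cmod (Q (r (Suc k)) z - Q (r k) z) powr p" for k z
  have w_nonneg: "0 \<le> w k z" for k z
    by (simp add: w_def)
  have w_int: "integrable M (w k)" for k
    unfolding w_def using diff_int by simp
  have w_le: "(LINT z|M. w k z) \<le> (1 / 2) ^ k" for k
  proof -
    have "(LINT z|M. w k z) = (2 powr p) ^ k * (LINT z|M. cmod (Q (r (Suc k)) z - Q (r k) z) powr p)"
      by (simp add: w_def)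
    also have "\<dots> \<le> (2 powr p) ^ k * \<epsilon> k"
      using rK[of k] r_mono[of k] by (intro mult_left_mono K) auto
    finally show ?thesis
      by (simp add: \<epsilon>_def)
  qed
  have "(\<integral>\<^sup>+ z. (\<Sum>k. ennreal (w k z)) \<partial>M) = (\<Sum>k. \<integral>\<^sup>+ z. ennreal (w k z) \<partial>M)"
    using w_int by (intro nn_integral_suminf) auto
  also have "\<dots> = (\<Sum>k. ennreal (LINT z|M. w k z))"
    using w_int w_nonneg by (intro suminf_cong nn_integral_eq_integral) auto
  also have "\<dots> \<le> (\<Sum>k. ennreal ((1 / 2) ^ k))"
    using w_le by (intro suminf_le ennreal_leI) auto
  also have "\<dots> = ennreal (\<Sum>k. (1 / 2) ^ k)"
    by (intro suminf_ennreal2 summable_geometric) auto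
  finally have fin: "(\<integral>\<^sup>+ z. (\<Sum>k. ennreal (w k z)) \<partial>M) < \<infinity>"
    by (rule order_le_less_trans) simp
  have conv: "AE z in M. convergent (\<lambda>k. Q (r k) z)"
  proof -
    have "AE z in M. (\<Sum>k. ennreal (w k z)) \<noteq> \<infinity>"
      using fin w_int by (intro nn_integral_PInf_AE) auto
    then show ?thesis
    proof eventually_elim
      fix z assume "(\<Sum>k. ennreal (w k z)) \<noteq> \<infinity>"
      then obtain B where B: "0 \<le> B" "(\<Sum>k. ennreal (w k z)) = ennreal B"
        by (cases "\<Sum>k. ennreal (w k z)" rule: ennreal_cases) auto
      have "w k z \<le> B" for k
      proof -
        have "ennreal (w k z) \<le> (\<Sum>k. ennreal (w k z))"
          using sum_le_suminf[of "\<lambda>k. ennreal (w k z)" "{k}"] by simp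
        then show ?thesis
          using B by (simp add: ennreal_le_iff)
      qed
      then show "convergent (\<lambda>k. Q (r k) z)"
        unfolding w_def by (intro fast_cauchy_convergent[OF p])
    qed
  qed
  define H where "H z = lim (\<lambda>k. Q (r k) z)" for z
  have H[measurable]: "H \<in> borel_measurable M"
    unfolding H_def by (rule borel_measurable_lim_metric) measurable
  have lim: "AE z in M. (\<lambda>k. Q (r k) z) \<longlonglongrightarrow> H z"
    using conv by eventually_elim (simp add: H_def convergent_LIMSEQ_iff)
  have fatou: "integrable M (\<lambda>z. cmod (H z - Q k z) powr p) \<and> (LINT z|M. cmod (H z - Q k z) powr p) \<le> e"
    if e: "0 < e" and k: "N \<le> k" and N: "\<And>i j. N \<le> i \<Longrightarrow> N \<le> j \<Longrightarrow> (LINT z|M. cmod (Q i z - Q j z) powr p) \<le> e" for e k N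
  proof -
    have "(\<integral>\<^sup>+ z. ennreal (cmod (H z - Q k z) powr p) \<partial>M) \<le> (\<integral>\<^sup>+ z. liminf (\<lambda>l. ennreal (cmod (Q (r l) z - Q k z) powr p)) \<partial>M)"
    proof (rule nn_integral_mono_AE)
      show "AE z in M. ennreal (cmod (H z - Q k z) powr p) \<le> liminf (\<lambda>l. ennreal (cmod (Q (r l) z - Q k z) powr p))"
        using lim
      proof eventually_elim
        fix z assume "(\<lambda>k. Q (r k) z) \<longlonglongrightarrow> H z"
        then have "(\<lambda>l. cmod (Q (r l) z - Q k z) powr p) \<longlonglongrightarrow> cmod (H z - Q k z) powr p"
          using p by (intro tendsto_powr' tendsto_intros) auto
        then have "(\<lambda>l. ennreal (cmod (Q (r l) z - Q k z) powr p)) \<longlonglongrightarrow> ennreal (cmod (H z - Q k z) powr p)"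
          by (intro tendsto_ennrealI)
        from lim_imp_Liminf[OF sequentially_bot this]
        show "ennreal (cmod (H z - Q k z) powr p) \<le> liminf (\<lambda>l. ennreal (cmod (Q (r l) z - Q k z) powr p))"
          by simp
      qed
    qed
    also have "\<dots> \<le> liminf (\<lambda>l. \<integral>\<^sup>+ z. ennreal (cmod (Q (r l) z - Q k z) powr p) \<partial>M)"
      by (intro nn_integral_liminf) measurable
    also have "\<dots> \<le> liminf (\<lambda>l. ennreal e)"
    proof (rule Liminf_mono)
      show "\<forall>\<^sub>F l in sequentially. (\<integral>\<^sup>+ z. ennreal (cmod (Q (r l) z - Q k z) powr p) \<partial>M) \<le> ennreal e"
        using eventually_ge_at_top[of N]
      proof eventually_elim
        fix l assume "N \<le> l"
        then have "(LINT z|M. cmod (Q (r l) z - Q k z) powr p) \<le> e"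
          using r_ge[of l] k by (intro N) auto
        then show "(\<integral>\<^sup>+ z. ennreal (cmod (Q (r l) z - Q k z) powr p) \<partial>M) \<le> ennreal e"
          using diff_int by (subst nn_integral_eq_integral) (auto intro: ennreal_leI)
      qed
    qed
    also have "\<dots> = ennreal e"
      by (simp add: Liminf_const)
    finally have le: "(\<integral>\<^sup>+ z. ennreal (cmod (H z - Q k z) powr p) \<partial>M) \<le> ennreal e" .
    then have "integrable M (\<lambda>z. cmod (H z - Q k z) powr p)"
      by (intro integrableI_nonneg) (auto intro: order_le_less_trans)
    then show ?thesis
      using le e by (simp add: nn_integral_eq_integral)
  qed
  have tendsto: "(\<lambda>k. LINT z|M. cmod (H z - Q k z) powr p) \<longlonglongrightarrow> 0"
  proof (rule LIMSEQ_I)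
    fix e :: real assume e: "0 < e"
    then obtain N where N: "\<And>i j. N \<le> i \<Longrightarrow> N \<le> j \<Longrightarrow> (LINT z|M. cmod (Q i z - Q j z) powr p) \<le> e / 2"
      using cauchy[of "e / 2"] by auto
    have "norm ((LINT z|M. cmod (H z - Q k z) powr p) - 0) < e" if "N \<le> k" for k
    proof -
      have "(LINT z|M. cmod (H z - Q k z) powr p) \<le> e / 2"
        using fatou[of "e / 2" N k] e that N by auto
      moreover have "0 \<le> (LINT z|M. cmod (H z - Q k z) powr p)"
        by (intro Bochner_Integration.integral_nonneg) auto
      ultimately show ?thesis using e by simp
    qed
    then show "\<exists>N. \<forall>k\<ge>N. norm ((LINT z|M. cmod (H z - Q k z) powr p) - 0) < e"
      by blast
  qed
  obtain N where "\<And>i j. N \<le> i \<Longrightarrow> N \<le> j \<Longrightarrow> (LINT z|M. cmod (Q i z - Q j z) powr p) \<le> 1"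
    using cauchy[of 1] by auto
  then have "lp_fun M p (\<lambda>z. H z - Q N z)"
    using fatou[of 1 N N] by (simp add: lp_fun_def)
  from lp_fun_add(1)[OF p this Q[of N]] have "lp_fun M p H"
    by simp
  then show ?thesis
    using tendsto that by blast
qed

section \<open>Orthogonality of characters and square sums of coefficients\<close>

lemma lp_fun_bohr_polynomial:
  assumes "0 < p"
  shows "lp_fun torus_measure p (bohr_polynomial a)"
  unfolding lp_fun_def
proof
  show meas: "bohr_polynomial a \<in> borel_measurable torus_measure"
    unfolding bohr_polynomial_def by measurable
  define B where "B = (\<Sum>n\<in>{n. 1 \<le> n \<and> a n \<noteq> 0}. cmod (a n))"
  have "cmod (bohr_polynomial a z) \<le> B" if "z \<in> space torus_measure" for z
    unfolding bohr_polynomial_def B_def using that by (intro sum_norm_le) (simp add: norm_mult norm_monomial)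
  then show "integrable torus_measure (\<lambda>z. cmod (bohr_polynomial a z) powr p)"
    using assms meas by (intro torus.integrable_const_bound[where B = "B powr p"]) (auto intro!: powr_mono2)
qed

text \<open>For m \<noteq> n the flow at time pi / (ln m - ln n) multiplies the integrand by -1 and
  preserves the measure.\<close>

lemma integral_dchar: 
  assumes "1 \<le> m" "1 \<le> n"
  shows "(LINT z|torus_measure. dchar m z * cnj (dchar n z)) = (if m = n then 1 else 0)"
proof (cases "m = n")
  case True
  have "(LINT z|torus_measure. dchar m z * cnj (dchar n z)) = (LINT z|torus_measure. 1)"
    using True by (intro Bochner_Integration.integral_cong refl)
      (simp add: complex_norm_square[symmetric] norm_dchar del: of_real_power)
  then show ?thesis
    using True by (simp add: torus.prob_space)
next
  case False
  define \<theta> where "\<theta> = ln (real m) - ln (real n)"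
  have "\<theta> \<noteq> 0"
    using False assms by (simp add: \<theta>_def)
  define t where "t = pi / \<theta>"
  define f where "f z = dchar m z * cnj (dchar n z)" for z
  have cnj: "(\<lambda>z. cnj (dchar n z)) \<in> borel_measurable torus_measure"
  proof -
    have "cnj \<in> borel_measurable borel"
      by (intro borel_measurable_continuous_onI continuous_on_cnj continuous_on_id)
    then show ?thesis
      by (rule measurable_compose[OF measurable_dchar])
  qed
  have flow: "f (rot t z) = exp (- (\<i> * of_real (t * \<theta>))) * f z" for z
    using assms by (simp add: f_def dchar_rot_exp exp_cnj \<theta>_def exp_add[symmetric] exp_diff exp_minus algebra_simps divide_simps)
  have "exp (- (\<i> * of_real (t * \<theta>))) = - 1"
    using \<open>\<theta> \<noteq> 0\<close> by (simp add: t_def exp_minus)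
  then have "(LINT z|torus_measure. f (rot t z)) = - (LINT z|torus_measure. f z)"
    by (simp add: flow)
  moreover have "(LINT z|torus_measure. f (rot t z)) = (LINT z|torus_measure. f z)"
    unfolding f_def by (intro integral_rot borel_measurable_times measurable_dchar cnj)
  ultimately show ?thesis
    using False by (simp add: f_def)
qed

lemma bohr_parseval:
  assumes S: "finite S" "0 \<notin> S" "\<And>n. 1 \<le> n \<Longrightarrow> a n \<noteq> 0 \<Longrightarrow> n \<in> S"
  shows "(LINT z|torus_measure. (cmod (bohr_polynomial a z))\<^sup>2) = (\<Sum>n\<in>S. (cmod (a n))\<^sup>2)"
proof -
  have int: "integrable torus_measure (\<lambda>z. (a m * cnj (a n)) * (dchar m z * cnj (dchar n z)))" for m n
  proof -
    have "cnj \<in> borel_measurable borel"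
      by (intro borel_measurable_continuous_onI continuous_on_cnj continuous_on_id)
    then have "(\<lambda>z. cnj (dchar n z)) \<in> borel_measurable torus_measure"
      by (rule measurable_compose[OF measurable_dchar])
    then have "(\<lambda>z. dchar m z * cnj (dchar n z)) \<in> borel_measurable torus_measure"
      by (rule borel_measurable_times[OF measurable_dchar])
    then have "integrable torus_measure (\<lambda>z. dchar m z * cnj (dchar n z))"
      by (intro torus.integrable_const_bound[where B = 1]) (auto simp: norm_mult norm_dchar)
    then show ?thesis by simp
  qed
  have pos: "1 \<le> n" if "n \<in> S" for n
    using S(2) that by (cases n) auto
  have "complex_of_real (LINT z|torus_measure. (cmod (bohr_polynomial a z))\<^sup>2) =
     (LINT z|torus_measure. of_real ((cmod (bohr_polynomial a z))\<^sup>2))"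
    by (simp only: integral_complex_of_real)
  also have "\<dots> = (LINT z|torus_measure. (\<Sum>m\<in>S. \<Sum>n\<in>S. (a m * cnj (a n)) * (dchar m z * cnj (dchar n z))))"
    unfolding complex_norm_square
    by (intro Bochner_Integration.integral_cong refl) (simp add: bohr_polynomial_eq_sum[OF S] sum_product mult_ac)
  also have "\<dots> = (\<Sum>m\<in>S. \<Sum>n\<in>S. (a m * cnj (a n)) * (LINT z|torus_measure. dchar m z * cnj (dchar n z)))"
    using int by (simp add: Bochner_Integration.integral_sum)
  also have "\<dots> = (\<Sum>m\<in>S. \<Sum>n\<in>S. (a m * cnj (a n)) * (if m = n then 1 else 0))"
    using pos by (intro sum.cong refl) (simp add: integral_dchar)
  also have "\<dots> = (\<Sum>m\<in>S. a m * cnj (a m))"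
    using S by (simp add: if_distrib sum.delta cong: if_cong)
  also have "\<dots> = of_real (\<Sum>n\<in>S. (cmod (a n))\<^sup>2)"
    by (simp only: of_real_sum complex_norm_square)
  finally show ?thesis
    by (simp only: of_real_eq_iff)
qed

lemma dirichlet_polynomial_diff:
  assumes "dirichlet_polynomial a" "dirichlet_polynomial b"
  shows "dirichlet_polynomial (\<lambda>n. a n - b n)"
  using assms unfolding dirichlet_polynomial_def
  by (rule finite_subset[OF _ finite_UnI, rotated]) auto

lemma dirichlet_polynomial_mult:
  assumes "dirichlet_polynomial a"
  shows "dirichlet_polynomial (\<lambda>n. a n * c n)"
  using assms unfolding dirichlet_polynomial_def by (rule rev_finite_subset) auto

lemma bohr_polynomial_diff:
  assumes "dirichlet_polynomial a" "dirichlet_polynomial b"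
  shows "bohr_polynomial (\<lambda>n. a n - b n) z = bohr_polynomial a z - bohr_polynomial b z"
proof -
  let ?S = "{n. 1 \<le> n \<and> a n \<noteq> 0} \<union> {n. 1 \<le> n \<and> b n \<noteq> 0}"
  have S: "finite ?S" "0 \<notin> ?S"
    using finite_support[OF assms(1)] finite_support[OF assms(2)] by auto
  have "bohr_polynomial (\<lambda>n. a n - b n) z = (\<Sum>n\<in>?S. (a n - b n) * dchar n z)"
    "bohr_polynomial a z = (\<Sum>n\<in>?S. a n * dchar n z)" "bohr_polynomial b z = (\<Sum>n\<in>?S. b n * dchar n z)"
    using S by (auto intro: bohr_polynomial_eq_sum)
  then show ?thesis
    by (simp add: left_diff_distrib sum_subtractf)
qed

lemma volterra_coeff_upto_diff:
  "volterra_coeff_upto N (\<lambda>n. a n - b n) n = volterra_coeff_upto N a n - volterra_coeff_upto N b n"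
  by (simp add: volterra_coeff_upto_def diff_divide_distrib sum_subtractf)

lemma iterated_hypercontractive:
  fixes \<delta> :: real
  assumes \<delta>: "0 < \<delta>" and p: "0 < p"
  shows "\<exists>C>0. \<forall>a. dirichlet_polynomial a \<longrightarrow>
    (LINT z|torus_measure. cmod (bohr_polynomial (\<lambda>n. a n * of_real (real n powr - (real k * \<delta>))) z) powr (2 ^ k * p)) \<le>
    C * (LINT z|torus_measure. cmod (bohr_polynomial a z) powr p) ^ (2 ^ k)"
proof (induction k)
  case 0
  have "bohr_polynomial (\<lambda>n. a n * of_real (real n powr - (real 0 * \<delta>))) z = bohr_polynomial a z"
    if "dirichlet_polynomial a" for a z
    using finite_support[OF that]
    by (subst (1 2) bohr_polynomial_eq_sum[where S = "{n. 1 \<le> n \<and> a n \<noteq> 0}"]) auto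
  then show ?case
    by (intro exI[of _ 1]) simp
next
  case (Suc k)
  then obtain C where C: "0 < C" "\<And>a. dirichlet_polynomial a \<Longrightarrow>
    (LINT z|torus_measure. cmod (bohr_polynomial (\<lambda>n. a n * of_real (real n powr - (real k * \<delta>))) z) powr (2 ^ k * p)) \<le>
    C * (LINT z|torus_measure. cmod (bohr_polynomial a z) powr p) ^ (2 ^ k)" by blast
  obtain D where D: "1 \<le> D" "\<And>q a. 0 < q \<Longrightarrow> dirichlet_polynomial a \<Longrightarrow>
      (LINT z|torus_measure. cmod (bohr_polynomial (\<lambda>n. a n * of_real (real n powr - \<delta>)) z) powr (2 * q)) \<le>
      D * (LINT z|torus_measure. cmod (bohr_polynomial a z) powr q)\<^sup>2"
    using dirichlet_hypercontractive[OF \<delta>] by blast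
  show ?case
  proof (intro exI conjI allI impI)
    show "0 < D * C\<^sup>2" using C D by simp
    fix a assume a: "dirichlet_polynomial a"
    let ?b = "\<lambda>n. a n * of_real (real n powr - (real k * \<delta>))"
    have b: "dirichlet_polynomial ?b"
      by (rule dirichlet_polynomial_mult[OF a])
    have "(\<lambda>n. a n * of_real (real n powr - (real (Suc k) * \<delta>))) = (\<lambda>n. ?b n * of_real (real n powr - \<delta>))"
      by (auto simp: fun_eq_iff algebra_simps powr_add[symmetric] simp flip: of_real_mult)
    then have "(LINT z|torus_measure. cmod (bohr_polynomial (\<lambda>n. a n * of_real (real n powr - (real (Suc k) * \<delta>))) z) powr (2 ^ Suc k * p)) =
      (LINT z|torus_measure. cmod (bohr_polynomial (\<lambda>n. ?b n * of_real (real n powr - \<delta>)) z) powr (2 * (2 ^ k * p)))"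
      by (simp only: power_Suc mult.assoc)
    also have "\<dots> \<le> D * (LINT z|torus_measure. cmod (bohr_polynomial ?b z) powr (2 ^ k * p))\<^sup>2"
      using p b by (intro D) auto
    also have "\<dots> \<le> D * (C * (LINT z|torus_measure. cmod (bohr_polynomial a z) powr p) ^ (2 ^ k))\<^sup>2"
      using D(1) C(2)[OF a] by (intro mult_left_mono power_mono Bochner_Integration.integral_nonneg) auto
    also have "\<dots> = D * C\<^sup>2 * (LINT z|torus_measure. cmod (bohr_polynomial a z) powr p) ^ (2 ^ Suc k)"
      by (simp add: power_mult_distrib power_mult[symmetric] mult.commute)
    finally show "(LINT z|torus_measure. cmod (bohr_polynomial (\<lambda>n. a n * of_real (real n powr - (real (Suc k) * \<delta>))) z) powr (2 ^ Suc k * p)) \<le>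
      D * C\<^sup>2 * (LINT z|torus_measure. cmod (bohr_polynomial a z) powr p) ^ (2 ^ Suc k)" .
  qed
qed

text \<open>The exponent is doubled until it is at least 2; below it lies the exponent 2, where
  Parseval turns the mean into the sum of squares. Homogeneity survives: the power 2^(k+1) of the
  mean, taken to the power 2 / (2^(k+1) p), is the power 2 / p.\<close>

lemma weighted_coefficient_bound:
  fixes \<delta> p :: real
  assumes \<delta>: "0 < \<delta>" and p: "0 < p"
  obtains C where "0 < C" "\<And>a S. dirichlet_polynomial a \<Longrightarrow> finite S \<Longrightarrow> 0 \<notin> S \<Longrightarrow>
    (\<Sum>n\<in>S. (cmod (a n))\<^sup>2 * real n powr - (2 * \<delta>)) \<le>
    C * (LINT z|torus_measure. cmod (bohr_polynomial a z) powr p) powr (2 / p)"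
proof -
  obtain k :: nat where k: "2 / p < 2 ^ k"
    using real_arch_pow[of 2 "2 / p"] by auto
  \<comment> \<open>The available translation is divided evenly among the k + 1 doublings.\<close>
  define \<delta>' where "\<delta>' = \<delta> / real (Suc k)"
  have k': "2 \<le> 2 ^ Suc k * p"
    using k p by (simp add: field_simps)
  have \<delta>': "0 < \<delta>'" "real (Suc k) * \<delta>' = \<delta>"
    using \<delta> by (simp_all add: \<delta>'_def)
  obtain C where C: "0 < C" "\<And>a. dirichlet_polynomial a \<Longrightarrow>
    (LINT z|torus_measure. cmod (bohr_polynomial (\<lambda>n. a n * of_real (real n powr - \<delta>)) z) powr (2 ^ Suc k * p)) \<le>
    C * (LINT z|torus_measure. cmod (bohr_polynomial a z) powr p) ^ (2 ^ Suc k)"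
    using iterated_hypercontractive[OF \<delta>'(1) p, of "Suc k"] unfolding \<delta>'(2) by blast
  let ?P = "2 ^ Suc k * p"
  show ?thesis
  proof (rule that)
    show "0 < 2 * C powr (2 / ?P)" using C by simp
    fix a and S :: "nat set" assume a: "dirichlet_polynomial a" and S: "finite S" "0 \<notin> S"
    define b where "b n = a n * of_real (real n powr - \<delta>)" for n
    have b: "dirichlet_polynomial b"
      unfolding b_def by (rule dirichlet_polynomial_mult[OF a])
    define T where "T = S \<union> {n. 1 \<le> n \<and> b n \<noteq> 0}"
    have T: "finite T" "0 \<notin> T" "\<And>n. 1 \<le> n \<Longrightarrow> b n \<noteq> 0 \<Longrightarrow> n \<in> T"
      using S finite_support[OF b] by (auto simp: T_def)
    define I where "I = (LINT z|torus_measure. cmod (bohr_polynomial a z) powr p)"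
    have I: "0 \<le> I"
      unfolding I_def by (intro Bochner_Integration.integral_nonneg) auto
    have "(\<Sum>n\<in>S. (cmod (a n))\<^sup>2 * real n powr - (2 * \<delta>)) = (\<Sum>n\<in>S. (cmod (b n))\<^sup>2)"
      by (simp add: b_def norm_mult power_mult_distrib powr_square)
    also have "\<dots> \<le> (\<Sum>n\<in>T. (cmod (b n))\<^sup>2)"
      using T by (intro sum_mono2) (auto simp: T_def)
    also have "\<dots> = (LINT z|torus_measure. (cmod (bohr_polynomial b z))\<^sup>2)"
      using bohr_parseval[OF T] by simp
    also have "\<dots> = (LINT z|torus_measure. cmod (bohr_polynomial b z) powr 2)"
      by simp
    also have "\<dots> \<le> 2 * (LINT z|torus_measure. cmod (bohr_polynomial b z) powr ?P) powr (2 / ?P)"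
      using k' p by (intro torus.lp_fun_lower_exponent(2) lp_fun_bohr_polynomial) auto
    also have "\<dots> \<le> 2 * (C * I ^ (2 ^ Suc k)) powr (2 / ?P)"
      using C(2)[OF a] p unfolding b_def I_def
      by (intro mult_left_mono powr_mono2 Bochner_Integration.integral_nonneg) auto
    also have "(C * I ^ (2 ^ Suc k)) powr (2 / ?P) = C powr (2 / ?P) * I powr (2 / p)"
    proof (cases "I = 0")
      case False
      then have "I ^ (2 ^ Suc k) = I powr (2 ^ Suc k)"
        using I powr_realpow[of I "2 ^ Suc k"] by simp
      then show ?thesis
        using C I by (simp add: powr_mult powr_powr)
    qed (use p in simp)
    finally show "(\<Sum>n\<in>S. (cmod (a n))\<^sup>2 * real n powr - (2 * \<delta>)) \<le>
       2 * C powr (2 / ?P) * (LINT z|torus_measure. cmod (bohr_polynomial a z) powr p) powr (2 / p)"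
      by (simp add: I_def)
  qed
qed

section \<open>Uniqueness of Bohr lifts and truncations of the operator\<close>

lemma lp_functional_tendsto_0_iff:
  assumes p: "0 < p"
  shows "(\<lambda>k. lp_functional p (G k)) \<longlonglongrightarrow> 0 \<longleftrightarrow> (\<lambda>k. LINT z|torus_measure. cmod (G k z) powr p) \<longlonglongrightarrow> 0"
proof -
  define I where "I k = (LINT z|torus_measure. cmod (G k z) powr p)" for k
  have I: "0 \<le> I k" for k
    unfolding I_def by (intro Bochner_Integration.integral_nonneg) auto
  have "I \<longlonglongrightarrow> 0" if "(\<lambda>k. I k powr (1 / p)) \<longlonglongrightarrow> 0"
  proof -
    have "(\<lambda>k. (I k powr (1 / p)) powr p) \<longlonglongrightarrow> 0 powr p"
      using that p by (intro tendsto_powr') auto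
    then show ?thesis
      using p I by (simp add: powr_powr)
  qed
  moreover have "(\<lambda>k. I k powr (1 / p)) \<longlonglongrightarrow> 0" if "I \<longlonglongrightarrow> 0"
  proof -
    have "(\<lambda>k. I k powr (1 / p)) \<longlonglongrightarrow> 0 powr (1 / p)"
      using that p I by (intro tendsto_powr' tendsto_const) auto
    then show ?thesis by simp
  qed
  ultimately show ?thesis
    unfolding lp_functional_def I_def by blast
qed

lemma is_bohr_lift_iff:
  assumes "0 < p"
  shows "is_bohr_lift p f F \<longleftrightarrow> lp_fun torus_measure p F \<and>
    (\<exists>P. (\<forall>k. dirichlet_polynomial (P k)) \<and>
      (\<lambda>k. LINT z|torus_measure. cmod (F z - bohr_polynomial (P k) z) powr p) \<longlonglongrightarrow> 0 \<and>
      (\<forall>n\<ge>1. (\<lambda>k. P k n) \<longlonglongrightarrow> f n))"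
  unfolding is_bohr_lift_def lp_fun_def lp_functional_tendsto_0_iff[OF assms] by (simp only: conj_assoc)

lemma integral_cmod_powr_nonneg: "0 \<le> (LINT z|M. cmod (F z) powr p)"
  by (intro Bochner_Integration.integral_nonneg) auto

text \<open>On the torus the difference is at most the finite sum of |a n| |1 - n^(-\<tau>)|,
  uniformly in z.\<close>

lemma dilation_tendsto:
  assumes a: "dirichlet_polynomial a" and q: "0 < q" and e: "0 < e"
  obtains \<tau> where "0 < \<tau>"
    "(LINT z|torus_measure. cmod (bohr_polynomial a z - bohr_polynomial (\<lambda>n. a n * of_real (real n powr - \<tau>)) z) powr q) \<le> e"
proof -
  define S where "S = {n. 1 \<le> n \<and> a n \<noteq> 0}"
  have S: "finite S" "0 \<notin> S" "\<And>n. 1 \<le> n \<Longrightarrow> a n \<noteq> 0 \<Longrightarrow> n \<in> S"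
    using finite_support[OF a] by (auto simp: S_def)
  define t where "t m = 1 / real (Suc m)" for m
  define g where "g m = (\<Sum>n\<in>S. cmod (a n) * \<bar>1 - real n powr - t m\<bar>)" for m
  have t: "t \<longlonglongrightarrow> 0"
    unfolding t_def using LIMSEQ_Suc[OF lim_1_over_n] by simp
  have "g \<longlonglongrightarrow> (\<Sum>n\<in>S. cmod (a n) * \<bar>1 - real n powr - 0\<bar>)"
    unfolding g_def using S by (intro tendsto_intros t) (auto intro: gr0I)
  also have "(\<Sum>n\<in>S. cmod (a n) * \<bar>1 - real n powr - 0\<bar>) = 0"
    using S by (intro sum.neutral) (auto intro: gr0I)
  finally have "\<forall>\<^sub>F m in sequentially. g m < e powr (1 / q)"
    using e by (intro order_tendstoD(2)[of g 0]) auto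
  then obtain m where m: "g m < e powr (1 / q)"
    by (auto simp: eventually_sequentially)
  let ?b = "\<lambda>n. a n * of_real (real n powr - t m)"
  have b: "dirichlet_polynomial ?b"
    by (rule dirichlet_polynomial_mult[OF a])
  have bound: "cmod (bohr_polynomial a z - bohr_polynomial ?b z) powr q \<le> e" if z: "z \<in> space torus_measure" for z
  proof -
    have "bohr_polynomial a z = (\<Sum>n\<in>S. a n * dchar n z)" "bohr_polynomial ?b z = (\<Sum>n\<in>S. ?b n * dchar n z)"
      using S by (auto intro: bohr_polynomial_eq_sum)
    then have "bohr_polynomial a z - bohr_polynomial ?b z = (\<Sum>n\<in>S. a n * of_real (1 - real n powr - t m) * dchar n z)"
      by (simp add: sum_subtractf[symmetric] algebra_simps)
    also have "cmod \<dots> \<le> g m"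
      unfolding g_def using z by (intro sum_norm_le) (simp add: norm_mult norm_dchar del: of_real_diff)
    finally have "cmod (bohr_polynomial a z - bohr_polynomial ?b z) powr q \<le> (e powr (1 / q)) powr q"
      using m q by (intro powr_mono2) auto
    then show ?thesis
      using q e by (simp add: powr_powr)
  qed
  show ?thesis
  proof (rule that[of "t m"])
    show "0 < t m" by (simp add: t_def)
    have "lp_fun torus_measure q (\<lambda>z. bohr_polynomial a z - bohr_polynomial ?b z)"
      using q by (intro lp_fun_diff lp_fun_bohr_polynomial)
    then have "(LINT z|torus_measure. cmod (bohr_polynomial a z - bohr_polynomial ?b z) powr q) \<le> (LINT z|torus_measure. e)"
      using bound by (intro Bochner_Integration.integral_mono) (auto simp: lp_fun_def)
    then show "(LINT z|torus_measure. cmod (bohr_polynomial a z - bohr_polynomial ?b z) powr q) \<le> e"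
      by (simp add: torus.prob_space)
  qed
qed

text \<open>After a fixed translation \<tau> > 0 the coefficient bound makes the translated
  \<open>Q k\<close> tend to 0 in square mean. \<open>X\<close> is then linked to 0 by the chain X,
  Q l, translated Q l, translated Q k, 0 with four small gaps; the third gap is bounded by the
  distance of Q l and Q k, because translation is bounded.\<close>

lemma lift_of_zero_null:
  assumes p: "0 < p" and X: "lp_fun torus_measure p X" and Q: "\<And>k. dirichlet_polynomial (Q k)"
    and lim: "(\<lambda>k. LINT z|torus_measure. cmod (X z - bohr_polynomial (Q k) z) powr p) \<longlonglongrightarrow> 0"
    and coeff: "\<And>n. 1 \<le> n \<Longrightarrow> (\<lambda>k. Q k n) \<longlonglongrightarrow> 0"
  shows "AE z in torus_measure. X z = 0"
proof -
  \<comment> \<open>Means of order \<open>q\<close> are controlled both by those of order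
    \<open>p\<close>, in which Q k approximates X, and by those of order 2, where Parseval
    holds.\<close>
  define q where "q = min p 2"
  have q: "0 < q" "q \<le> p" "q \<le> 2"
    using p by (auto simp: q_def)
  define c where "c = 2 powr q"
  have c: "0 < c" by (simp add: c_def)
  have Xq: "lp_fun torus_measure q X"
    using q X by (intro torus.lp_fun_lower_exponent(1)[OF q(1,2)])
  note bq = lp_fun_bohr_polynomial[OF q(1)]
  define d where "d k = (LINT z|torus_measure. cmod (X z - bohr_polynomial (Q k) z) powr q)" for k
  have d_nonneg: "0 \<le> d k" for k
    unfolding d_def by (rule integral_cmod_powr_nonneg)
  have dlim: "d \<longlonglongrightarrow> 0"
  proof (rule tendsto_sandwich[OF _ _ tendsto_const])
    have "(\<lambda>k. 2 * (LINT z|torus_measure. cmod (X z - bohr_polynomial (Q k) z) powr p) powr (q / p)) \<longlonglongrightarrow> 2 * 0 powr (q / p)"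
      using lim q p by (intro tendsto_intros tendsto_powr') (auto intro: integral_cmod_powr_nonneg)
    then show "(\<lambda>k. 2 * (LINT z|torus_measure. cmod (X z - bohr_polynomial (Q k) z) powr p) powr (q / p)) \<longlonglongrightarrow> 0"
      by simp
    have "d k \<le> 2 * (LINT z|torus_measure. cmod (X z - bohr_polynomial (Q k) z) powr p) powr (q / p)" for k
      unfolding d_def using p X by (intro torus.lp_fun_lower_exponent(2)[OF q(1,2)] lp_fun_diff(1) lp_fun_bohr_polynomial)
    then show "\<forall>\<^sub>F k in sequentially. d k \<le> 2 * (LINT z|torus_measure. cmod (X z - bohr_polynomial (Q k) z) powr p) powr (q / p)"
      by simp
  qed (simp add: d_nonneg)
  have dd: "(LINT z|torus_measure. cmod (bohr_polynomial (\<lambda>n. Q k n - Q l n) z) powr q) \<le> c * (d l + d k)" for k l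
  proof -
    have "bohr_polynomial (\<lambda>n. Q k n - Q l n) z = (X z - bohr_polynomial (Q l) z) - (X z - bohr_polynomial (Q k) z)" for z
      by (simp add: bohr_polynomial_diff Q)
    then show ?thesis
      using lp_fun_diff(2)[OF q(1) lp_fun_diff(1)[OF q(1) Xq bq] lp_fun_diff(1)[OF q(1) Xq bq], of "Q l" "Q k"]
      by (simp add: d_def c_def)
  qed
  let ?dil = "\<lambda>\<tau> a n. a n * of_real (real n powr - \<tau>) :: complex"
  have dil_lim: "(\<lambda>k. LINT z|torus_measure. cmod (bohr_polynomial (?dil \<tau> (Q k)) z) powr q) \<longlonglongrightarrow> 0" if \<tau>: "0 < \<tau>" for \<tau>
  proof -
    obtain C where C: "0 < C" "\<And>a S. dirichlet_polynomial a \<Longrightarrow> finite S \<Longrightarrow> 0 \<notin> S \<Longrightarrow>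
      (\<Sum>n\<in>S. (cmod (a n))\<^sup>2 * real n powr - (2 * \<tau>)) \<le>
      C * (LINT z|torus_measure. cmod (bohr_polynomial a z) powr q) powr (2 / q)"
      using weighted_coefficient_bound[OF \<tau> q(1)] by blast
    \<comment> \<open>The coefficient bound is applied to Q k - Q m, and m tends to infinity: on the
      finite support of Q k the coefficients of Q m vanish in the limit, while the mean of the
      difference is controlled by \<open>d k\<close> and \<open>d m\<close>.\<close>
    have le: "(LINT z|torus_measure. cmod (bohr_polynomial (?dil \<tau> (Q k)) z) powr q) \<le> 2 * (C * (c * d k) powr (2 / q)) powr (q / 2)" for k
    proof -
      define S where "S = {n. 1 \<le> n \<and> Q k n \<noteq> 0}"
      have S: "finite S" "0 \<notin> S" "\<And>n. 1 \<le> n \<Longrightarrow> Q k n \<noteq> 0 \<Longrightarrow> n \<in> S"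
        using finite_support[OF Q] by (auto simp: S_def)
      have "(\<lambda>m. \<Sum>n\<in>S. (cmod (Q k n - Q m n))\<^sup>2 * real n powr - (2 * \<tau>)) \<longlonglongrightarrow> (\<Sum>n\<in>S. (cmod (Q k n - 0))\<^sup>2 * real n powr - (2 * \<tau>))"
        using S by (intro tendsto_intros coeff) (auto intro: Suc_leI gr0I)
      moreover have "(\<lambda>m. C * (c * (d m + d k)) powr (2 / q)) \<longlonglongrightarrow> C * (c * (0 + d k)) powr (2 / q)"
        using q c d_nonneg by (intro tendsto_intros tendsto_powr' dlim) auto
      moreover have "(\<Sum>n\<in>S. (cmod (Q k n - Q m n))\<^sup>2 * real n powr - (2 * \<tau>)) \<le> C * (c * (d m + d k)) powr (2 / q)" for m
      proof -
        have "(\<Sum>n\<in>S. (cmod (Q k n - Q m n))\<^sup>2 * real n powr - (2 * \<tau>)) \<le>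
           C * (LINT z|torus_measure. cmod (bohr_polynomial (\<lambda>n. Q k n - Q m n) z) powr q) powr (2 / q)"
          using S by (intro C dirichlet_polynomial_diff Q)
        also have "\<dots> \<le> C * (c * (d m + d k)) powr (2 / q)"
          using C q dd by (intro mult_left_mono powr_mono2 integral_cmod_powr_nonneg) auto
        finally show ?thesis .
      qed
      ultimately have "(\<Sum>n\<in>S. (cmod (Q k n - 0))\<^sup>2 * real n powr - (2 * \<tau>)) \<le> C * (c * (0 + d k)) powr (2 / q)"
        by (intro LIMSEQ_le) auto
      moreover have "(LINT z|torus_measure. cmod (bohr_polynomial (?dil \<tau> (Q k)) z) powr 2) = (\<Sum>n\<in>S. (cmod (Q k n))\<^sup>2 * real n powr - (2 * \<tau>))"
        using bohr_parseval[of S "?dil \<tau> (Q k)"] S by (simp add: norm_mult power_mult_distrib powr_square)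
      ultimately have "(LINT z|torus_measure. cmod (bohr_polynomial (?dil \<tau> (Q k)) z) powr 2) \<le> C * (c * d k) powr (2 / q)"
        by simp
      then have "2 * (LINT z|torus_measure. cmod (bohr_polynomial (?dil \<tau> (Q k)) z) powr 2) powr (q / 2) \<le> 2 * (C * (c * d k) powr (2 / q)) powr (q / 2)"
        using q by (intro mult_left_mono powr_mono2 integral_cmod_powr_nonneg) auto
      with torus.lp_fun_lower_exponent(2)[OF q(1,3) lp_fun_bohr_polynomial, of "?dil \<tau> (Q k)"] show ?thesis
        by simp
    qed
    have "(\<lambda>k. 2 * (C * (c * d k) powr (2 / q)) powr (q / 2)) \<longlonglongrightarrow> 2 * (C * (c * 0) powr (2 / q)) powr (q / 2)"
      using q c C d_nonneg by (intro tendsto_intros tendsto_powr' dlim) auto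
    then have "(\<lambda>k. 2 * (C * (c * d k) powr (2 / q)) powr (q / 2)) \<longlonglongrightarrow> 0"
      using q by simp
    then show ?thesis
      by (rule tendsto_sandwich[OF _ _ tendsto_const, rotated 2]) (use le in \<open>auto intro: integral_cmod_powr_nonneg\<close>)
  qed
  define M where "M = c * (c * 2 + c * (2 powr (q / 2) * (c * 2) + 1))"
  have small: "(LINT z|torus_measure. cmod (X z) powr q) \<le> M * e" if e: "0 < e" for e
  proof -
    have "\<forall>\<^sub>F k in sequentially. d k < e"
      by (rule order_tendstoD(2)[OF dlim e])
    \<comment> \<open>The order of choices matters: \<tau> depends on l, and k depends on
      \<tau>.\<close>
    then obtain l where l: "d l < e"
      by (auto simp: eventually_sequentially)
    obtain \<tau> where \<tau>: "0 < \<tau>" and dil: "(LINT z|torus_measure. cmod (bohr_polynomial (Q l) z - bohr_polynomial (?dil \<tau> (Q l)) z) powr q) \<le> e"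
      using dilation_tendsto[OF Q q(1) e] by blast
    have "\<forall>\<^sub>F k in sequentially. d k < e \<and> (LINT z|torus_measure. cmod (bohr_polynomial (?dil \<tau> (Q k)) z) powr q) < e"
      by (intro eventually_conj order_tendstoD(2)[OF dlim e] order_tendstoD(2)[OF dil_lim[OF \<tau>] e])
    then obtain k where k: "d k < e" "(LINT z|torus_measure. cmod (bohr_polynomial (?dil \<tau> (Q k)) z) powr q) < e"
      by (auto simp: eventually_sequentially)
    let ?Qlk = "\<lambda>n. Q l n - Q k n"
    let ?A = "\<lambda>z. X z - bohr_polynomial (Q l) z"
    let ?B = "\<lambda>z. bohr_polynomial (Q l) z - bohr_polynomial (?dil \<tau> (Q l)) z"
    let ?D = "bohr_polynomial (?dil \<tau> ?Qlk)" and ?E = "bohr_polynomial (?dil \<tau> (Q k))"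
    have lps: "lp_fun torus_measure q ?A" "lp_fun torus_measure q ?B" "lp_fun torus_measure q ?D" "lp_fun torus_measure q ?E"
      by (intro lp_fun_diff(1) q Xq bq)+
    have "?D z = bohr_polynomial (?dil \<tau> (Q l)) z - ?E z" for z
      using bohr_polynomial_diff[OF dirichlet_polynomial_mult[OF Q] dirichlet_polynomial_mult[OF Q]]
      by (simp add: left_diff_distrib)
    then have X_eq: "X z = (?A z + ?B z) + (?D z + ?E z)" for z
      by simp
    have D: "(LINT z|torus_measure. cmod (?D z) powr q) \<le> 2 powr (q / 2) * (c * (2 * e))"
    proof -
      have "(LINT z|torus_measure. cmod (?D z) powr q) \<le> 2 powr (q / 2) * (LINT z|torus_measure. cmod (bohr_polynomial ?Qlk z) powr q)"
        using \<tau> by (intro integral_bohr_dilated_le dirichlet_polynomial_diff Q q) auto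
      also have "\<dots> \<le> 2 powr (q / 2) * (c * (2 * e))"
        using dd[of l k] l k c by (intro mult_left_mono order_trans[OF dd]) auto
      finally show ?thesis .
    qed
    have "(LINT z|torus_measure. cmod (?A z + ?B z) powr q) \<le> c * ((LINT z|torus_measure. cmod (?A z) powr q) + (LINT z|torus_measure. cmod (?B z) powr q))"
      unfolding c_def by (rule lp_fun_add(2)[OF q(1) lps(1,2)])
    also have "\<dots> \<le> c * (e + e)"
      using c l dil by (intro mult_left_mono add_mono) (auto simp: d_def)
    finally have AB: "(LINT z|torus_measure. cmod (?A z + ?B z) powr q) \<le> c * (e + e)" .
    have "(LINT z|torus_measure. cmod (?D z + ?E z) powr q) \<le> c * ((LINT z|torus_measure. cmod (?D z) powr q) + (LINT z|torus_measure. cmod (?E z) powr q))"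
      unfolding c_def by (rule lp_fun_add(2)[OF q(1) lps(3,4)])
    also have "\<dots> \<le> c * (2 powr (q / 2) * (c * (2 * e)) + e)"
      using c k D by (intro mult_left_mono add_mono) auto
    finally have DE: "(LINT z|torus_measure. cmod (?D z + ?E z) powr q) \<le> c * (2 powr (q / 2) * (c * (2 * e)) + e)" .
    have "(LINT z|torus_measure. cmod (X z) powr q) = (LINT z|torus_measure. cmod ((?A z + ?B z) + (?D z + ?E z)) powr q)"
      unfolding X_eq[symmetric] ..
    also have "\<dots> \<le> c * ((LINT z|torus_measure. cmod (?A z + ?B z) powr q) + (LINT z|torus_measure. cmod (?D z + ?E z) powr q))"
      unfolding c_def by (intro lp_fun_add q lps)
    also have "\<dots> \<le> c * (c * (e + e) + c * (2 powr (q / 2) * (c * (2 * e)) + e))"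
      using c AB DE by (intro mult_left_mono add_mono) auto
    also have "\<dots> = M * e"
      by (simp add: M_def algebra_simps)
    finally show ?thesis .
  qed
  have M: "0 < M"
    using c by (simp add: M_def add_pos_pos)
  have "(LINT z|torus_measure. cmod (X z) powr q) \<le> 0"
  proof (rule field_le_epsilon)
    fix e :: real assume "0 < e"
    then show "(LINT z|torus_measure. cmod (X z) powr q) \<le> 0 + e"
      using small[of "e / M"] M by simp
  qed
  then have "(LINT z|torus_measure. cmod (X z) powr q) = 0"
    using integral_cmod_powr_nonneg[of torus_measure X q] by linarith
  then have "AE z in torus_measure. cmod (X z) powr q = 0"
    using Xq by (subst (asm) integral_nonneg_eq_0_iff_AE) (auto simp: lp_fun_def)
  then show ?thesis
    by simp
qed

text \<open>The difference of two lifts is approximated by polynomials whose coefficients tend to 0.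
  Since \<open>bohr_lift\<close> is a choice, this is what allows \<open>hardy_norm\<close> to be
  computed from any lift.\<close>

lemma bohr_lift_unique:
  assumes p: "0 < p" and F: "is_bohr_lift p f F" and G: "is_bohr_lift p g G"
    and fg: "\<And>n. 1 \<le> n \<Longrightarrow> f n = g n"
  shows "AE z in torus_measure. F z = G z"
proof -
  obtain P where F': "lp_fun torus_measure p F" and P: "\<And>k. dirichlet_polynomial (P k)"
      "(\<lambda>k. LINT z|torus_measure. cmod (F z - bohr_polynomial (P k) z) powr p) \<longlonglongrightarrow> 0"
      "\<And>n. n \<ge> 1 \<Longrightarrow> (\<lambda>k. P k n) \<longlonglongrightarrow> f n"
    using F unfolding is_bohr_lift_iff[OF p] by blast
  obtain R where G': "lp_fun torus_measure p G" and R: "\<And>k. dirichlet_polynomial (R k)"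
      "(\<lambda>k. LINT z|torus_measure. cmod (G z - bohr_polynomial (R k) z) powr p) \<longlonglongrightarrow> 0"
      "\<And>n. n \<ge> 1 \<Longrightarrow> (\<lambda>k. R k n) \<longlonglongrightarrow> g n"
    using G unfolding is_bohr_lift_iff[OF p] by blast
  note bp = lp_fun_bohr_polynomial[OF p]
  have "AE z in torus_measure. F z - G z = 0"
  proof (rule lift_of_zero_null[OF p])
    show "lp_fun torus_measure p (\<lambda>z. F z - G z)"
      by (rule lp_fun_diff(1)[OF p F' G'])
    show "dirichlet_polynomial (\<lambda>n. P k n - R k n)" for k
      by (intro dirichlet_polynomial_diff P R)
    show "(\<lambda>k. P k n - R k n) \<longlonglongrightarrow> 0" if "1 \<le> n" for n
      using tendsto_diff[OF P(3)[OF that] R(3)[OF that]] fg[OF that] by simp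
    show "(\<lambda>k. LINT z|torus_measure. cmod (F z - G z - bohr_polynomial (\<lambda>n. P k n - R k n) z) powr p) \<longlonglongrightarrow> 0"
    proof (rule tendsto_sandwich[OF _ _ tendsto_const])
      have "(\<lambda>k. 2 powr p * ((LINT z|torus_measure. cmod (F z - bohr_polynomial (P k) z) powr p) +
          (LINT z|torus_measure. cmod (G z - bohr_polynomial (R k) z) powr p))) \<longlonglongrightarrow> 2 powr p * (0 + 0)"
        by (intro tendsto_intros P R)
      then show "(\<lambda>k. 2 powr p * ((LINT z|torus_measure. cmod (F z - bohr_polynomial (P k) z) powr p) +
          (LINT z|torus_measure. cmod (G z - bohr_polynomial (R k) z) powr p))) \<longlonglongrightarrow> 0" by simp
      have "(LINT z|torus_measure. cmod (F z - G z - bohr_polynomial (\<lambda>n. P k n - R k n) z) powr p) \<le>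
        2 powr p * ((LINT z|torus_measure. cmod (F z - bohr_polynomial (P k) z) powr p) +
          (LINT z|torus_measure. cmod (G z - bohr_polynomial (R k) z) powr p))" for k
      proof -
        have eq: "F z - G z - bohr_polynomial (\<lambda>n. P k n - R k n) z = (F z - bohr_polynomial (P k) z) - (G z - bohr_polynomial (R k) z)" for z
          by (simp add: bohr_polynomial_diff P R)
        show ?thesis
          unfolding eq by (intro lp_fun_diff p F' G' bp)
      qed
      then show "\<forall>\<^sub>F k in sequentially. (LINT z|torus_measure. cmod (F z - G z - bohr_polynomial (\<lambda>n. P k n - R k n) z) powr p) \<le>
        2 powr p * ((LINT z|torus_measure. cmod (F z - bohr_polynomial (P k) z) powr p) +
          (LINT z|torus_measure. cmod (G z - bohr_polynomial (R k) z) powr p))"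
        by simp
    qed (simp add: integral_cmod_powr_nonneg)
  qed
  then show ?thesis
    by simp
qed

text \<open>Cauchy--Schwarz against the weighted square sum of the coefficients.\<close>

lemma hardy_space_summable:
  assumes p: "0 < p" and f: "f \<in> hardy_space p" and \<sigma>: "1 / 2 < \<sigma>"
  shows "summable (\<lambda>n. cmod (f n) * real n powr - \<sigma>)"
proof -
  obtain F where "is_bohr_lift p f F"
    using f by (auto simp: hardy_space_def)
  then obtain P where F: "lp_fun torus_measure p F" and P: "\<And>k. dirichlet_polynomial (P k)"
      "(\<lambda>k. LINT z|torus_measure. cmod (F z - bohr_polynomial (P k) z) powr p) \<longlonglongrightarrow> 0"
      "\<And>n. n \<ge> 1 \<Longrightarrow> (\<lambda>k. P k n) \<longlonglongrightarrow> f n"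
    unfolding is_bohr_lift_iff[OF p] by blast
  note bp = lp_fun_bohr_polynomial[OF p]
  \<comment> \<open>Half of the excess of \<sigma> over 1 / 2 damps the coefficients; the other half
    keeps n^(-(\<sigma> - \<delta>)) square summable, as 2 (\<sigma> - \<delta>) = \<sigma> + 1 / 2
    > 1.\<close>
  define \<delta> where "\<delta> = (\<sigma> - 1 / 2) / 2"
  have \<delta>: "0 < \<delta>" "2 * (\<sigma> - \<delta>) = \<sigma> + 1 / 2"
    using \<sigma> by (auto simp: \<delta>_def field_simps)
  obtain C where C: "0 < C" "\<And>a S. dirichlet_polynomial a \<Longrightarrow> finite S \<Longrightarrow> 0 \<notin> S \<Longrightarrow>
      (\<Sum>n\<in>S. (cmod (a n))\<^sup>2 * real n powr - (2 * \<delta>)) \<le>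
      C * (LINT z|torus_measure. cmod (bohr_polynomial a z) powr p) powr (2 / p)"
    using weighted_coefficient_bound[OF \<delta>(1) p] by blast
  let ?I = "LINT z|torus_measure. cmod (F z) powr p"
  let ?J = "\<lambda>k. LINT z|torus_measure. cmod (F z - bohr_polynomial (P k) z) powr p"
  have Pk: "(LINT z|torus_measure. cmod (bohr_polynomial (P k) z) powr p) \<le> 2 powr p * (?I + ?J k)" for k
    using lp_fun_diff(2)[OF p F lp_fun_diff(1)[OF p F bp], of "P k"] by simp
  define D where "D = C * (2 powr p * (?I + 0)) powr (2 / p)"
  have partial: "(\<Sum>n\<in>{1..<N}. (cmod (f n))\<^sup>2 * real n powr - (2 * \<delta>)) \<le> D" for N
  proof (rule LIMSEQ_le)
    show "(\<lambda>k. \<Sum>n\<in>{1..<N}. (cmod (P k n))\<^sup>2 * real n powr - (2 * \<delta>)) \<longlonglongrightarrow> (\<Sum>n\<in>{1..<N}. (cmod (f n))\<^sup>2 * real n powr - (2 * \<delta>))"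
      by (intro tendsto_intros P) auto
    show "(\<lambda>k. C * (2 powr p * (?I + ?J k)) powr (2 / p)) \<longlonglongrightarrow> D"
      unfolding D_def using p
      by (intro tendsto_intros tendsto_powr' P) (auto intro!: always_eventually mult_nonneg_nonneg add_nonneg_nonneg integral_cmod_powr_nonneg)
    have "(\<Sum>n\<in>{1..<N}. (cmod (P k n))\<^sup>2 * real n powr - (2 * \<delta>)) \<le> C * (2 powr p * (?I + ?J k)) powr (2 / p)" for k
    proof -
      have "(\<Sum>n\<in>{1..<N}. (cmod (P k n))\<^sup>2 * real n powr - (2 * \<delta>)) \<le>
         C * (LINT z|torus_measure. cmod (bohr_polynomial (P k) z) powr p) powr (2 / p)"
        by (intro C P) auto
      also have "\<dots> \<le> C * (2 powr p * (?I + ?J k)) powr (2 / p)"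
        using C p Pk by (intro mult_left_mono powr_mono2 integral_cmod_powr_nonneg) auto
      finally show ?thesis .
    qed
    then show "\<exists>K. \<forall>k\<ge>K. (\<Sum>n\<in>{1..<N}. (cmod (P k n))\<^sup>2 * real n powr - (2 * \<delta>)) \<le> C * (2 powr p * (?I + ?J k)) powr (2 / p)"
      by blast
  qed
  have sum2: "summable (\<lambda>n. (cmod (f n))\<^sup>2 * real n powr - (2 * \<delta>))"
  proof (rule summableI_nonneg_bounded)
    fix N
    have "(\<Sum>n<N. (cmod (f n))\<^sup>2 * real n powr - (2 * \<delta>)) = (\<Sum>n\<in>{1..<N}. (cmod (f n))\<^sup>2 * real n powr - (2 * \<delta>))"
      by (rule sum.mono_neutral_right) (auto simp: not_le)
    then show "(\<Sum>n<N. (cmod (f n))\<^sup>2 * real n powr - (2 * \<delta>)) \<le> D"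
      using partial[of N] by simp
  qed simp
  have "summable (\<lambda>n. real n powr - (\<sigma> + 1 / 2))"
    using \<sigma> by (subst summable_real_powr_iff) auto
  then have "summable (\<lambda>n. (cmod (f n))\<^sup>2 * real n powr - (2 * \<delta>) + real n powr - (\<sigma> + 1 / 2))"
    by (rule summable_add[OF sum2])
  then show ?thesis
  proof (rule summable_comparison_test'[where N = 0])
    fix n :: nat
    let ?x = "cmod (f n) * real n powr - \<delta>" and ?y = "real n powr - (\<sigma> - \<delta>)"
    have "2 * (?x * ?y) \<le> ?x\<^sup>2 + ?y\<^sup>2"
      using sum_squares_bound[of ?x ?y] by (simp add: mult.assoc)
    moreover have "0 \<le> ?x * ?y" by simp
    ultimately have young: "?x * ?y \<le> ?x\<^sup>2 + ?y\<^sup>2" by linarith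
    have xy: "?x * ?y = cmod (f n) * real n powr - \<sigma>"
      by (simp add: mult.assoc powr_add[symmetric])
    have x2: "?x\<^sup>2 = (cmod (f n))\<^sup>2 * real n powr - (2 * \<delta>)"
      by (simp add: power_mult_distrib powr_square)
    have y2: "?y\<^sup>2 = real n powr - (\<sigma> + 1 / 2)"
    proof -
      have "2 * - (\<sigma> - \<delta>) = - (\<sigma> + 1 / 2)"
        using \<delta>(2) by simp
      then show ?thesis
        by (simp only: powr_square)
    qed
    from young[unfolded xy x2 y2] show "norm (cmod (f n) * real n powr - \<sigma>) \<le> (cmod (f n))\<^sup>2 * real n powr - (2 * \<delta>) + real n powr - (\<sigma> + 1 / 2)"
      by simp
  qed
qed

definition volterra_coeff :: "(nat \<Rightarrow> complex) \<Rightarrow> nat \<Rightarrow> complex" where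
  "volterra_coeff a n = (\<Sum>d | d dvd n \<and> 2 \<le> d. a (n div d) / of_nat d) / of_real (ln (real n))"

section \<open>Convergence of the truncated transforms of a polynomial\<close>

lemma volterra_coeff_upto_eq:
  assumes "1 \<le> n" "n \<le> N"
  shows "volterra_coeff_upto N a n = volterra_coeff a n"
proof -
  have "{d. d dvd n \<and> d \<in> {2..N}} = {d. d dvd n \<and> 2 \<le> d}"
    using assms by (auto dest: dvd_imp_le)
  then show ?thesis
    by (simp add: volterra_coeff_upto_def volterra_coeff_def)
qed

text \<open>For k = n / d the summand |a k| / d equals |a k| k / n, and d determines k injectively,
  so the divisor sum is at most (sum of |a k| k) / n. The factor 2 bounds 1 / ln n. The bound is
  uniform in \<open>N\<close> and square summable in \<open>n\<close>.\<close>

lemma volterra_coeff_upto_decay: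
  assumes a: "dirichlet_polynomial a" and n: "1 \<le> n"
  shows "cmod (volterra_coeff_upto N a n) \<le> 2 * (\<Sum>k | a k \<noteq> 0. cmod (a k) * real k) / real n"
proof (cases "n = 1")
  case True
  then have "{d. d dvd n \<and> d \<in> {2..N}} = {}" by auto
  then have "volterra_coeff_upto N a n = 0"
    by (simp only: volterra_coeff_upto_def sum.empty div_0)
  then show ?thesis
    by (simp add: sum_nonneg)
next
  case False
  then have n2: "2 \<le> n" using n by simp
  define D where "D = {d. d dvd n \<and> d \<in> {2..N}}"
  define h where "h k = cmod (a k) * real k" for k
  have D: "finite D"
    by (rule finite_subset[of _ "{2..N}"]) (auto simp: D_def)
  have supp: "finite {k. a k \<noteq> 0}"
    using a by (simp add: dirichlet_polynomial_def)
  have inj: "inj_on (\<lambda>d. n div d) D"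
  proof (rule inj_onI)
    fix d e assume "d \<in> D" "e \<in> D" and eq: "n div d = n div e"
    then have "d dvd n" "e dvd n"
      by (simp_all add: D_def)
    then have "d * (n div d) = n" "e * (n div e) = n"
      by simp_all
    then have de: "d * (n div d) = n" "e * (n div d) = n"
      by (simp_all only: eq)
    then have "n div d \<noteq> 0"
      using n by (intro notI) simp
    moreover have "d * (n div d) = e * (n div d)"
      using de by simp
    ultimately show "d = e"
      by simp
  qed
  have "cmod (\<Sum>d\<in>D. a (n div d) / of_nat d) \<le> (\<Sum>d\<in>D. h (n div d) / real n)"
  proof (rule sum_norm_le)
    fix d assume "d \<in> D"
    then have "d dvd n" "0 < d"
      by (simp_all add: D_def)
    then have dn: "d * (n div d) = n" "0 < d"
      by simp_all
    then have "real d * real (n div d) = real n"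
      by (metis of_nat_mult)
    moreover have "u * (x / y) = u / c" if "c * x = y" "0 < c" "0 < y" for u x y c :: real
      using that by (auto simp: field_simps)
    ultimately have "cmod (a (n div d)) * (real (n div d) / real n) = cmod (a (n div d)) / real d"
      using dn(2) n by simp
    then have "h (n div d) / real n = cmod (a (n div d)) / real d"
      by (simp add: h_def)
    then show "cmod (a (n div d) / of_nat d) \<le> h (n div d) / real n"
      by (simp add: norm_divide)
  qed
  also have "\<dots> = (\<Sum>k\<in>(\<lambda>d. n div d) ` D. h k) / real n"
    by (simp add: sum_divide_distrib sum.reindex[OF inj])
  also have "(\<Sum>k\<in>(\<lambda>d. n div d) ` D. h k) \<le> (\<Sum>k | a k \<noteq> 0. h k)"
  proof -
    have "(\<Sum>k\<in>(\<lambda>d. n div d) ` D. h k) = (\<Sum>k\<in>(\<lambda>d. n div d) ` D \<inter> {k. a k \<noteq> 0}. h k)"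
      using D by (intro sum.mono_neutral_right) (auto simp: h_def)
    also have "\<dots> \<le> (\<Sum>k | a k \<noteq> 0. h k)"
      using supp by (intro sum_mono2) (auto simp: h_def)
    finally show ?thesis .
  qed
  finally have num: "cmod (\<Sum>d\<in>D. a (n div d) / of_nat d) \<le> (\<Sum>k | a k \<noteq> 0. h k) / real n"
    by (simp add: divide_right_mono)
  have "cmod (volterra_coeff_upto N a n) = cmod (\<Sum>d\<in>D. a (n div d) / of_nat d) / ln (real n)"
    using n2 by (simp add: volterra_coeff_upto_def D_def norm_divide)
  also have "\<dots> \<le> ((\<Sum>k | a k \<noteq> 0. h k) / real n) / (1 / 2)"
    using num ln_ge_half[OF n2] by (intro frac_le) (auto intro: order_trans[OF norm_ge_zero])
  finally show ?thesis
    by (simp add: h_def mult.commute)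
qed

lemma inverse_square_tail:
  assumes "1 \<le> N" "finite S" "S \<subseteq> {N<..}"
  shows "(\<Sum>n\<in>S. 1 / (real n)\<^sup>2) \<le> 1 / real N"
proof -
  have tail: "(\<Sum>n\<in>{N<..R}. 1 / (real n)\<^sup>2) \<le> 1 / real N - 1 / real R" if "N \<le> R" for R
    using that
  proof (induction R rule: dec_induct)
    case (step R)
    have "1 / (real (Suc R))\<^sup>2 \<le> 1 / (real R * real (Suc R))"
      using step assms(1) unfolding power2_eq_square by (intro divide_left_mono mult_right_mono) auto
    also have "\<dots> = 1 / real R - 1 / real (Suc R)"
      using step assms(1) by (simp add: field_simps)
    finally have "1 / (real (Suc R))\<^sup>2 \<le> 1 / real R - 1 / real (Suc R)" .
    moreover have "{N<..Suc R} = insert (Suc R) {N<..R}"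
      using step by auto
    ultimately show ?case
      using step.IH by simp
  qed simp
  define R where "R = Max (insert N S)"
  have R: "N \<le> R" "S \<subseteq> {N<..R}"
    using assms by (auto simp: R_def)
  have "(\<Sum>n\<in>S. 1 / (real n)\<^sup>2) \<le> (\<Sum>n\<in>{N<..R}. 1 / (real n)\<^sup>2)"
    using R by (intro sum_mono2) auto
  also have "\<dots> \<le> 1 / real N - 1 / real R"
    by (rule tail) fact
  also have "\<dots> \<le> 1 / real N" by simp
  finally show ?thesis .
qed

text \<open>Square summability gives convergence of the truncations in \<open>L\<^sup>2\<close>; the uniform bound in
  \<open>L\<^sup>2\<^sup>p\<^sup>-\<^sup>2\<close> and Cauchy--Schwarz upgrade it to \<open>L\<^sup>p\<close>.\<close>

lemma volterra_truncations_cauchy: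
  assumes a: "dirichlet_polynomial a" and p: "0 < p" and e: "0 < e"
  obtains N0 where "\<And>N. N0 \<le> N \<Longrightarrow>
    (LINT z|torus_measure. cmod (bohr_polynomial (volterra_coeff_upto N a) z - bohr_polynomial (volterra_coeff_upto N0 a) z) powr p) \<le> e"
proof -
  \<comment> \<open>Raising the exponent to at least 2 makes the companion exponent 2 P - 2
    positive; \<open>lp_fun_lower_exponent\<close> returns from P to p.\<close>
  define P where "P = max p 2"
  have P: "2 \<le> P" "p \<le> P" "0 < P" "0 < 2 * P - 2"
    by (auto simp: P_def)
  obtain C where C: "0 < C" "\<And>a N. dirichlet_polynomial a \<Longrightarrow>
      (LINT z|torus_measure. cmod (bohr_polynomial (volterra_coeff_upto N a) z) powr (2 * P - 2)) \<le>
      C * (LINT z|torus_measure. cmod (bohr_polynomial a z) powr (2 * P - 2))"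
    using integral_bohr_volterra_coeff_upto_le[OF P(4)] by blast
  define Z where "Z = 2 powr (2 * P - 2) * (C * (LINT z|torus_measure. cmod (bohr_polynomial a z) powr (2 * P - 2)) +
     C * (LINT z|torus_measure. cmod (bohr_polynomial a z) powr (2 * P - 2)))"
  define A where "A = 4 * (\<Sum>k | a k \<noteq> 0. cmod (a k) * real k)"
  have Z: "0 \<le> Z"
    unfolding Z_def using C by (intro mult_nonneg_nonneg add_nonneg_nonneg integral_cmod_powr_nonneg) auto
  have bound: "(LINT z|torus_measure. cmod (bohr_polynomial (volterra_coeff_upto N a) z - bohr_polynomial (volterra_coeff_upto M a) z) powr p) \<le>
     2 * sqrt (A\<^sup>2 * (1 / real M) * Z) powr (p / P)" if M: "1 \<le> M" "M \<le> N" for N M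
  proof -
    define X where "X z = bohr_polynomial (volterra_coeff_upto N a) z - bohr_polynomial (volterra_coeff_upto M a) z" for z
    define b where "b n = volterra_coeff_upto N a n - volterra_coeff_upto M a n" for n
    have b: "dirichlet_polynomial b"
      unfolding b_def by (intro dirichlet_polynomial_diff dirichlet_polynomial_volterra_coeff_upto a)
    have Xb: "X = bohr_polynomial b"
      unfolding X_def b_def fun_eq_iff
      by (simp add: bohr_polynomial_diff dirichlet_polynomial_volterra_coeff_upto a)
    define S where "S = {n. 1 \<le> n \<and> b n \<noteq> 0}"
    have S: "finite S" "0 \<notin> S" "\<And>n. 1 \<le> n \<Longrightarrow> b n \<noteq> 0 \<Longrightarrow> n \<in> S"
      using finite_support[OF b] by (auto simp: S_def)
    have SM: "S \<subseteq> {M<..}"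
    proof
      fix n assume n: "n \<in> S"
      show "n \<in> {M<..}"
      proof (rule ccontr)
        assume "n \<notin> {M<..}"
        then have "b n = 0"
          using n M by (simp add: b_def S_def volterra_coeff_upto_eq)
        then show False using n by (simp add: S_def)
      qed
    qed
    have bn: "cmod (b n) \<le> A / real n" if "n \<in> S" for n
    proof -
      have "cmod (b n) \<le> cmod (volterra_coeff_upto N a n) + cmod (volterra_coeff_upto M a n)"
        unfolding b_def by (rule norm_triangle_ineq4)
      also have "\<dots> \<le> 2 * (\<Sum>k | a k \<noteq> 0. cmod (a k) * real k) / real n + 2 * (\<Sum>k | a k \<noteq> 0. cmod (a k) * real k) / real n"
        using that by (intro add_mono volterra_coeff_upto_decay a) (auto simp: S_def)
      also have "\<dots> = A / real n"
        by (simp add: A_def add_divide_distrib[symmetric])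
      finally show ?thesis .
    qed
    have "(LINT z|torus_measure. (cmod (X z))\<^sup>2) = (\<Sum>n\<in>S. (cmod (b n))\<^sup>2)"
      unfolding Xb by (rule bohr_parseval[OF S])
    also have "\<dots> \<le> (\<Sum>n\<in>S. (A / real n)\<^sup>2)"
      using bn by (intro sum_mono power_mono) auto
    also have "\<dots> = A\<^sup>2 * (\<Sum>n\<in>S. 1 / (real n)\<^sup>2)"
      by (simp add: power_divide sum_distrib_left)
    also have "\<dots> \<le> A\<^sup>2 * (1 / real M)"
      by (intro mult_left_mono inverse_square_tail M S SM) auto
    finally have L2: "(LINT z|torus_measure. (cmod (X z))\<^sup>2) \<le> A\<^sup>2 * (1 / real M)" .
    have lp: "lp_fun torus_measure s X" if "0 < s" for s
      unfolding Xb by (rule lp_fun_bohr_polynomial[OF that])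
    have "(LINT z|torus_measure. cmod (X z) powr (2 * P - 2)) \<le>
      2 powr (2 * P - 2) * ((LINT z|torus_measure. cmod (bohr_polynomial (volterra_coeff_upto N a) z) powr (2 * P - 2)) +
        (LINT z|torus_measure. cmod (bohr_polynomial (volterra_coeff_upto M a) z) powr (2 * P - 2)))"
      unfolding X_def by (intro lp_fun_diff lp_fun_bohr_polynomial P)
    also have "\<dots> \<le> Z"
      unfolding Z_def by (intro mult_left_mono add_mono C a) auto
    finally have LZ: "(LINT z|torus_measure. cmod (X z) powr (2 * P - 2)) \<le> Z" .
    have sq: "(cmod (X z) powr (P - 1))\<^sup>2 = cmod (X z) powr (2 * P - 2)" for z
      by (simp add: powr_square algebra_simps)
    have mul: "cmod (X z) * cmod (X z) powr (P - 1) = cmod (X z) powr P" for z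
      using powr_add[of "cmod (X z)" 1 "P - 1"] by simp
    \<comment> \<open>|X|^P is split into |X|, which is small in square mean, and |X|^(P-1), whose
      square mean is bounded by Z.\<close>
    have "(LINT z|torus_measure. cmod (X z) * cmod (X z) powr (P - 1))\<^sup>2 \<le>
      (LINT z|torus_measure. (cmod (X z))\<^sup>2) * (LINT z|torus_measure. (cmod (X z) powr (P - 1))\<^sup>2)"
      using lp[of 2] lp[OF P(3)] lp[OF P(4)] by (intro Cauchy_Schwarz_integral) (simp_all add: sq mul lp_fun_def)
    also have "\<dots> \<le> A\<^sup>2 * (1 / real M) * Z"
      unfolding sq by (intro mult_mono L2 LZ integral_cmod_powr_nonneg) auto
    finally have LP: "(LINT z|torus_measure. cmod (X z) powr P) \<le> sqrt (A\<^sup>2 * (1 / real M) * Z)"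
      unfolding mul by (rule real_le_rsqrt)
    have "(LINT z|torus_measure. cmod (X z) powr p) \<le> 2 * (LINT z|torus_measure. cmod (X z) powr P) powr (p / P)"
      by (intro torus.lp_fun_lower_exponent(2) p P lp)
    also have "\<dots> \<le> 2 * sqrt (A\<^sup>2 * (1 / real M) * Z) powr (p / P)"
      using LP p P by (intro mult_left_mono powr_mono2 integral_cmod_powr_nonneg) auto
    finally show ?thesis
      by (simp add: X_def)
  qed
  have "(\<lambda>M. 2 * sqrt (A\<^sup>2 * (1 / real M) * Z) powr (p / P)) \<longlonglongrightarrow> 2 * sqrt (A\<^sup>2 * 0 * Z) powr (p / P)"
    using p P Z by (intro tendsto_intros tendsto_powr' lim_1_over_n) auto
  then have "(\<lambda>M. 2 * sqrt (A\<^sup>2 * (1 / real M) * Z) powr (p / P)) \<longlonglongrightarrow> 0"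
    by simp
  then have "\<forall>\<^sub>F M in sequentially. 2 * sqrt (A\<^sup>2 * (1 / real M) * Z) powr (p / P) < e \<and> 1 \<le> M"
    using e by (intro eventually_conj order_tendstoD(2) eventually_ge_at_top)
  then obtain M where M: "2 * sqrt (A\<^sup>2 * (1 / real M) * Z) powr (p / P) < e" "1 \<le> M"
    by (auto simp: eventually_sequentially)
  show ?thesis
    by (rule that[of M]) (use bound[OF M(2)] M(1) in \<open>auto intro: order_trans less_imp_le\<close>)
qed

section \<open>The Volterra operator on the Hardy space\<close>

text \<open>The index is forced beyond \<open>K\<close> so that the k-th approximant will have its
  final coefficients up to k. Moving the reference from N0 to max K N0 costs one quasi-triangle
  inequality, which is why the error is divided by 2 * 2^p.\<close>

lemma volterra_truncation_index:
  assumes a: "dirichlet_polynomial a" and p: "0 < p" and e: "0 < e"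
  shows "\<exists>M\<ge>K. \<forall>N\<ge>M.
    (LINT z|torus_measure. cmod (bohr_polynomial (volterra_coeff_upto N a) z - bohr_polynomial (volterra_coeff_upto M a) z) powr p) \<le> e"
proof -
  let ?T = "\<lambda>N. bohr_polynomial (volterra_coeff_upto N a)"
  define e' where "e' = e / (2 powr p * 2)"
  have e': "0 < e'" "2 powr p * (e' + e') = e"
    using e by (simp_all add: e'_def)
  obtain N0 where N0: "\<And>N. N0 \<le> N \<Longrightarrow> (LINT z|torus_measure. cmod (?T N z - ?T N0 z) powr p) \<le> e'"
    using volterra_truncations_cauchy[OF a p e'(1)] by blast
  show ?thesis
  proof (intro exI[of _ "max K N0"] conjI allI impI)
    fix N assume N: "max K N0 \<le> N"
    let ?M = "max K N0"
    have lp: "lp_fun torus_measure p (\<lambda>z. ?T N z - ?T N0 z)" for N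
      using p by (intro lp_fun_diff(1) lp_fun_bohr_polynomial)
    have eq: "?T N z - ?T ?M z = (?T N z - ?T N0 z) - (?T ?M z - ?T N0 z)" for z
      by simp
    have "(LINT z|torus_measure. cmod (?T N z - ?T ?M z) powr p) \<le>
      2 powr p * ((LINT z|torus_measure. cmod (?T N z - ?T N0 z) powr p) + (LINT z|torus_measure. cmod (?T ?M z - ?T N0 z) powr p))"
      unfolding eq by (rule lp_fun_diff(2)[OF p lp lp])
    also have "\<dots> \<le> 2 powr p * (e' + e')"
      using N by (intro mult_left_mono add_mono N0) auto
    finally show "(LINT z|torus_measure. cmod (?T N z - ?T ?M z) powr p) \<le> e"
      using e' by simp
  qed simp
qed

lemma volterra_coeff_tendsto:
  assumes "1 \<le> n" "\<And>n. 1 \<le> n \<Longrightarrow> (\<lambda>k. P k n) \<longlonglongrightarrow> f n"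
  shows "(\<lambda>k. volterra_coeff (P k) n) \<longlonglongrightarrow> volterra_coeff f n"
proof (cases "n = 1")
  case True
  then show ?thesis
    by (simp add: volterra_coeff_def)
next
  case False
  then have "ln (real n) \<noteq> 0"
    using assms(1) by simp
  then show ?thesis
    unfolding volterra_coeff_def
    using assms div_gt_0_of_dvd by (intro tendsto_intros) (auto simp: Suc_le_eq)
qed

text \<open>A diagonal choice: the k-th polynomial is transformed with the symbol cut off at
  \<open>M k\<close>, late enough for a truncation error of at most 1 / (k + 1). The uniform bound
  for polynomials makes these transforms Cauchy in the mean, and M k \<ge> k makes their
  coefficients converge to those of the full transform.\<close>

lemma volterra_lift_exists:
  fixes p :: real
  assumes p: "0 < p"
  obtains C where "0 < C" "\<And>f F. is_bohr_lift p f F \<Longrightarrow>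
    \<exists>H. is_bohr_lift p (volterra_coeff f) H \<and>
      (LINT z|torus_measure. cmod (H z) powr p) \<le> C * (LINT z|torus_measure. cmod (F z) powr p)"
proof -
  obtain C where C: "0 < C" "\<And>a N. dirichlet_polynomial a \<Longrightarrow>
      (LINT z|torus_measure. cmod (bohr_polynomial (volterra_coeff_upto N a) z) powr p) \<le>
      C * (LINT z|torus_measure. cmod (bohr_polynomial a z) powr p)"
    using integral_bohr_volterra_coeff_upto_le[OF p] by blast
  define c where "c = 2 powr p"
  have c: "0 < c" by (simp add: c_def)
  note bp = lp_fun_bohr_polynomial[OF p]
  show ?thesis
  proof (rule that)
    show "0 < c * (C * c)" using c C by simp
    fix f F assume "is_bohr_lift p f F"
    then obtain P where F: "lp_fun torus_measure p F" and P: "\<And>k. dirichlet_polynomial (P k)"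
        "(\<lambda>k. LINT z|torus_measure. cmod (F z - bohr_polynomial (P k) z) powr p) \<longlonglongrightarrow> 0"
        "\<And>n. n \<ge> 1 \<Longrightarrow> (\<lambda>k. P k n) \<longlonglongrightarrow> f n"
      unfolding is_bohr_lift_iff[OF p] by blast
    let ?T = "\<lambda>N k. bohr_polynomial (volterra_coeff_upto N (P k))"
    define I where "I = (LINT z|torus_measure. cmod (F z) powr p)"
    define J where "J k = (LINT z|torus_measure. cmod (F z - bohr_polynomial (P k) z) powr p)" for k
    have J: "J \<longlonglongrightarrow> 0" "\<And>k. 0 \<le> J k"
      using P(2) by (simp_all add: J_def[abs_def] integral_cmod_powr_nonneg)
    have "\<forall>k. \<exists>M\<ge>k. \<forall>N\<ge>M. (LINT z|torus_measure. cmod (?T N k z - ?T M k z) powr p) \<le> 1 / real (Suc k)"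
      by (intro allI volterra_truncation_index P p) simp
    then obtain M where M: "\<And>k. k \<le> M k"
        "\<And>k N. M k \<le> N \<Longrightarrow> (LINT z|torus_measure. cmod (?T N k z - ?T (M k) k z) powr p) \<le> 1 / real (Suc k)"
      by metis
    define Q where "Q k = ?T (M k) k" for k
    define \<eta> where "\<eta> k = 1 / real (Suc k)" for k
    have \<eta>: "\<eta> \<longlonglongrightarrow> 0"
      unfolding \<eta>_def using LIMSEQ_Suc[OF lim_1_over_n] by simp
    have Q: "lp_fun torus_measure p (Q k)" for k
      unfolding Q_def by (rule bp)
    have PP: "(LINT z|torus_measure. cmod (bohr_polynomial (\<lambda>n. P k n - P l n) z) powr p) \<le> c * (J k + J l)" for k l
    proof -
      have "bohr_polynomial (\<lambda>n. P k n - P l n) z = (F z - bohr_polynomial (P l) z) - (F z - bohr_polynomial (P k) z)" for z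
        by (simp add: bohr_polynomial_diff P)
      then show ?thesis
        using lp_fun_diff(2)[OF p lp_fun_diff(1)[OF p F bp] lp_fun_diff(1)[OF p F bp], of "P l" "P k"]
        by (simp add: J_def c_def add.commute)
    qed
    have QQ: "(LINT z|torus_measure. cmod (Q k z - Q l z) powr p) \<le> c * (\<eta> k + c * (C * (c * (J k + J l)) + \<eta> l))" for k l
    proof -
      \<comment> \<open>At a common level of truncation the difference of the transforms is the
        transform of P k - P l, to which the uniform bound applies.\<close>
      define N where "N = max (M k) (M l)"
      let ?D = "bohr_polynomial (volterra_coeff_upto N (\<lambda>n. P k n - P l n))"
      have D: "?D z = ?T N k z - ?T N l z" for z
        unfolding volterra_coeff_upto_diff
        by (simp add: bohr_polynomial_diff dirichlet_polynomial_volterra_coeff_upto P)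
      have lpA: "lp_fun torus_measure p (\<lambda>z. ?T N k z - Q k z)" "lp_fun torus_measure p (\<lambda>z. ?T N l z - Q l z)"
        by (intro lp_fun_diff(1) p bp Q)+
      have lpB: "lp_fun torus_measure p (\<lambda>z. ?D z + (?T N l z - Q l z))"
        by (intro lp_fun_add(1) p bp lpA)
      have eq: "Q k z - Q l z = (?D z + (?T N l z - Q l z)) - (?T N k z - Q k z)" for z
        by (simp add: D)
      have "(LINT z|torus_measure. cmod (Q k z - Q l z) powr p) \<le>
         c * ((LINT z|torus_measure. cmod (?D z + (?T N l z - Q l z)) powr p) + (LINT z|torus_measure. cmod (?T N k z - Q k z) powr p))"
        unfolding eq c_def by (rule lp_fun_diff(2)[OF p lpB lpA(1)])
      also have "\<dots> \<le> c * (c * (C * (c * (J k + J l)) + \<eta> l) + \<eta> k)"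
      proof (intro mult_left_mono add_mono)
        show "(LINT z|torus_measure. cmod (?T N k z - Q k z) powr p) \<le> \<eta> k"
          unfolding Q_def \<eta>_def by (intro M(2)) (simp add: N_def)
        have "(LINT z|torus_measure. cmod (?D z + (?T N l z - Q l z)) powr p) \<le>
           c * ((LINT z|torus_measure. cmod (?D z) powr p) + (LINT z|torus_measure. cmod (?T N l z - Q l z) powr p))"
          unfolding c_def by (rule lp_fun_add(2)[OF p bp lpA(2)])
        also have "\<dots> \<le> c * (C * (c * (J k + J l)) + \<eta> l)"
        proof (intro mult_left_mono add_mono)
          show "(LINT z|torus_measure. cmod (?T N l z - Q l z) powr p) \<le> \<eta> l"
            unfolding Q_def \<eta>_def by (intro M(2)) (simp add: N_def)
          have "(LINT z|torus_measure. cmod (?D z) powr p) \<le> C * (LINT z|torus_measure. cmod (bohr_polynomial (\<lambda>n. P k n - P l n) z) powr p)"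
            by (intro C dirichlet_polynomial_diff P)
          also have "\<dots> \<le> C * (c * (J k + J l))"
            using C by (intro mult_left_mono PP) auto
          finally show "(LINT z|torus_measure. cmod (?D z) powr p) \<le> C * (c * (J k + J l))" .
        qed (use c in simp)
        finally show "(LINT z|torus_measure. cmod (?D z + (?T N l z - Q l z)) powr p) \<le> c * (C * (c * (J k + J l)) + \<eta> l)" .
      qed (use c in simp)
      finally show ?thesis
        by (simp add: add.commute)
    qed
    have cauchy: "\<exists>K. \<forall>k\<ge>K. \<forall>l\<ge>K. (LINT z|torus_measure. cmod (Q k z - Q l z) powr p) \<le> e" if e: "0 < e" for e
    proof -
      \<comment> \<open>The factor that the two quasi-triangle inequalities and the operator bound
        put on a common bound for \<open>J\<close> and \<open>\<eta>\<close>.\<close>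
      define m where "m = c * (1 + c * (C * (c * 2) + 1))"
      have m: "0 < m"
        using c C by (simp add: m_def add_pos_pos)
      have "\<forall>\<^sub>F k in sequentially. J k < e / m \<and> \<eta> k < e / m"
        using e m by (intro eventually_conj order_tendstoD(2)[OF J(1)] order_tendstoD(2)[OF \<eta>]) auto
      then obtain K where K: "\<And>k. K \<le> k \<Longrightarrow> J k < e / m \<and> \<eta> k < e / m"
        by (auto simp: eventually_sequentially)
      have "(LINT z|torus_measure. cmod (Q k z - Q l z) powr p) \<le> e" if "K \<le> k" "K \<le> l" for k l
      proof -
        have "(LINT z|torus_measure. cmod (Q k z - Q l z) powr p) \<le> c * (\<eta> k + c * (C * (c * (J k + J l)) + \<eta> l))"
          by (rule QQ)
        also have "\<dots> \<le> c * (e / m + c * (C * (c * (e / m + e / m)) + e / m))"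
          using c C K[OF that(1)] K[OF that(2)] by (intro mult_left_mono add_mono) auto
        also have "\<dots> = m * (e / m)"
          by (simp add: m_def algebra_simps add_divide_distrib)
        also have "\<dots> = e"
          using m by simp
        finally show ?thesis .
      qed
      then show ?thesis by blast
    qed
    obtain H where H: "lp_fun torus_measure p H" "(\<lambda>k. LINT z|torus_measure. cmod (H z - Q k z) powr p) \<longlonglongrightarrow> 0"
    proof (rule lp_complete[OF p, of torus_measure Q])
      fix e :: real assume "0 < e"
      then show "\<exists>K. \<forall>k\<ge>K. \<forall>l\<ge>K. (LINT z|torus_measure. cmod (Q k z - Q l z) powr p) \<le> e"
        by (rule cauchy)
    qed (use Q that in auto)
    have "is_bohr_lift p (volterra_coeff f) H"
      unfolding is_bohr_lift_iff[OF p]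
    proof (intro conjI H exI[of _ "\<lambda>k. volterra_coeff_upto (M k) (P k)"] allI impI)
      show "dirichlet_polynomial (volterra_coeff_upto (M k) (P k))" for k
        by (intro dirichlet_polynomial_volterra_coeff_upto P)
      show "(\<lambda>k. LINT z|torus_measure. cmod (H z - bohr_polynomial (volterra_coeff_upto (M k) (P k)) z) powr p) \<longlonglongrightarrow> 0"
        using H(2) by (simp add: Q_def)
      fix n :: nat assume n: "n \<ge> 1"
      have "(\<lambda>k. volterra_coeff (P k) n) \<longlonglongrightarrow> volterra_coeff f n"
        using n by (intro volterra_coeff_tendsto P)
      moreover have "\<forall>\<^sub>F k in sequentially. volterra_coeff (P k) n = volterra_coeff_upto (M k) (P k) n"
        using eventually_ge_at_top[of n]
      proof eventually_elim
        fix k assume "n \<le> k"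
        then show "volterra_coeff (P k) n = volterra_coeff_upto (M k) (P k) n"
          using M(1)[of k] n by (subst volterra_coeff_upto_eq) auto
      qed
      ultimately show "(\<lambda>k. volterra_coeff_upto (M k) (P k) n) \<longlonglongrightarrow> volterra_coeff f n"
        by (rule Lim_transform_eventually)
    qed
    moreover have "(LINT z|torus_measure. cmod (H z) powr p) \<le> c * (C * c) * I"
    proof (rule LIMSEQ_le_const)
      have "(\<lambda>k. c * ((LINT z|torus_measure. cmod (H z - Q k z) powr p) + C * (c * (I + J k)))) \<longlonglongrightarrow> c * (0 + C * (c * (I + 0)))"
        by (intro tendsto_intros H J)
      then show "(\<lambda>k. c * ((LINT z|torus_measure. cmod (H z - Q k z) powr p) + C * (c * (I + J k)))) \<longlonglongrightarrow> c * (C * c) * I"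
        by (simp add: mult.assoc)
      have "(LINT z|torus_measure. cmod (H z) powr p) \<le> c * ((LINT z|torus_measure. cmod (H z - Q k z) powr p) + C * (c * (I + J k)))" for k
      proof -
        have "(LINT z|torus_measure. cmod (H z) powr p) \<le> c * ((LINT z|torus_measure. cmod (H z - Q k z) powr p) + (LINT z|torus_measure. cmod (Q k z) powr p))"
          using lp_fun_add(2)[OF p lp_fun_diff(1)[OF p H(1) Q] Q, of k k] by (simp add: c_def)
        also have "\<dots> \<le> c * ((LINT z|torus_measure. cmod (H z - Q k z) powr p) + C * (c * (I + J k)))"
        proof (intro mult_left_mono add_mono order_refl)
          have "(LINT z|torus_measure. cmod (Q k z) powr p) \<le> C * (LINT z|torus_measure. cmod (bohr_polynomial (P k) z) powr p)"
            unfolding Q_def by (intro C P)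
          also have "(LINT z|torus_measure. cmod (bohr_polynomial (P k) z) powr p) \<le> c * (I + J k)"
            using lp_fun_diff(2)[OF p F lp_fun_diff(1)[OF p F bp], of "P k"] by (simp add: c_def I_def J_def)
          finally show "(LINT z|torus_measure. cmod (Q k z) powr p) \<le> C * (c * (I + J k))"
            using C by simp
        qed (use c in simp)
        finally show ?thesis .
      qed
      then show "\<exists>N. \<forall>n\<ge>N. (LINT z|torus_measure. cmod (H z) powr p) \<le> c * ((LINT z|torus_measure. cmod (H z - Q n z) powr p) + C * (c * (I + J n)))"
        by blast
    qed
    ultimately show "\<exists>H. is_bohr_lift p (volterra_coeff f) H \<and>
      (LINT z|torus_measure. cmod (H z) powr p) \<le> c * (C * c) * (LINT z|torus_measure. cmod (F z) powr p)"
      unfolding I_def by blast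
  qed
qed

section \<open>From coefficients back to Dirichlet series and the integral\<close>

lemma norm_dirichlet_term: "cmod (dirichlet_term a s n) = cmod (a n) * real n powr - Re s"
proof (cases "n = 0")
  case False
  then show ?thesis
    using norm_powr_real_powr[of "of_nat n" "- s"] by (simp add: dirichlet_term_def norm_mult)
qed (simp add: dirichlet_term_def)

lemma dirichlet_term_add:
  assumes "1 \<le> n"
  shows "dirichlet_term a (s + of_real t) n = dirichlet_term a s n * of_real (exp (- ln (real n) * t))"
proof -
  have eq: "of_nat n powr (- w) = exp (- w * of_real (ln (real n)))" for w :: complex
    using assms by (simp add: powr_def Ln_of_nat)
  have "exp (- (s + of_real t) * of_real (ln (real n))) = exp (- s * of_real (ln (real n))) * of_real (exp (- ln (real n) * t))"
    unfolding exp_of_real[symmetric] exp_add[symmetric] by (simp add: algebra_simps)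
  then show ?thesis
    unfolding dirichlet_term_def eq by simp
qed

text \<open>The absolutely convergent double sum over (m, d) is regrouped along the products m d =
  n.\<close>

lemma dirichlet_product_sums:
  fixes X Y :: "nat \<Rightarrow> complex"
  assumes X: "summable (\<lambda>n. norm (X n))" "X 0 = 0" and Y: "summable (\<lambda>n. norm (Y n))" "Y 0 = 0"
  shows "(\<lambda>n. \<Sum>d | d dvd n. X (n div d) * Y d) sums (suminf X * suminf Y)"
proof -
  define F where "F = (\<lambda>(m, d). X m * Y d)"
  have Xs: "(X has_sum suminf X) UNIV" and Ys: "(Y has_sum suminf Y) UNIV"
    by (intro norm_summable_imp_has_sum X Y summable_sums summable_norm_cancel)+
  have Xn: "(\<lambda>n. norm (X n)) summable_on UNIV" and Yn: "(\<lambda>n. norm (Y n)) summable_on UNIV"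
    using X Y by (simp_all add: summable_on_UNIV_nonneg_real_iff)
  have "(\<lambda>x. norm (F x)) summable_on (UNIV \<times> UNIV)"
    unfolding Infinite_Sum.abs_summable_on_Sigma_iff
  proof (intro conjI ballI)
    show "(\<lambda>y. norm (F (x, y))) summable_on UNIV" for x
      using Yn by (simp add: F_def norm_mult summable_on_cmult_right)
    have "(\<lambda>x. norm (\<Sum>\<^sub>\<infinity>y\<in>UNIV. norm (F (x, y)))) = (\<lambda>x. norm (X x) * (\<Sum>\<^sub>\<infinity>y\<in>UNIV. norm (Y y)))"
      by (simp add: F_def norm_mult infsum_cmult_right' abs_mult infsum_nonneg)
    then show "(\<lambda>x. norm (\<Sum>\<^sub>\<infinity>y\<in>UNIV. norm (F (x, y)))) summable_on UNIV"
      using Xn by (simp add: summable_on_cmult_left)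
  qed
  then have "F summable_on (UNIV \<times> UNIV)"
    by (rule Infinite_Sum.abs_summable_summable)
  then obtain S where S: "(F has_sum S) (UNIV \<times> UNIV)"
    by (auto simp: summable_on_def)
  have "((\<lambda>y. F (x, y)) has_sum X x * suminf Y) UNIV" for x
    using has_sum_cmult_right[OF Ys, of "X x"] by (simp add: F_def)
  from has_sum_SigmaD[OF S this] have "((\<lambda>x. X x * suminf Y) has_sum S) UNIV" .
  then have S_eq: "S = suminf X * suminf Y"
    using has_sum_cmult_left[OF Xs, of "suminf Y"] has_sum_unique by blast
  \<comment> \<open>Index 0 is removed before regrouping, because every number divides 0 and its
    fibre is infinite; X 0 = Y 0 = 0 keeps the sum unchanged. The term n = 0 of the claim is 0 as a
    sum over an infinite set.\<close>
  have "(F has_sum S) ({1..} \<times> {1..})"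
    using S by (rule has_sum_cong_neutral[THEN iffD1, rotated -1]) (auto simp: F_def Suc_le_eq, (metis X(2) Y(2) gr0I)+)
  then have "((\<lambda>(n, d). X (n div d) * Y d) has_sum S) (Sigma {1..} (\<lambda>n. {d. d dvd n}))"
    by (subst (asm) has_sum_reindex_bij_witness[where i = "\<lambda>(m, d). (m * d, d)" and j = "\<lambda>(n, d). (n div d, d)"
          and S = "Sigma {1..} (\<lambda>n. {d. d dvd n})" and T = "{1..} \<times> {1..}" and g = "\<lambda>(n, d). X (n div d) * Y d", symmetric])
       (auto simp: F_def Suc_le_eq div_gt_0_of_dvd dvd_pos_nat intro: dvd_pos_nat)
  moreover have "((\<lambda>d. (\<lambda>(n, d). X (n div d) * Y d) (n, d)) has_sum (\<Sum>d | d dvd n. X (n div d) * Y d)) {d. d dvd n}"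
    if "n \<in> {1..}" for n
    using that by (auto intro!: has_sum_finite)
  ultimately have "((\<lambda>n. \<Sum>d | d dvd n. X (n div d) * Y d) has_sum S) {1..}"
    by (rule has_sum_SigmaD)
  then have "((\<lambda>n. \<Sum>d | d dvd n. X (n div d) * Y d) has_sum S) UNIV"
    by (rule has_sum_cong_neutral[THEN iffD1, rotated -1]) (auto simp: not_le)
  then show ?thesis
    unfolding S_eq by (rule has_sum_imp_sums)
qed

lemma dirichlet_product_norm_summable:
  fixes X Y :: "nat \<Rightarrow> complex"
  assumes X: "summable (\<lambda>n. norm (X n))" "X 0 = 0" and Y: "summable (\<lambda>n. norm (Y n))" "Y 0 = 0"
  shows "summable (\<lambda>n. norm (\<Sum>d | d dvd n. X (n div d) * Y d))"
proof -
  have "summable (\<lambda>n. \<Sum>d | d dvd n. complex_of_real (norm (X (n div d))) * of_real (norm (Y d)))"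
    by (rule sums_summable, rule dirichlet_product_sums) (use X Y in auto)
  then have "summable (\<lambda>n. complex_of_real (\<Sum>d | d dvd n. norm (X (n div d)) * norm (Y d)))"
    by simp
  then have "summable (\<lambda>n. \<Sum>d | d dvd n. norm (X (n div d)) * norm (Y d))"
    by (simp only: summable_complex_of_real)
  then show ?thesis
    by (rule summable_comparison_test'[where N = 0]) (auto intro!: sum_norm_le simp: norm_mult)
qed

lemma has_bochner_integral_exp:
  fixes l :: real
  assumes l: "0 < l"
  shows "has_bochner_integral lborel (\<lambda>t. indicator {0..} t * exp (- l * t)) (1 / l)"
proof (rule has_bochner_integral_nn_integral)
  have lim: "((\<lambda>t. - exp (- l * t) / l) \<longlongrightarrow> 0) at_top"
  proof -
    have "((\<lambda>t. exp (- l * t)) \<longlongrightarrow> 0) at_top"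
      by (rule filterlim_compose[OF exp_at_bot])
         (use l in \<open>intro filterlim_tendsto_neg_mult_at_bot[OF tendsto_const _ filterlim_ident], simp\<close>)
    then have "((\<lambda>t. - exp (- l * t) / l) \<longlongrightarrow> - 0 / l) at_top"
      using l by (intro tendsto_intros) auto
    then show ?thesis by simp
  qed
  have "(\<integral>\<^sup>+ t. ennreal (indicator {0..} t * exp (- l * t)) \<partial>lborel) = (\<integral>\<^sup>+ t. ennreal (exp (- l * t)) * indicator {0..} t \<partial>lborel)"
    by (intro nn_integral_cong) (auto simp: indicator_def)
  also have "\<dots> = 0 - (- exp (- l * 0) / l)"
    using l by (intro nn_integral_FTC_atLeast lim) (auto intro!: derivative_eq_intros)
  finally show "(\<integral>\<^sup>+ t. ennreal (indicator {0..} t * exp (- l * t)) \<partial>lborel) = ennreal (1 / l)"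
    by simp
qed (use l in auto)

abbreviation (input) corollary_symbol :: "nat \<Rightarrow> complex" where
  "corollary_symbol n \<equiv> if 2 \<le> n then complex_of_real (1 / (real n * ln (real n))) else 0"

text \<open>The coefficients of zeta (1 + s) - 1. For the symbol at hand this function is - g'(s),
  as differentiation cancels the logarithm in the denominator.\<close>

definition zeta_tail :: "nat \<Rightarrow> complex" where
  "zeta_tail n = (if 2 \<le> n then 1 / of_nat n else 0)"

lemma summable_zeta_tail:
  assumes "0 < Re w"
  shows "summable (\<lambda>n. cmod (dirichlet_term zeta_tail w n))"
proof (rule summable_comparison_test'[where N = 0])
  show "summable (\<lambda>n. real n powr (- 1 - Re w))"
    using assms by (subst summable_real_powr_iff) auto
  show "norm (cmod (dirichlet_term zeta_tail w n)) \<le> real n powr (- 1 - Re w)" for n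
  proof (cases "2 \<le> n")
    case True
    then show ?thesis
      by (simp add: norm_dirichlet_term zeta_tail_def norm_divide powr_diff powr_minus divide_simps)
  qed (simp add: norm_dirichlet_term zeta_tail_def)
qed

text \<open>Termwise differentiation, justified by the Weierstrass test in the half-plane Re u > Re
  w / 2, where the derived series is dominated by its terms at the real point Re w / 2.\<close>

lemma deriv_symbol:
  assumes w: "0 < Re w"
  shows "deriv (dirichlet_fun corollary_symbol) w = - (\<Sum>n. dirichlet_term zeta_tail w n)"
proof -
  define \<delta> where "\<delta> = Re w / 2"
  define S where "S = {u. \<delta> < Re u}"
  have \<delta>: "0 < \<delta>" "w \<in> S"
    using w by (auto simp: \<delta>_def S_def)
  have S: "open S" "convex S"
    unfolding S_def by (auto simp: open_halfspace_Re_gt convex_halfspace_Re_gt)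
  have term_deriv: "((\<lambda>u. dirichlet_term corollary_symbol u n) has_field_derivative - dirichlet_term zeta_tail u n) (at u within S)" for n u
  proof (cases "2 \<le> n")
    case True
    have eq: "of_nat n powr (- v) = exp (- v * of_real (ln (real n)))" for v :: complex
      using True by (simp add: powr_def Ln_of_nat)
    have "((\<lambda>v. exp (- v * of_real (ln (real n)))) has_field_derivative exp (- u * of_real (ln (real n))) * - of_real (ln (real n))) (at u within S)"
      by (rule derivative_eq_intros refl | simp)+
    from DERIV_cmult[OF this, of "complex_of_real (1 / (real n * ln (real n)))"] show ?thesis
      using True by (simp add: dirichlet_term_def eq zeta_tail_def)
  qed (simp add: dirichlet_term_def zeta_tail_def)
  have unif: "uniformly_convergent_on S (\<lambda>n u. \<Sum>i<n. - dirichlet_term zeta_tail u i)"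
  proof (rule Weierstrass_m_test'[where M = "\<lambda>n. cmod (dirichlet_term zeta_tail (of_real \<delta>) n)"])
    show "summable (\<lambda>n. cmod (dirichlet_term zeta_tail (of_real \<delta>) n))"
      using \<delta> by (intro summable_zeta_tail) simp
    show "norm (- dirichlet_term zeta_tail u n) \<le> cmod (dirichlet_term zeta_tail (of_real \<delta>) n)" if "u \<in> S" for n u
    proof (cases "n = 0")
      case False
      then have "real n powr - Re u \<le> real n powr - \<delta>"
        using that by (intro powr_mono) (auto simp: S_def)
      then show ?thesis
        by (simp add: norm_dirichlet_term mult_left_mono)
    qed (simp add: dirichlet_term_def)
  qed
  have summ: "summable (\<lambda>n. dirichlet_term corollary_symbol w n)"
  proof (rule summable_norm_cancel, rule summable_comparison_test'[where N = 0])
    show "summable (\<lambda>n. 2 * cmod (dirichlet_term zeta_tail w n))"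
      by (intro summable_mult summable_zeta_tail w)
    show "norm (cmod (dirichlet_term corollary_symbol w n)) \<le> 2 * cmod (dirichlet_term zeta_tail w n)" for n
    proof (cases "2 \<le> n")
      case True
      have "1 / (real n * ln (real n)) \<le> 1 / (real n * (1 / 2))"
        using ln_ge_half[OF True] True by (intro divide_left_mono mult_left_mono) auto
      then have "1 / (real n * ln (real n)) * real n powr - Re w \<le> 2 / real n * real n powr - Re w"
        by (intro mult_right_mono) auto
      then show ?thesis
        using True by (simp add: norm_dirichlet_term zeta_tail_def norm_divide norm_mult)
    qed (simp add: norm_dirichlet_term)
  qed
  have int: "w \<in> interior S"
    using S \<delta> by (simp add: interior_open)
  have "((\<lambda>u. \<Sum>n. dirichlet_term corollary_symbol u n) has_field_derivative (\<Sum>n. - dirichlet_term zeta_tail w n)) (at w)"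
    by (rule has_field_derivative_series'(2)[OF S(2) term_deriv unif \<delta>(2) summ int])
  then have "deriv (dirichlet_fun corollary_symbol) w = (\<Sum>n. - dirichlet_term zeta_tail w n)"
    unfolding dirichlet_fun_def by (rule DERIV_imp_deriv)
  also have "\<dots> = - (\<Sum>n. dirichlet_term zeta_tail w n)"
    using summable_norm_cancel[OF summable_zeta_tail[OF w]] by (rule suminf_minus)
  finally show ?thesis .
qed

text \<open>By absolute convergence f g' is the Dirichlet series with the coefficients - c n.
  Integrating n^(-(s+t)) over t \<ge> 0 gives n^(-s) / ln n, which turns \<open>c\<close> into
  \<open>volterra_coeff f\<close>; since c 1 = 0, every term of the integrand decays.\<close>

lemma is_volterra_volterra_coeff:
  assumes f: "\<And>\<sigma>. 1 / 2 < \<sigma> \<Longrightarrow> summable (\<lambda>n. cmod (f n) * real n powr - \<sigma>)"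
  shows "is_volterra corollary_symbol f (volterra_coeff f)"
  unfolding is_volterra_def
proof (intro allI impI)
  fix s assume s: "1 / 2 < Re s"
  have f_norm: "summable (\<lambda>n. cmod (dirichlet_term f w n))" if "1 / 2 < Re w" for w
    using f[OF that] by (simp add: norm_dirichlet_term)
  have t0: "dirichlet_term a w 0 = 0" for a w
    by (simp add: dirichlet_term_def)
  define c where "c n = (\<Sum>d | d dvd n. f (n div d) * zeta_tail d)" for n
  have conv: "(\<Sum>d | d dvd n. dirichlet_term f w (n div d) * dirichlet_term zeta_tail w d) = dirichlet_term c w n" for n w
  proof (cases "n = 0")
    case False
    have "of_nat (n div d) powr (- w) * of_nat d powr (- w) = of_nat n powr (- w)" if "d dvd n" for d
    proof -
      have "n = n div d * d" using that by simp
      then have "complex_of_nat n = of_real (real (n div d)) * of_real (real d)"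
        by (metis of_nat_mult of_real_of_nat_eq)
      then show ?thesis
        using powr_times_real[of "complex_of_real (real (n div d))" "of_real (real d)" "- w"] by simp
    qed
    then show ?thesis
      unfolding c_def dirichlet_term_def sum_distrib_right
      by (intro sum.cong refl) (simp add: mult_ac)
  qed (simp add: t0)
  have prod: "volterra_integrand corollary_symbol f w = - (\<Sum>n. dirichlet_term c w n)"
    and prod_norm: "summable (\<lambda>n. cmod (dirichlet_term c w n))" if w: "1 / 2 < Re w" for w
  proof -
    have w0: "0 < Re w" using w by linarith
    note * = f_norm[OF w] t0[of f w] summable_zeta_tail[OF w0] t0[of zeta_tail w]
    show "volterra_integrand corollary_symbol f w = - (\<Sum>n. dirichlet_term c w n)"
      using sums_unique[OF dirichlet_product_sums[OF *]]
      by (simp add: conv volterra_integrand_def deriv_symbol[OF w0] dirichlet_fun_def)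
    show "summable (\<lambda>n. cmod (dirichlet_term c w n))"
      using dirichlet_product_norm_summable[OF *] by (simp only: conv)
  qed
  have c1: "c 0 = 0" "c 1 = 0"
    by (simp_all add: c_def zeta_tail_def)
  have c_eq: "c n = volterra_coeff f n * of_real (ln (real n))" if "2 \<le> n" for n
  proof -
    have "(\<Sum>d | d dvd n. f (n div d) * zeta_tail d) = (\<Sum>d | d dvd n \<and> 2 \<le> d. f (n div d) * zeta_tail d)"
      using that by (intro sum.mono_neutral_right) (auto simp: zeta_tail_def)
    also have "\<dots> = (\<Sum>d | d dvd n \<and> 2 \<le> d. f (n div d) / of_nat d)"
      by (intro sum.cong refl) (simp add: zeta_tail_def)
    finally show ?thesis
      using that by (simp add: c_def volterra_coeff_def)
  qed
  have v0: "dirichlet_term (volterra_coeff f) s n = 0" if "n < 2" for n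
    using that by (cases n) (auto simp: dirichlet_term_def volterra_coeff_def)
  \<comment> \<open>With the indicator inside the terms, the series converges absolutely for every
    real t and the integrals run over the whole line.\<close>
  define u where "u n t = indicator {0..} t *\<^sub>R dirichlet_term c (s + of_real t) n" for n and t :: real
  have u_eq: "u n t = dirichlet_term c s n * of_real (indicator {0..} t * exp (- ln (real n) * t))" if "1 \<le> n" for n t
    using dirichlet_term_add[OF that, of c s t] by (simp add: u_def scaleR_conv_of_real mult_ac)
  have u_int: "has_bochner_integral lborel (u n) (dirichlet_term (volterra_coeff f) s n)" for n
  proof (cases "2 \<le> n")
    case True
    then have l: "0 < ln (real n)" by simp
    have "has_bochner_integral lborel (\<lambda>t. dirichlet_term c s n * of_real (indicator {0..} t * exp (- ln (real n) * t)))
        (dirichlet_term c s n * of_real (1 / ln (real n)))"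
      by (intro has_bochner_integral_mult_right has_bochner_integral_of_real has_bochner_integral_exp l)
    moreover have "dirichlet_term c s n * of_real (1 / ln (real n)) = dirichlet_term (volterra_coeff f) s n"
      using l by (simp add: dirichlet_term_def c_eq[OF True])
    moreover have "u n = (\<lambda>t. dirichlet_term c s n * of_real (indicator {0..} t * exp (- ln (real n) * t)))"
      using True u_eq[of n] by (intro ext) simp
    ultimately show ?thesis by simp
  next
    case False
    then have "c n = 0"
      using c1 by (cases n) (auto simp: not_le less_Suc_eq)
    then have "u n = (\<lambda>t. 0)"
      by (simp add: u_def dirichlet_term_def fun_eq_iff)
    then show ?thesis
      using v0[of n] False by (simp add: has_bochner_integral_zero)
  qed
  \<comment> \<open>1 / ln n \<le> 2 for n \<ge> 2 provides the summable majorant for exchanging sum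
    and integral.\<close>
  have u_norm_int: "(LINT t|lborel. norm (u n t)) \<le> 2 * cmod (dirichlet_term c s n)" for n
  proof (cases "2 \<le> n")
    case True
    then have l: "0 < ln (real n)" by simp
    have "(LINT t|lborel. norm (u n t)) = (LINT t|lborel. cmod (dirichlet_term c s n) * (indicator {0..} t * exp (- ln (real n) * t)))"
      using True by (intro Bochner_Integration.integral_cong refl) (simp add: u_eq norm_mult abs_mult)
    also have "\<dots> = cmod (dirichlet_term c s n) * (1 / ln (real n))"
      using has_bochner_integral_integral_eq[OF has_bochner_integral_mult_right[OF has_bochner_integral_exp[OF l]]] by blast
    also have "\<dots> \<le> cmod (dirichlet_term c s n) * 2"
      using ln_ge_half[OF True] l by (intro mult_left_mono) (auto simp: field_simps)
    finally show ?thesis by simp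
  next
    case False
    then have "c n = 0"
      using c1 by (cases n) (auto simp: not_le less_Suc_eq)
    then show ?thesis
      by (simp add: u_def dirichlet_term_def)
  qed
  have u_integrable: "integrable lborel (u n)" for n
    using u_int by (auto simp: has_bochner_integral_iff)
  have Re_ge: "1 / 2 < Re (s + of_real t)" if "0 \<le> t" for t
    using s that by simp
  have AE_summ: "AE t in lborel. summable (\<lambda>n. norm (u n t))"
  proof (rule AE_I2)
    fix t :: real
    show "summable (\<lambda>n. norm (u n t))"
    proof (cases "0 \<le> t")
      case True
      then show ?thesis
        using prod_norm[OF Re_ge[OF True]] by (simp add: u_def)
    qed (simp add: u_def)
  qed
  have summ_int: "summable (\<lambda>n. LINT t|lborel. norm (u n t))"
  proof (rule summable_comparison_test'[where N = 0])
    show "summable (\<lambda>n. 2 * cmod (dirichlet_term c s n))"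
      using prod_norm[OF s] by (rule summable_mult)
    show "norm (LINT t|lborel. norm (u n t)) \<le> 2 * cmod (dirichlet_term c s n)" for n
      using u_norm_int[of n] by simp
  qed
  have integrand: "indicator {0..} t *\<^sub>R volterra_integrand corollary_symbol f (s + of_real t) = - (\<Sum>n. u n t)" for t
  proof (cases "0 \<le> t")
    case True
    then show ?thesis
      using prod[OF Re_ge[OF True]] by (simp add: u_def)
  qed (simp add: u_def)
  have "set_integrable lborel {0..} (\<lambda>t. volterra_integrand corollary_symbol f (s + of_real t))"
    unfolding set_integrable_def integrand
    using integrable_suminf[OF u_integrable AE_summ summ_int] by simp
  moreover have "volterra_fun corollary_symbol f s = (LINT t|lborel. (\<Sum>n. u n t))"
    unfolding volterra_fun_def set_lebesgue_integral_def integrand by simp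
  moreover have "(\<lambda>n. LINT t|lborel. u n t) sums (LINT t|lborel. (\<Sum>n. u n t))"
    by (rule sums_integral[OF u_integrable AE_summ summ_int])
  moreover have "(LINT t|lborel. u n t) = dirichlet_term (volterra_coeff f) s n" for n
    using u_int by (rule has_bochner_integral_integral_eq)
  moreover have "summable (dirichlet_term f s)"
    by (rule summable_norm_cancel[OF f_norm[OF s]])
  ultimately show "summable (dirichlet_term f s) \<and>
      set_integrable lborel {0..} (\<lambda>t. volterra_integrand corollary_symbol f (s + of_real t)) \<and>
      dirichlet_term (volterra_coeff f) s sums volterra_fun corollary_symbol f s"
    by simp
qed

text \<open>If all coefficients before \<open>N\<close> vanish, multiplying the zero sum by N^x
  leaves a N and a tail of order (N / (N + 1))^k for x = k + 1. One unit of the exponent is reserved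
  for the absolute convergence at 1, and k tends to infinity.\<close>

lemma dirichlet_series_eq_0:
  assumes summ: "summable (\<lambda>n. cmod (a n) * real n powr - 1)"
    and zero: "\<And>x. 1 \<le> x \<Longrightarrow> dirichlet_term a (of_real x) sums 0"
    and N: "1 \<le> N"
  shows "a N = 0"
  using N
proof (induction N rule: less_induct)
  case (less N)
  define D where "D = real N * (\<Sum>n. cmod (a n) * real n powr - 1)"
  have bound: "cmod (a N) \<le> (real N / real (Suc N)) ^ k * D" for k
  proof -
    define x where "x = real k + 1"
    let ?t = "dirichlet_term a (of_real x)"
    have sm: "summable ?t"
      using zero[of x] by (auto simp: x_def intro: sums_summable)
    have low: "(\<Sum>n<Suc N. ?t n) = ?t N"
    proof -
      have "?t n = 0" if "n < N" for n
        using less.IH[OF that] by (cases "n = 0") (auto simp: dirichlet_term_def)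
      then show ?thesis by simp
    qed
    have "0 = suminf ?t"
      using zero[of x] by (simp add: x_def sums_iff)
    also have "\<dots> = (\<Sum>n. ?t (n + Suc N)) + ?t N"
      using suminf_split_initial_segment[OF sm, of "Suc N"] low by simp
    finally have "?t N = - (\<Sum>n. ?t (n + Suc N))"
      by (simp add: eq_neg_iff_add_eq_0 add.commute)
    then have "cmod (?t N) = cmod (\<Sum>n. ?t (n + Suc N))"
      by simp
    let ?w = "\<lambda>n. real (Suc N) powr - real k * (cmod (a n) * real n powr - 1)"
    have le: "cmod (?t (n + Suc N)) \<le> ?w (n + Suc N)" for n
    proof -
      have "real (n + Suc N) powr - real k \<le> real (Suc N) powr - real k"
        by (intro powr_mono2') auto
      then have "cmod (a (n + Suc N)) * real (n + Suc N) powr - 1 * real (n + Suc N) powr - real k \<le>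
         cmod (a (n + Suc N)) * real (n + Suc N) powr - 1 * real (Suc N) powr - real k"
        by (intro mult_left_mono) auto
      then have "cmod (a (n + Suc N)) * (real (n + Suc N) powr - 1 * real (n + Suc N) powr - real k) \<le> ?w (n + Suc N)"
        by (simp only: mult_ac)
      moreover have "real (n + Suc N) powr - 1 * real (n + Suc N) powr - real k = real (n + Suc N) powr - x"
        unfolding powr_add[symmetric] x_def by (simp add: algebra_simps)
      ultimately show ?thesis
        by (simp only: norm_dirichlet_term Re_complex_of_real)
    qed
    have w_summ: "summable ?w"
      by (intro summable_mult summ)
    have "cmod (\<Sum>n. ?t (n + Suc N)) \<le> (\<Sum>n. ?w (n + Suc N))"
      using le w_summ by (intro norm_suminf_le summable_ignore_initial_segment)
    also have "\<dots> \<le> suminf ?w"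
      using suminf_split_initial_segment[OF w_summ, of "Suc N"] by (simp add: sum_nonneg)
    also have "\<dots> = real (Suc N) powr - real k * (\<Sum>n. cmod (a n) * real n powr - 1)"
      by (rule suminf_mult[OF summ])
    finally have "cmod (a N) * real N powr - x \<le> real (Suc N) powr - real k * (\<Sum>n. cmod (a n) * real n powr - 1)"
      using \<open>cmod (?t N) = cmod (\<Sum>n. ?t (n + Suc N))\<close> by (simp add: norm_dirichlet_term)
    then have "real N powr x * (cmod (a N) * real N powr - x) \<le> real N powr x * (real (Suc N) powr - real k * (\<Sum>n. cmod (a n) * real n powr - 1))"
      by (intro mult_left_mono) auto
    moreover have "real N powr x * (cmod (a N) * real N powr - x) = cmod (a N)"
      using less.prems by (simp add: powr_minus)
    moreover have "real N powr x = real N ^ k * real N"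
      using less.prems by (simp add: x_def powr_add powr_realpow)
    moreover have "real (Suc N) powr - real k = 1 / real (Suc N) ^ k"
      by (simp add: powr_minus_divide powr_realpow)
    ultimately have "cmod (a N) \<le> real N ^ k * real N * (1 / real (Suc N) ^ k * (\<Sum>n. cmod (a n) * real n powr - 1))"
      by (simp only:)
    then show ?thesis
      unfolding D_def by (simp only: power_divide mult_ac times_divide_eq_right times_divide_eq_left mult_1)
  qed
  have "(\<lambda>k. (real N / real (Suc N)) ^ k * D) \<longlonglongrightarrow> 0 * D"
    by (intro tendsto_intros LIMSEQ_realpow_zero) auto
  then have "cmod (a N) \<le> 0 * D"
    by (rule LIMSEQ_le_const) (use bound in auto)
  then show ?case by simp
qed

theorem corollary5p4:
  fixes p :: real
  assumes "0 < p"
  shows "volterra_bounded p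
           (\<lambda>n. if 2 \<le> n then complex_of_real (1 / (real n * ln (real n))) else 0)"
proof -
  obtain C where C: "0 < C" "\<And>f F. is_bohr_lift p f F \<Longrightarrow>
      \<exists>H. is_bohr_lift p (volterra_coeff f) H \<and>
        (LINT z|torus_measure. cmod (H z) powr p) \<le> C * (LINT z|torus_measure. cmod (F z) powr p)"
    using volterra_lift_exists[OF assms] by blast
  have lift: "is_bohr_lift p f (bohr_lift p f)" if "f \<in> hardy_space p" for f
    using that someI_ex[of "is_bohr_lift p f"] by (simp add: hardy_space_def bohr_lift_def)
  have volterra: "is_volterra corollary_symbol f (volterra_coeff f)" if "f \<in> hardy_space p" for f
    using hardy_space_summable[OF assms that] by (rule is_volterra_volterra_coeff)
  show ?thesis
    unfolding volterra_bounded_def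
  proof (intro conjI ballI bdd_aboveI)
    fix f assume f: "f \<in> hardy_space p"
    then have "volterra_coeff f \<in> hardy_space p"
      using C(2)[OF lift[OF f]] by (auto simp: hardy_space_def)
    with volterra[OF f] show "\<exists>h\<in>hardy_space p. is_volterra corollary_symbol f h"
      by blast
  next
    fix x assume "x \<in> {hardy_norm p h | f h. f \<in> hardy_space p \<and> hardy_norm p f \<le> 1 \<and> h \<in> hardy_space p \<and>
        is_volterra corollary_symbol f h}"
    then obtain f h where x: "x = hardy_norm p h" and f: "f \<in> hardy_space p" "hardy_norm p f \<le> 1"
      and h: "h \<in> hardy_space p" "is_volterra corollary_symbol f h" by blast
    define I where "I = (LINT z|torus_measure. cmod (bohr_lift p f z) powr p)"
    have "(I powr (1 / p)) powr p \<le> 1 powr p"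
      using f(2) assms by (intro powr_mono2) (auto simp: hardy_norm_def lp_functional_def I_def)
    then have I: "I \<le> 1"
      using assms by (simp add: powr_powr I_def integral_cmod_powr_nonneg)
    obtain H where H: "is_bohr_lift p (volterra_coeff f) H" "(LINT z|torus_measure. cmod (H z) powr p) \<le> C * I"
      using C(2)[OF lift[OF f(1)]] by (auto simp: I_def)
    have vf: "volterra_coeff f \<in> hardy_space p"
      using H by (auto simp: hardy_space_def)
    \<comment> \<open>The supremum runs over every \<open>h\<close> with \<open>is_volterra\<close>,
      so \<open>h\<close> is identified with \<open>volterra_coeff f\<close> through the common
      values of the two series on the real axis. Agreement for n \<ge> 1 is what determines the
      lift.\<close>
    have "h n = volterra_coeff f n" if n: "1 \<le> n" for n
    proof -
      have "h n - volterra_coeff f n = 0"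
      proof (rule dirichlet_series_eq_0[where a = "\<lambda>n. h n - volterra_coeff f n", OF _ _ n])
        have "summable (\<lambda>n. cmod (h n) * real n powr - 1 + cmod (volterra_coeff f n) * real n powr - 1)"
          by (intro summable_add hardy_space_summable[OF assms] h vf) auto
        then show "summable (\<lambda>n. cmod (h n - volterra_coeff f n) * real n powr - 1)"
        proof (rule summable_comparison_test'[where N = 0])
          have "cmod (h n - volterra_coeff f n) * real n powr - 1 \<le> (cmod (h n) + cmod (volterra_coeff f n)) * real n powr - 1" for n
            by (intro mult_right_mono norm_triangle_ineq4) simp
          then show "norm (cmod (h n - volterra_coeff f n) * real n powr - 1) \<le>
              cmod (h n) * real n powr - 1 + cmod (volterra_coeff f n) * real n powr - 1" for n
            by (simp only: distrib_right real_norm_def abs_mult abs_norm_cancel abs_of_nonneg[OF powr_ge_zero])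
        qed
        fix x :: real assume "1 \<le> x"
        then have s: "1 / 2 < Re (of_real x)" by simp
        have "(\<lambda>n. dirichlet_term h (of_real x) n - dirichlet_term (volterra_coeff f) (of_real x) n) sums
           (volterra_fun corollary_symbol f (of_real x) - volterra_fun corollary_symbol f (of_real x))"
          using h(2) volterra[OF f(1)] s unfolding is_volterra_def by (intro sums_diff) blast+
        then show "dirichlet_term (\<lambda>n. h n - volterra_coeff f n) (of_real x) sums 0"
          by (simp add: dirichlet_term_def[abs_def] left_diff_distrib)
      qed
      then show ?thesis by simp
    qed
    then have AE: "AE z in torus_measure. bohr_lift p h z = H z"
      by (intro bohr_lift_unique[OF assms lift[OF h(1)] H(1)])
    have meas: "bohr_lift p h \<in> borel_measurable torus_measure" "H \<in> borel_measurable torus_measure"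
      using lift[OF h(1)] H(1) by (simp_all add: is_bohr_lift_def)
    have "(LINT z|torus_measure. cmod (bohr_lift p h z) powr p) = (LINT z|torus_measure. cmod (H z) powr p)"
      using AE meas by (intro integral_cong_AE) auto
    also have "\<dots> \<le> C * 1"
      using H(2) mult_left_mono[OF I, of C] C by linarith
    finally have "(LINT z|torus_measure. cmod (bohr_lift p h z) powr p) \<le> C" by simp
    then show "x \<le> C powr (1 / p)"
      unfolding x hardy_norm_def lp_functional_def using assms
      by (intro powr_mono2 integral_cmod_powr_nonneg) auto
  qed
qed

end
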